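(* Let $d\ge 2$, let $p_1,\ldots,p_d$ be integers with $|p_i|\ge 2$ for $1\le i\le d$, write $r=p_d$, and let $\boldsymbol s=(s_1,\ldots,s_{d-1})\in\mathbb R^{d-1}$. For $0\le k<|r|$ let $\boldsymbol a_k=(a_k^{(1)},\ldots,a_k^{(d-1)})\in\mathbb R^{d-1}$, with $\boldsymbol a_0=(0,\ldots,0)$. Let $$A=\begin{pmatrix}\operatorname{diag}(p_1,\ldots,p_{d-1}) & -\boldsymbol s\\ 0& r\end{pmatrix},\qquad \widetilde{\mathcal D}=\{(\boldsymbol\iota+\boldsymbol a_k,\,k):\ 0\le k<|r|,\ \boldsymbol\iota\in\mathcal L_{d-1}\},$$ where $-\boldsymbol s$ is written as a column, $k$ ranges over integers, and $\mathcal L_{d-1}=\prod_{j=1}^{d-1}[0,|p_j|)\cap\mathbb Z^{d-1}$. Let $T=T(A,\widetilde{\mathcal D})$ be the corresponding self-affine tile. Then the following statements are equivalent. (1) The interior $T^\circ$ of $T$ is connected. (2) $T$ is a $d$-dimensional tame ball. (3) $$\max_{\substack{0\le k<|r|-1\\ 1\le j\le d-1}}\left|\frac{a_{k+1}^{(j)}-a_k^{(j)}}{p_j}-\frac{\operatorname{sign}(r)\,a_{|r|-1}^{(j)}+s_j}{p_j\,(p_j-\operatorname{sign}(r))}\right|<1.$$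
   Context: For an expanding matrix $A\in\mathbb R^{d\times d}$ (all eigenvalues have modulus greater than $1$) and a finite set $\mathcal D\subset\mathbb R^d$, $T(A,\mathcal D)$ denotes the unique nonempty compact set $T\subset\mathbb R^d$ with $AT=T+\mathcal D$, that is, $T=\{\sum_{k\ge1}A^{-k}d_k:\ d_k\in\mathcal D\}$ (elements of $\mathcal D$ are regarded as column vectors). $\operatorname{sign}(x)$ is $1$, $0$ or $-1$ according to $x>0$, $x=0$ or $x<0$. A set $E\subset\mathbb R^d$ is a ($d$-dimensional) tame ball if there is a homeomorphism from $E$ onto the closed $d$-dimensional unit ball that extends to a homeomorphism of $\mathbb R^d$ onto itself. *)

theory Defs
  imports "HOL-Analysis.Analysis"
begin

(* R^d with d = CARD('n) + 1 >= 2 is real ^ 'n option: the coordinates Some j are the first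
   d - 1 ones, the coordinate None is the last one. *)

(* T(A, D). The description determines T when A is expanding and D is finite and nonempty;
   otherwise the value may be unspecified. *)
definition self_affine_set :: "real ^ 'm ^ 'm \<Rightarrow> (real ^ 'm) set \<Rightarrow> (real ^ 'm) set" where
  "self_affine_set A D =
     (THE T. T \<noteq> {} \<and> compact T \<and> (\<lambda>x. A *v x) ` T = {t + d | t d. t \<in> T \<and> d \<in> D})"

definition tame_ball :: "'a::euclidean_space set \<Rightarrow> bool" where
  "tame_ball E \<longleftrightarrow>
     (\<exists>f g F G. homeomorphism E (cball (0::'a) 1) f g \<and> homeomorphism (UNIV :: 'a set) (UNIV :: 'a set) F G \<and>
        (\<forall>x\<in>E. F x = f x))"

definition tile_matrix ::
    "('n::finite option \<Rightarrow> int) \<Rightarrow> real ^ 'n \<Rightarrow> real ^ 'n option ^ 'n option" where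
  "tile_matrix p s = (\<chi> i j.
     case i of
       Some i' \<Rightarrow> (case j of
                    Some j' \<Rightarrow> if i' = j' then of_int (p (Some i')) else 0
                  | None \<Rightarrow> - (s $ i'))
     | None \<Rightarrow> (case j of
                    Some j' \<Rightarrow> 0
                  | None \<Rightarrow> of_int (p None)))"

definition box_digits :: "('n::finite option \<Rightarrow> int) \<Rightarrow> (real ^ 'n) set" where
  "box_digits p = {\<iota>. \<forall>j. \<iota> $ j \<in> \<int> \<and> 0 \<le> \<iota> $ j \<and> \<iota> $ j < of_int \<bar>p (Some j)\<bar>}"

definition append_coord :: "real ^ 'n \<Rightarrow> real \<Rightarrow> real ^ 'n option" where
  "append_coord x y = (\<chi> i. case i of Some j \<Rightarrow> x $ j | None \<Rightarrow> y)"

definition tile_digits ::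
    "('n::finite option \<Rightarrow> int) \<Rightarrow> (nat \<Rightarrow> real ^ 'n) \<Rightarrow> (real ^ 'n option) set" where
  "tile_digits p a =
     {append_coord (\<iota> + a k) (real k) | \<iota> k. k < nat \<bar>p None\<bar> \<and> \<iota> \<in> box_digits p}"

end

(* Over a height y the tile consists of one or two translates, by vectors g(y-) and g(y+), of a fixed
   unit box; g is a path with one-sided limits everywhere, whose jumps occur where the expansion of y
   in base r is ambiguous.  By self-similarity the largest jumps are those at the first digit, and these
   are the numbers in (3).  If a jump has a coordinate of size at least 1, the two boxes at that height
   have no common interior point, so this level separates the interior of the tile.

   If all jumps are smaller than 1, blow up the heights of the jumps to intervals, over which the first
   box shrinks to the intersection of the two and then grows to the second.  This gives a tube over an
   interval, whose fibres are boxes depending continuously on the height, hence a tame ball, and the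
   tile is its image under the map q that collapses the intervals again.  Bing's shrinking criterion
   turns q into a homeomorphism: the collapsed segments over one jump can be made short by a
   homeomorphism that preserves the tube and is close to the identity after q, because in every
   vertical line the part of the segment inside the tube is empty, everything, or bounded by one point
   c(x), which can be taken as the centre of the contraction. *)

theory Submission
  imports Defs
begin

section \<open>Homeomorphisms of Euclidean space\<close>

text \<open>If y has the remainders y_0 = y, y_1, ... and the digits e_0, e_1, ... in base r,
  solving the digit equations row by row gives the j-th coordinate of a point of T as the sum over n
  of (a_(e_n)^(j) + s_j y_n) / p_j^(n+1) plus an arbitrary expansion in base p_j. The latter fills a
  unit interval; the former is the path, with two values where y has two expansions. For negative r,
  multiplication by r reverses the order, so an approach from the right becomes one from the left at
  the next digit; the side of approach is therefore carried along as a boolean. The obstacle is that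
  a nonzero first jump recurs, scaled down, on a dense set of heights, so no finite composition of
  explicit maps removes all jumps. Giving the i-th height the weight 2^-i leaves only finitely many
  inserted intervals longer than a given bound. Each shrinking step treats these, and has to keep
  the infinitely many others from growing.\<close>

lemma bij_continuous_imp_homeomorphism:
  fixes f :: "'a::euclidean_space \<Rightarrow> 'a"
  assumes "continuous_on UNIV f" "inj f" "surj f"
  shows "\<exists>g. homeomorphism UNIV UNIV f g"
proof -
  obtain g where "homeomorphism UNIV (f ` UNIV) f g"
    by (rule invariance_of_domain_homeomorphism[OF open_UNIV assms(1) order_refl assms(2)])
  then show ?thesis using assms(3) by metis
qed

lemma homeomorphism_UNIV_simps:
  assumes "homeomorphism UNIV UNIV f g"
  shows "f (g y) = y" "g (f x) = x" "continuous_on A f" "continuous_on A g" "inj f" "surj f"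
proof -
  show fg: "f (g y) = y" and gf: "g (f x) = x" for x y
    using assms by (auto simp: homeomorphism_def)
  show "continuous_on A f" "continuous_on A g"
    using assms continuous_on_subset by (auto simp: homeomorphism_def)
  show "inj f" by (metis gf injI)
  show "surj f" by (metis fg surjI)
qed

text \<open>Each ray is rescaled by the ratio of the two norms, so \<open>F\<close> and
  \<open>G\<close> are mutually inverse by homogeneity. At the origin, where the ratio is 0 / 0,
  continuity comes from \<open>infnorm x \<le> norm x\<close>.\<close>

lemma radial_homeomorphism_infnorm:
  "\<exists>F G :: 'a::euclidean_space \<Rightarrow> 'a.
     homeomorphism UNIV UNIV F G \<and> F ` {x. infnorm x \<le> 1} = cball 0 1"
proof -
  define F where "F = (\<lambda>x::'a. (infnorm x / norm x) *\<^sub>R x)"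
  define G where "G = (\<lambda>x::'a. (norm x / infnorm x) *\<^sub>R x)"
  have nF: "norm (F x) = infnorm x" for x
    by (cases "x = 0") (auto simp: F_def infnorm_0 infnorm_pos_le)
  have F0: "F x = 0 \<longleftrightarrow> x = 0" for x
    using nF[of x] by (metis infnorm_eq_0 norm_eq_zero)
  have GF: "G (F x) = x" for x
    by (cases "x = 0") (auto simp: F_def G_def infnorm_mul infnorm_eq_0 infnorm_pos_le field_simps)
  have FG: "F (G x) = x" for x
    by (cases "x = 0") (auto simp: F_def G_def infnorm_mul infnorm_eq_0 infnorm_pos_le field_simps)
  have "isCont F x" for x
  proof (cases "x = 0")
    case True
    have "(F \<longlongrightarrow> 0) (at 0)"
    proof (rule Lim_null_comparison)
      show "\<forall>\<^sub>F x in at 0. norm (F x) \<le> norm x"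
        by (simp add: nF infnorm_le_norm)
      show "((\<lambda>x::'a. norm x) \<longlongrightarrow> 0) (at 0)"
        by (rule tendsto_norm_zero) (rule tendsto_ident_at)
    qed
    moreover have "F 0 = 0" using F0 by blast
    ultimately show ?thesis using True by (simp add: isCont_def)
  next
    case False
    have "continuous_on UNIV (infnorm :: 'a \<Rightarrow> real)"
      by (rule continuous_on_infnorm) (rule continuous_on_id)
    then have ci: "isCont infnorm x" by (simp add: continuous_on_eq_continuous_at)
    show ?thesis unfolding F_def
      by (intro continuous_intros ci) (use False in auto)
  qed
  then have cF: "continuous_on UNIV F"
    by (simp add: continuous_on_eq_continuous_at)
  have "inj F" by (metis GF injI)
  moreover have "surj F" by (metis FG surjI)
  ultimately obtain g where g: "homeomorphism UNIV UNIV F g"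
    using bij_continuous_imp_homeomorphism[OF cF] by auto
  have "F ` {x. infnorm x \<le> 1} = cball 0 1"
  proof
    show "F ` {x. infnorm x \<le> 1} \<subseteq> cball 0 1" by (auto simp: nF)
    show "cball 0 1 \<subseteq> F ` {x. infnorm x \<le> 1}"
    proof
      fix y :: 'a assume "y \<in> cball 0 1"
      then have "infnorm (G y) \<le> 1" using nF[of "G y"] by (simp add: FG)
      then show "y \<in> F ` {x. infnorm x \<le> 1}" using FG by (intro image_eqI[of _ _ "G y"]) auto
    qed
  qed
  with g show ?thesis by (intro exI conjI)
qed

text \<open>The constructions below end in a cube, whereas tameness refers to the Euclidean ball;
  the radial map joins the two on the whole space.\<close>

lemma tame_ballI:
  fixes E :: "'a::euclidean_space set" and \<Phi> \<Psi> :: "'a \<Rightarrow> 'a"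
  assumes h: "homeomorphism UNIV UNIV \<Phi> \<Psi>" and E: "\<Phi> ` E = {x. infnorm x \<le> 1}"
  shows "tame_ball E"
proof -
  obtain F G :: "'a \<Rightarrow> 'a"
    where FG: "homeomorphism UNIV UNIV F G" "F ` {x. infnorm x \<le> 1} = cball 0 1"
    using radial_homeomorphism_infnorm by blast
  have c: "homeomorphism UNIV UNIV (F \<circ> \<Phi>) (\<Psi> \<circ> G)"
    using homeomorphism_compose[OF h FG(1)] .
  have "(F \<circ> \<Phi>) ` E = cball 0 1" by (simp only: image_comp[symmetric] E FG(2))
  then have "homeomorphism E (cball 0 1) (F \<circ> \<Phi>) (\<Psi> \<circ> G)"
    by (intro homeomorphism_of_subsets[OF c]) auto
  with c show ?thesis unfolding tame_ball_def by blast
qed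

text \<open>The extension to the whole space preserves interiors in both directions, so the interior
  of \<open>E\<close> is a continuous image of the open ball.\<close>

lemma tame_ball_connected_interior:
  fixes E :: "'a::euclidean_space set"
  assumes "tame_ball E"
  shows "connected (interior E)"
proof -
  obtain f g F G where fg: "homeomorphism E (cball (0::'a) 1) f g"
    and FG: "homeomorphism (UNIV :: 'a set) (UNIV :: 'a set) F G"
    and eq: "\<forall>x\<in>E. F x = f x"
    using assms unfolding tame_ball_def by blast
  have FE: "F ` E = cball 0 1"
    using fg eq by (auto simp: homeomorphism_def image_def)
  have GE: "G ` cball 0 1 = E"
    unfolding FE[symmetric] by (simp add: image_image homeomorphism_UNIV_simps[OF FG])
  have GF: "homeomorphism UNIV UNIV G F" using FG by (rule homeomorphism_symD)
  have "interior E = G ` ball 0 1"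
  proof
    have "interior (G ` cball 0 1) \<subseteq> G ` interior (cball 0 1)"
      by (rule interior_image_subset)
        (use homeomorphism_UNIV_simps(5)[OF GF] homeomorphism_UNIV_simps(3)[OF GF, of UNIV] in
          \<open>auto simp: continuous_on_eq_continuous_at\<close>)
    then show "interior E \<subseteq> G ` ball 0 1" by (simp add: GE interior_cball)
    have "interior (F ` E) \<subseteq> F ` interior E"
      by (rule interior_image_subset)
        (use homeomorphism_UNIV_simps(5)[OF FG] homeomorphism_UNIV_simps(3)[OF FG, of UNIV] in
          \<open>auto simp: continuous_on_eq_continuous_at\<close>)
    then have "G ` ball 0 1 \<subseteq> G ` F ` interior E" by (simp add: FE interior_cball image_mono)
    then show "G ` ball 0 1 \<subseteq> interior E" by (simp add: image_image homeomorphism_UNIV_simps[OF FG])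
  qed
  then show ?thesis
    using connected_continuous_image[OF homeomorphism_UNIV_simps(4)[OF FG]] by simp
qed

section \<open>Shrinking the fibres of a map\<close>

text \<open>The pairs at distance at least \<open>e\<close> form a compact set. On it the distance
  of the images is positive, hence bounded below by its minimum.\<close>

lemma small_fibres_uniform:
  fixes F :: "'a::metric_space \<Rightarrow> 'b::metric_space"
  assumes C: "compact C" and F: "continuous_on C F"
    and fib: "\<And>a b. a \<in> C \<Longrightarrow> b \<in> C \<Longrightarrow> F a = F b \<Longrightarrow> dist a b < e"
  shows "\<exists>\<rho>>0. \<forall>a\<in>C. \<forall>b\<in>C. dist (F a) (F b) < \<rho> \<longrightarrow> dist a b < e"
proof -
  define S where "S = (C \<times> C) \<inter> {z. e \<le> dist (fst z) (snd z)}"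
  have "closed {z :: 'a \<times> 'a. e \<le> dist (fst z) (snd z)}"
    by (intro closed_Collect_le continuous_intros)
  then have S: "compact S"
    unfolding S_def using C by (intro compact_Int_closed compact_Times)
  show ?thesis
  proof (cases "S = {}")
    case True
    then have "\<forall>a\<in>C. \<forall>b\<in>C. dist a b < e" by (force simp: S_def)
    then show ?thesis using zero_less_one by blast
  next
    case False
    have "continuous_on (C \<times> C) (\<lambda>z. dist (F (fst z)) (F (snd z)))"
      by (intro continuous_intros continuous_on_compose2[OF F]) auto
    then have "continuous_on S (\<lambda>z. dist (F (fst z)) (F (snd z)))"
      by (rule continuous_on_subset) (auto simp: S_def)
    then obtain z where z: "z \<in> S" "\<And>w. w \<in> S \<Longrightarrow> dist (F (fst z)) (F (snd z)) \<le> dist (F (fst w)) (F (snd w))"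
      using continuous_attains_inf[OF S False] by meson
    have "dist (F (fst z)) (F (snd z)) > 0"
      using z(1) fib[of "fst z" "snd z"] by (auto simp: S_def)
    moreover have "dist a b < e" if "a \<in> C" "b \<in> C" "dist (F a) (F b) < dist (F (fst z)) (F (snd z))" for a b
    proof (rule ccontr)
      assume "\<not> dist a b < e"
      then have "(a, b) \<in> S" using that by (auto simp: S_def)
      with z(2) that(3) show False by force
    qed
    ultimately show ?thesis by blast
  qed
qed

text \<open>Bing's shrinking criterion: if small fibres can be achieved by composing \<open>q\<close> with
  homeomorphisms close to the given one, then a uniform limit of such compositions is injective.\<close>

lemma shrinking_criterion:
  fixes q :: "'a::euclidean_space \<Rightarrow> 'a"
  assumes cq: "continuous_on UNIV q" and sq: "surj q" and bq: "\<And>a. dist (q a) a \<le> C"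
    and K: "compact K"
    and H: "H = {h. (\<exists>g. homeomorphism UNIV UNIV h g) \<and> h ` K = K}"
    and shrink: "\<And>h e n. h \<in> H \<Longrightarrow> e > 0 \<Longrightarrow> \<exists>h'\<in>H. (\<forall>a. dist (q (h' a)) (q (h a)) < e) \<and>
        (\<forall>a\<in>cball 0 (real n). \<forall>b\<in>cball 0 (real n). q (h' a) = q (h' b) \<longrightarrow> dist a b < 1 / real (Suc n))"
  shows "\<exists>f g. homeomorphism UNIV UNIV f g \<and> f ` K = q ` K"
proof -
  \<comment> \<open>Besides the homeomorphism the recursion carries a tolerance \<rho>: points of
    the ball of radius \<open>n\<close> whose images under \<open>q \<circ> h\<close> are
    \<rho>-close lie within \<open>1 / (n + 1)\<close>. Growing balls exhaust the noncompact space;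
    stage 0, which starts from the identity, makes no such demand.\<close>
  define P where "P = (\<lambda>n (h, \<rho>). h \<in> H \<and> 0 < \<rho> \<and> \<rho> \<le> (1/2)^n \<and>
     (n > 0 \<longrightarrow> (\<forall>a\<in>cball 0 (real n). \<forall>b\<in>cball 0 (real n). 
         dist (q (h a)) (q (h b)) < \<rho> \<longrightarrow> dist a b < 1 / real (Suc n))))"
  \<comment> \<open>With steps below \<rho>/8 and tolerances at least halved, all stages after the
    \<open>n\<close>-th together move an image by at most \<rho>/4. Two points with the same limit
    then have \<open>n\<close>-th images at distance at most \<rho>/2, inside the tolerance.\<close>
  define Q where "Q = (\<lambda>(n::nat) (h :: 'a \<Rightarrow> 'a, \<rho>) (h', \<rho>'). (\<forall>a. dist (q (h' a)) (q (h a)) < \<rho> / 8) \<and> \<rho>' \<le> \<rho> / (2::real))"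
  have qh: "continuous_on A (\<lambda>a. q (h a))" if hH: "h \<in> H" for h A
  proof -
    obtain g where "homeomorphism UNIV UNIV h g" using hH H by auto
    then show ?thesis
      by (intro continuous_on_compose2[OF cq]) (auto simp: homeomorphism_UNIV_simps)
  qed
  have "\<exists>X. \<forall>n. P n (X n) \<and> Q n (X n) (X (Suc n))"
  proof (rule dependent_nat_choice)
    have "id \<in> H" unfolding H using homeomorphism_ident[of UNIV] by (auto simp: id_def)
    then show "\<exists>X. P 0 X" by (intro exI[of _ "(id, 1)"]) (auto simp: P_def)
  next
    fix X :: "('a \<Rightarrow> 'a) \<times> real" and n assume X: "P n X"
    obtain h \<rho> where X': "X = (h, \<rho>)" by force
    have h: "h \<in> H" "0 < \<rho>" "\<rho> \<le> (1/2)^n" using X by (auto simp: P_def X')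
    obtain h' where h': "h' \<in> H" "\<forall>a. dist (q (h' a)) (q (h a)) < \<rho> / 8"
        "\<forall>a\<in>cball 0 (real (Suc n)). \<forall>b\<in>cball 0 (real (Suc n)). q (h' a) = q (h' b) \<longrightarrow> dist a b < 1 / real (Suc (Suc n))"
      using shrink[OF h(1), of "\<rho> / 8" "Suc n"] h(2) by auto
    obtain \<sigma> where \<sigma>: "\<sigma> > 0" "\<forall>a\<in>cball 0 (real (Suc n)). \<forall>b\<in>cball 0 (real (Suc n)). 
        dist (q (h' a)) (q (h' b)) < \<sigma> \<longrightarrow> dist a b < 1 / real (Suc (Suc n))"
      using small_fibres_uniform[OF compact_cball qh[OF h'(1)], of 0 "real (Suc n)" "1 / real (Suc (Suc n))"] h'(3) by blast
    have "P (Suc n) (h', min \<sigma> (\<rho> / 2)) \<and> Q n X (h', min \<sigma> (\<rho> / 2))"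
      using h h' \<sigma> by (auto simp: P_def Q_def X')
    then show "\<exists>Y. P (Suc n) Y \<and> Q n X Y" by blast
  qed
  then obtain X where X: "\<And>n. P n (X n)" "\<And>n. Q n (X n) (X (Suc n))" by blast
  define h where "h = (\<lambda>n. fst (X n))"
  define \<rho> where "\<rho> = (\<lambda>n. snd (X n))"
  have Xn: "X n = (h n, \<rho> n)" for n by (simp add: h_def \<rho>_def)
  have hH: "h n \<in> H" and \<rho>0: "\<rho> n > 0" and \<rho>le: "\<rho> n \<le> (1/2)^n" for n
    using X(1)[of n] by (auto simp: P_def Xn)
  have inj: "dist a b < 1 / real (Suc n)"
    if "n > 0" "a \<in> cball 0 (real n)" "b \<in> cball 0 (real n)" "dist (q (h n a)) (q (h n b)) < \<rho> n" for n a b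
    using X(1)[of n] that by (auto simp: P_def Xn)
  have step: "dist (q (h (Suc n) a)) (q (h n a)) < \<rho> n / 8" and \<rho>step: "\<rho> (Suc n) \<le> \<rho> n / 2" for n a
    using X(2)[of n] by (auto simp: Q_def Xn)
  \<comment> \<open>Since \<open>\<rho> (Suc n) \<le> \<rho> n / 2\<close>, a step of
    \<open>\<rho> n / 8\<close> is at most \<open>(\<rho> n - \<rho> (Suc n)) / 4\<close>, and these
    bounds telescope.\<close>
  have tele: "dist (q (h (n + m) a)) (q (h n a)) \<le> (\<rho> n - \<rho> (n + m)) / 4" for n m a
  proof (induction m)
    case (Suc m)
    have "dist (q (h (n + Suc m) a)) (q (h n a)) \<le> dist (q (h (Suc (n + m)) a)) (q (h (n + m) a)) + dist (q (h (n + m) a)) (q (h n a))"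
      by (simp add: dist_triangle)
    then show ?case using Suc step[of "n + m" a] \<rho>step[of "n + m"] by simp
  qed simp
  have \<rho>lim: "\<rho> \<longlonglongrightarrow> 0"
    by (rule tendsto_sandwich[of "\<lambda>_. 0" _ _ "\<lambda>n. (1/2)^n"])
       (auto intro!: always_eventually less_imp_le[OF \<rho>0] \<rho>le LIMSEQ_power_zero)
  have "Cauchy (\<lambda>n. q (h n a))" for a
  proof (rule metric_CauchyI)
    fix e :: real assume "e > 0"
    then obtain N where N: "\<And>n. n \<ge> N \<Longrightarrow> \<rho> n < e"
      using order_tendstoD(2)[OF \<rho>lim] by (auto simp: eventually_sequentially)
    have "dist (q (h n a)) (q (h N a)) < e / 2" if n: "n \<ge> N" for n
      using tele[of N "n - N" a] \<rho>0[of n] N[of N] n zero_le_dist[of "q (h n a)" "q (h N a)"] by (simp del: zero_le_dist)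
    then show "\<exists>M. \<forall>m\<ge>M. \<forall>n\<ge>M. dist (q (h m a)) (q (h n a)) < e"
      by (metis dist_triangle_half_l)
  qed
  then have "\<forall>a. \<exists>l. (\<lambda>n. q (h n a)) \<longlonglongrightarrow> l"
    by (simp add: Cauchy_convergent_iff convergent_def)
  then obtain f where f: "\<And>a. (\<lambda>n. q (h n a)) \<longlonglongrightarrow> f a"
    using choice[of "\<lambda>a l. (\<lambda>n. q (h n a)) \<longlonglongrightarrow> l"] by blast
  have dist_f: "dist (f a) (q (h n a)) \<le> \<rho> n / 4" for n a
  proof -
    have "(\<lambda>m. q (h (m + n) a)) \<longlonglongrightarrow> f a" using f LIMSEQ_ignore_initial_segment by blast
    then have "(\<lambda>m. dist (q (h (m + n) a)) (q (h n a))) \<longlonglongrightarrow> dist (f a) (q (h n a))"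
      by (intro tendsto_intros)
    moreover have "dist (q (h (m + n) a)) (q (h n a)) \<le> \<rho> n / 4" for m
      using tele[of n m a] \<rho>0[of "n + m"] by (simp add: add.commute)
    ultimately show ?thesis by (intro LIMSEQ_le_const2) auto
  qed
  have "uniform_limit UNIV (\<lambda>n a. q (h n a)) f sequentially"
  proof (rule uniform_limitI)
    fix e :: real assume "e > 0"
    then have "\<forall>\<^sub>F n in sequentially. \<rho> n < e" using order_tendstoD(2)[OF \<rho>lim] by blast
    then show "\<forall>\<^sub>F n in sequentially. \<forall>a\<in>UNIV. dist (q (h n a)) (f a) < e"
    proof eventually_elim
      case (elim n)
      show ?case
      proof
        fix a show "dist (q (h n a)) (f a) < e"
          using dist_f[of a n] elim \<rho>0[of n] by (simp add: dist_commute)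
      qed
    qed
  qed
  then have cf: "continuous_on UNIV f"
    by (rule uniform_limit_theorem[rotated]) (auto intro!: always_eventually qh hH)
  have "inj f"
  proof (rule injI, rule ccontr)
    fix a b assume ab: "f a = f b" "a \<noteq> b"
    obtain n0 where n0: "norm a \<le> real n0" "norm b \<le> real n0"
      using real_arch_simple[of "max (norm a) (norm b)"] by auto
    obtain n1 where n1: "1 / real (Suc n1) < dist a b"
      using reals_Archimedean[of "dist a b"] ab(2) by (auto simp: inverse_eq_divide)
    define n where "n = Suc (max n0 n1)"
    have "dist (q (h n a)) (q (h n b)) \<le> dist (f a) (q (h n a)) + dist (f a) (q (h n b))"
      by (metis dist_commute dist_triangle)
    also have "\<dots> < \<rho> n" using dist_f[of a n] dist_f[of b n] \<rho>0[of n] ab(1) by simp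
    finally have "dist a b < 1 / real (Suc n)"
      using n0 by (intro inj) (auto simp: n_def)
    also have "\<dots> \<le> 1 / real (Suc n1)" by (simp add: n_def frac_le)
    finally show False using n1 by simp
  qed
  have hsurj: "surj (h n)" and hK: "h n ` K = K" for n
    using hH[of n] H by (auto dest: homeomorphism_UNIV_simps(6))
  \<comment> \<open>Uniform limits of surjections need not be onto. Here the preimages of
    \<open>y\<close> under the approximations stay in a compact set, because \<open>q\<close> and
    all later stages move points only boundedly far from \<open>h 0\<close>; a convergent
    subsequence gives a preimage under \<open>f\<close>. Taking \<open>S = UNIV\<close> yields
    surjectivity, \<open>S = K\<close> the image of \<open>K\<close>.\<close>
  have lift: "\<exists>a\<in>S. f a = y" if S: "closed S" and y: "\<And>n. \<exists>a\<in>S. q (h n a) = y" for S y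
  proof -
    obtain a where a: "\<And>n. a n \<in> S" "\<And>n. q (h n (a n)) = y" using y by metis
    have d1: "dist (f (a n)) y \<le> 1" for n
      using dist_f[of "a n" n] \<rho>le[of n] power_le_one[of "1/2::real" n] by (simp add: a(2))
    have "\<exists>B. \<forall>n. norm (a n) \<le> B"
    proof -
      obtain g where g: "homeomorphism UNIV UNIV (h 0) g" using hH[of 0] H by auto
      have "compact (g ` cball y (C + \<rho> 0 + 1))"
        by (intro compact_continuous_image homeomorphism_UNIV_simps[OF g] compact_cball)
      then obtain B where B: "\<And>x. x \<in> g ` cball y (C + \<rho> 0 + 1) \<Longrightarrow> norm x \<le> B"
        using compact_imp_bounded bounded_iff by metis
      have "a n \<in> g ` cball y (C + \<rho> 0 + 1)" for n
      proof -
        have "dist y (h 0 (a n)) \<le> dist y (f (a n)) + dist (f (a n)) (q (h 0 (a n))) + dist (q (h 0 (a n))) (h 0 (a n))"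
          using dist_triangle[of y "h 0 (a n)" "f (a n)"] dist_triangle[of "f (a n)" "h 0 (a n)" "q (h 0 (a n))"] by simp
        also have "\<dots> \<le> 1 + \<rho> 0 + C"
          using d1[of n] dist_f[of "a n" 0] bq[of "h 0 (a n)"] \<rho>0[of 0] by (simp add: dist_commute)
        finally show ?thesis
          by (intro image_eqI[of _ _ "h 0 (a n)"]) (auto simp: homeomorphism_UNIV_simps[OF g])
      qed
      then show ?thesis using B by blast
    qed
    then obtain B where B: "\<And>n. norm (a n) \<le> B" by blast
    have "compact (S \<inter> cball 0 B)" using S by (metis closed_Int_compact compact_cball)
    moreover have "\<forall>n. a n \<in> S \<inter> cball 0 B" using a(1) B by simp
    ultimately obtain l r where l: "l \<in> S \<inter> cball 0 B" "strict_mono r" "(a \<circ> r) \<longlonglongrightarrow> l"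
      unfolding compact_def by metis
    have "isCont f l" using cf by (simp add: continuous_on_eq_continuous_at)
    then have "(\<lambda>n. f (a (r n))) \<longlonglongrightarrow> f l"
      using l(3) by (auto simp: o_def intro: isCont_tendsto_compose)
    moreover have "(\<lambda>n. f (a (r n))) \<longlonglongrightarrow> y"
    proof (rule metric_tendsto_imp_tendsto)
      show "(\<lambda>n. \<rho> (r n)) \<longlonglongrightarrow> 0" using LIMSEQ_subseq_LIMSEQ[OF \<rho>lim l(2)] by (simp add: o_def)
      show "\<forall>\<^sub>F n in sequentially. dist (f (a (r n))) y \<le> dist (\<rho> (r n)) 0"
      proof (intro always_eventually allI)
        fix n show "dist (f (a (r n))) y \<le> dist (\<rho> (r n)) 0"
          using dist_f[of "a (r n)" "r n"] \<rho>0[of "r n"] a(2)[of "r n"] by simp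
      qed
    qed
    ultimately have "f l = y" using LIMSEQ_unique by blast
    then show ?thesis using l(1) by blast
  qed
  have "\<exists>a\<in>UNIV. f a = y" for y
  proof (rule lift)
    show "\<exists>a\<in>UNIV. q (h n a) = y" for n using sq hsurj[of n] by (metis UNIV_I surjD)
  qed simp
  then have "surj f" by (auto simp: surj_def eq_commute)
  with bij_continuous_imp_homeomorphism[OF cf \<open>inj f\<close>]
  obtain g where g: "homeomorphism UNIV UNIV f g" by blast
  have "f ` K = q ` K"
  proof
    have cl: "closed (q ` K)"
      by (meson K compact_continuous_image compact_imp_closed continuous_on_subset cq subset_UNIV)
    show "f ` K \<subseteq> q ` K"
    proof clarify
      fix a assume "a \<in> K"
      then have "q (h n a) \<in> q ` K" for n using hK[of n] by blast
      with cl f[of a] show "f a \<in> q ` K" by (metis closed_sequentially)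
    qed
    show "q ` K \<subseteq> f ` K"
    proof
      fix y assume "y \<in> q ` K"
      then have "\<exists>a\<in>K. q (h n a) = y" for n using hK[of n] by (metis imageE)
      then obtain a where "a \<in> K" "f a = y" using lift[OF compact_imp_closed[OF K]] by blast
      then show "y \<in> f ` K" by blast
    qed
  qed
  with g show ?thesis by blast
qed

section \<open>Shrinking one vertical gap of a column\<close>

lemma bounded_displacement_surj:
  fixes f :: "real \<Rightarrow> real"
  assumes "continuous_on UNIV f" "\<And>x. \<bar>f x - x\<bar> \<le> C"
  shows "\<exists>x. f x = y"
proof -
  have "C \<ge> 0" using assms(2)[of 0] by linarith
  then have "\<exists>x. y - C \<le> x \<and> x \<le> y + C \<and> f x = y"
    using assms(2)[of "y - C"] assms(2)[of "y + C"] continuous_on_subset[OF assms(1)]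
    by (intro IVT') (auto simp: abs_le_iff)
  then show ?thesis by blast
qed

text \<open>Piecewise affine with slope 1 outside \<open>[a, b]\<close>. The single clamped formula
  makes continuity visible jointly in \<open>x\<close> and in the four end points, which will depend
  on the height.\<close>

definition stretch :: "real \<Rightarrow> real \<Rightarrow> real \<Rightarrow> real \<Rightarrow> real \<Rightarrow> real" where
  "stretch a b a' b' x =
     (min x a - a) + (a' + (b' - a') / (b - a) * (max a (min b x) - a)) + (max x b - b)"

lemma stretch_strict_mono:
  assumes "a < b" "a' < b'" "x < y"
  shows "stretch a b a' b' x < stretch a b a' b' y"
proof -
  define m where "m = (b' - a') / (b - a)"
  have m: "m > 0" using assms by (simp add: m_def)
  have mid: "m * (max a (min b x) - a) \<le> m * (max a (min b y) - a)"
    using m assms by (intro mult_left_mono) auto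
  consider "x < a" | "b < y" | "a \<le> x" "y \<le> b" by linarith
  then show ?thesis
  proof cases
    case 3
    then have "m * (max a (min b x) - a) < m * (max a (min b y) - a)"
      using m assms by (intro mult_strict_left_mono) auto
    then show ?thesis using 3 assms unfolding stretch_def m_def by auto
  qed (use mid assms in \<open>auto simp: stretch_def m_def[symmetric]\<close>)
qed

lemma stretch_ends:
  assumes "a < b"
  shows "stretch a b a' b' a = a'" "stretch a b a' b' b = b'"
  using assms by (auto simp: stretch_def)

lemma stretch_id: "a < b \<Longrightarrow> stretch a b a b x = x"
  by (auto simp: stretch_def)

text \<open>The displacement is a convex combination of those of the two end points, the weight
  \<theta> being the clamped relative position of \<open>x\<close> in \<open>[a, b]\<close>.\<close>

lemma stretch_displacement:
  assumes "a < b" "\<bar>a' - a\<bar> \<le> e" "\<bar>b' - b\<bar> \<le> e"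
  shows "\<bar>stretch a b a' b' x - x\<bar> \<le> e"
proof -
  define \<theta> where "\<theta> = (max a (min b x) - a) / (b - a)"
  have \<theta>: "0 \<le> \<theta>" "\<theta> \<le> 1" using assms(1) by (auto simp: \<theta>_def divide_simps)
  have cl: "max a (min b x) - a = \<theta> * (b - a)" using assms(1) by (simp add: \<theta>_def)
  have "stretch a b a' b' x = (min x a - a) + (a' + (b' - a') * \<theta>) + (max x b - b)"
    unfolding stretch_def cl using assms(1) by simp
  moreover have "x = (min x a - a) + (a + \<theta> * (b - a)) + (max x b - b)"
    using assms(1) unfolding cl[symmetric] by auto
  ultimately have "stretch a b a' b' x - x = (1 - \<theta>) * (a' - a) + \<theta> * (b' - b)"
    by (simp add: algebra_simps)
  also have "\<bar>\<dots>\<bar> \<le> (1 - \<theta>) * \<bar>a' - a\<bar> + \<theta> * \<bar>b' - b\<bar>"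
    using \<theta> by (metis abs_mult abs_of_nonneg abs_triangle_ineq diff_ge_0_iff_ge)
  also have "\<dots> \<le> (1 - \<theta>) * e + \<theta> * e"
    using \<theta> assms by (intro add_mono mult_left_mono) auto
  finally show ?thesis by (simp add: algebra_simps)
qed

lemma stretch_in_iff:
  assumes "a < b" "a' < b'"
  shows "a' \<le> stretch a b a' b' x \<and> stretch a b a' b' x \<le> b' \<longleftrightarrow> a \<le> x \<and> x \<le> b"
  by (metis assms linorder_not_less stretch_ends stretch_strict_mono order_le_less)

lemma stretch_bij:
  assumes "a < b" "a' < b'"
  shows "\<exists>x. stretch a b a' b' x = y"
proof (rule bounded_displacement_surj)
  show "continuous_on UNIV (stretch a b a' b')"
    unfolding stretch_def using assms by (intro continuous_intros) auto
  show "\<bar>stretch a b a' b' x - x\<bar> \<le> max \<bar>a' - a\<bar> \<bar>b' - b\<bar>" for x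
    using assms by (intro stretch_displacement) auto
qed

abbreviation clip :: "real \<Rightarrow> real \<Rightarrow> real \<Rightarrow> real" where
  "clip u v t \<equiv> max u (min v t)"

text \<open>Where \<open>b\<close> is 1 on \<open>[u, v]\<close>, this is the contraction towards
  \<open>c\<close> by the factor \<kappa>. Outside, a point is shifted like the nearer end of the
  interval, damped by \<open>b\<close>.\<close>

definition squeeze :: "real \<Rightarrow> real \<Rightarrow> (real \<Rightarrow> real) \<Rightarrow> real \<Rightarrow> real \<Rightarrow> real \<Rightarrow> real" where
  "squeeze u v b \<kappa> c t = t + (1 - \<kappa>) * (c - clip u v t) * b t"

context
  fixes u v \<kappa> c :: real and b :: "real \<Rightarrow> real"
  assumes uv: "u < v" and \<kappa>: "0 < \<kappa>" "\<kappa> \<le> 1" and c: "u \<le> c" "c \<le> v"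
    and cont_b: "continuous_on UNIV b" and b01: "\<And>t. 0 \<le> b t" "\<And>t. b t \<le> 1"
    and b_mid: "\<And>t. u \<le> t \<Longrightarrow> t \<le> v \<Longrightarrow> b t = 1"
    and b_left: "\<And>x y. x \<le> y \<Longrightarrow> y \<le> u \<Longrightarrow> b x \<le> b y"
    and b_right: "\<And>x y. x \<le> y \<Longrightarrow> v \<le> x \<Longrightarrow> b y \<le> b x"
begin

lemma squeeze_mid: "u \<le> t \<Longrightarrow> t \<le> v \<Longrightarrow> squeeze u v b \<kappa> c t = c + \<kappa> * (t - c)"
  by (simp add: squeeze_def algebra_simps max_def min_def b_mid)

text \<open>Outside \<open>[u, v]\<close> the displacement is itself nondecreasing: left of
  \<open>u\<close> it is a nonnegative multiple of \<open>b\<close>, which increases there, and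
  right of \<open>v\<close> a nonpositive multiple of \<open>b\<close>, which decreases there. So
  strict monotonicity holds however steep \<open>b\<close> is; inside, the slope is
  \<kappa>.\<close>

lemma squeeze_strict_mono:
  assumes "x < y" shows "squeeze u v b \<kappa> c x < squeeze u v b \<kappa> c y"
proof -
  have 1: "squeeze u v b \<kappa> c x < squeeze u v b \<kappa> c y" if "x < y" "y \<le> u" for x y
  proof -
    have "(1 - \<kappa>) * (c - u) * b x \<le> (1 - \<kappa>) * (c - u) * b y"
      using \<kappa> c that b_left[of x y] by (intro mult_left_mono) auto
    moreover have "clip u v x = u" "clip u v y = u" using that uv by auto
    ultimately show ?thesis using that by (simp add: squeeze_def)
  qed
  have 2: "squeeze u v b \<kappa> c x < squeeze u v b \<kappa> c y" if "x < y" "u \<le> x" "y \<le> v" for x y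
    using that \<kappa> by (simp add: squeeze_mid)
  have 3: "squeeze u v b \<kappa> c x < squeeze u v b \<kappa> c y" if "x < y" "v \<le> x" for x y
  proof -
    have "(1 - \<kappa>) * (v - c) * b y \<le> (1 - \<kappa>) * (v - c) * b x"
      using \<kappa> c that b_right[of x y] by (intro mult_left_mono) auto
    moreover have "clip u v x = v" "clip u v y = v" using that uv by auto
    moreover have "(1 - \<kappa>) * (c - v) * a = - ((1 - \<kappa>) * (v - c) * a)" for a by (simp add: algebra_simps)
    ultimately show ?thesis using that by (simp add: squeeze_def)
  qed
  have 4: "squeeze u v b \<kappa> c x < squeeze u v b \<kappa> c y" if "x < y" "u \<le> x" for x y
    by (metis 2 3 linorder_le_less_linear order_le_less that order_less_trans order_less_imp_le)
  show ?thesis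
    by (metis 1 4 assms linorder_le_less_linear order_le_less order_less_trans order_less_imp_le)
qed

lemma squeeze_fix: "squeeze u v b \<kappa> c c = c"
  using c by (simp add: squeeze_mid)

text \<open>The fixed point \<open>c\<close> is never crossed. This is what keeps a column invariant
  when \<open>c\<close> is the height at which a vertical line leaves or enters it.\<close>

lemma squeeze_le_iff:
  "squeeze u v b \<kappa> c t \<le> c \<longleftrightarrow> t \<le> c" "c \<le> squeeze u v b \<kappa> c t \<longleftrightarrow> c \<le> t"
  by (metis linorder_not_less order_le_less squeeze_fix squeeze_strict_mono)+

lemma squeeze_surj: "\<exists>t. squeeze u v b \<kappa> c t = y"
proof (rule bounded_displacement_surj)
  show "continuous_on UNIV (squeeze u v b \<kappa> c)"
    unfolding squeeze_def using cont_b by (intro continuous_intros)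
  fix t
  have "\<bar>squeeze u v b \<kappa> c t - t\<bar> = (1 - \<kappa>) * \<bar>c - clip u v t\<bar> * b t"
    using \<kappa> b01 by (simp add: squeeze_def abs_mult)
  also have "\<dots> \<le> 1 * (v - u) * 1"
    using uv c \<kappa> b01 by (intro mult_mono) auto
  finally show "\<bar>squeeze u v b \<kappa> c t - t\<bar> \<le> v - u" by simp
qed

end

section \<open>Columns with boxes as fibres\<close>

abbreviation column :: "(real \<Rightarrow> real ^ 'n) \<Rightarrow> (real \<Rightarrow> real ^ 'n) \<Rightarrow> ((real ^ 'n) \<times> real) set" where
  "column \<alpha> \<beta> \<equiv> {z. fst z \<in> cbox (\<alpha> (snd z)) (\<beta> (snd z))}"

text \<open>The fibres are stretched coordinate by coordinate at fixed height. This serves twice: to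
  freeze the fibres on both sides of a gap, and to turn a whole tube into a box.\<close>

lemma column_stretch:
  fixes \<alpha> \<beta> \<alpha>' \<beta>' :: "real \<Rightarrow> real ^ 'n"
  assumes cont: "continuous_on UNIV \<alpha>" "continuous_on UNIV \<beta>" "continuous_on UNIV \<alpha>'" "continuous_on UNIV \<beta>'"
    and pos: "\<And>t j. \<alpha> t $ j < \<beta> t $ j" "\<And>t j. \<alpha>' t $ j < \<beta>' t $ j"
  defines "S \<equiv> (\<lambda>z. (\<chi> j. stretch (\<alpha> (snd z) $ j) (\<beta> (snd z) $ j) (\<alpha>' (snd z) $ j) (\<beta>' (snd z) $ j) (fst z $ j), snd z))"
  shows "\<exists>S'. homeomorphism UNIV UNIV S S'"
    and "S z \<in> column \<alpha>' \<beta>' \<longleftrightarrow> z \<in> column \<alpha> \<beta>"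
proof -
  have cS: "continuous_on UNIV S"
    unfolding S_def stretch_def
    by (intro continuous_intros continuous_on_vec_lambda continuous_on_compose2[OF cont(1)]
        continuous_on_compose2[OF cont(2)] continuous_on_compose2[OF cont(3)] continuous_on_compose2[OF cont(4)])
      (simp_all add: less_imp_neq[OF pos(1), symmetric])
  have "inj S"
  proof (rule injI)
    fix z w assume eq: "S z = S w"
    then have t: "snd z = snd w" by (simp add: S_def)
    have "fst z $ j = fst w $ j" for j
    proof -
      have "stretch (\<alpha> (snd z) $ j) (\<beta> (snd z) $ j) (\<alpha>' (snd z) $ j) (\<beta>' (snd z) $ j) (fst z $ j)
          = stretch (\<alpha> (snd z) $ j) (\<beta> (snd z) $ j) (\<alpha>' (snd z) $ j) (\<beta>' (snd z) $ j) (fst w $ j)"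
        using eq t by (simp add: S_def vec_eq_iff)
      then show ?thesis by (metis linorder_neqE order_less_irrefl pos stretch_strict_mono)
    qed
    with t show "z = w" by (simp add: prod_eq_iff vec_eq_iff)
  qed
  moreover have "surj S"
  proof (rule surjI)
    fix w :: "(real^'n) \<times> real"
    define x where "x = (\<chi> j. SOME x. stretch (\<alpha> (snd w) $ j) (\<beta> (snd w) $ j) (\<alpha>' (snd w) $ j) (\<beta>' (snd w) $ j) x = fst w $ j)"
    have "stretch (\<alpha> (snd w) $ j) (\<beta> (snd w) $ j) (\<alpha>' (snd w) $ j) (\<beta>' (snd w) $ j) (x $ j) = fst w $ j" for j
      unfolding x_def by (simp add: someI_ex[OF stretch_bij[OF pos]])
    then show "S (x, snd w) = w" by (simp add: S_def prod_eq_iff vec_eq_iff)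
  qed
  ultimately show "\<exists>S'. homeomorphism UNIV UNIV S S'"
    by (intro bij_continuous_imp_homeomorphism cS)
  show "S z \<in> column \<alpha>' \<beta>' \<longleftrightarrow> z \<in> column \<alpha> \<beta>"
    by (simp add: S_def mem_box_cart stretch_in_iff[OF pos])
qed

text \<open>The homeomorphism pulls the segments over \<open>[u, v]\<close> towards \<open>c\<close>. It tapers off as a function of
  \<open>Y t\<close>, not of \<open>t\<close>: every other gap of \<open>Y\<close>, however close, is then essentially translated and does
  not become longer.\<close>

lemma gap_shrinking:
  fixes \<alpha> \<beta> :: "real \<Rightarrow> real ^ 'n" and c :: "real ^ 'n \<Rightarrow> real"
  assumes cont: "continuous_on UNIV \<alpha>" "continuous_on UNIV \<beta>"
    and pos: "\<And>t j. \<alpha> t $ j < \<beta> t $ j"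
    and uv: "u < v" and Y: "continuous_on UNIV Y" "mono Y" "\<And>t. Y t = y \<longleftrightarrow> t \<in> {u..v}"
    and cc: "\<And>x x'. \<bar>c x - c x'\<bar> \<le> C * norm (x - x')" and c: "\<And>x. c x \<in> {u..v}"
    and gap: "\<And>x t. t \<in> {u..v} \<Longrightarrow> x \<in> cbox (\<alpha> t) (\<beta> t) \<longleftrightarrow>
        (t \<le> c x \<and> x \<in> cbox (\<alpha> u) (\<beta> u)) \<or> (c x \<le> t \<and> x \<in> cbox (\<alpha> v) (\<beta> v))"
    and \<delta>: "\<delta> > 0"
  shows "\<exists>K k. homeomorphism UNIV UNIV K k \<and>
    (\<forall>z. \<delta> \<le> \<bar>Y (snd z) - y\<bar> \<longrightarrow> K z = z) \<and>
    (\<forall>z. dist (fst (K z)) (fst z) < \<delta>) \<and>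
    (\<forall>z. K z \<in> column \<alpha> \<beta> \<longleftrightarrow> z \<in> column \<alpha> \<beta>) \<and>
    (\<forall>x t t'. Y t = Y t' \<longrightarrow> dist (K (x, t)) (K (x, t')) < (if Y t = y then 0 else \<bar>t - t'\<bar>) + \<delta>)"
proof -
  \<comment> \<open>\<epsilon> will bound the motion of each coordinate under one stretch.
    \<open>M\<close> collects the total error: \<open>4 * CARD('n) * \<epsilon>\<close> from two
    horizontal displacements, and \<open>\<bar>C\<bar> * 2 * CARD('n) * \<epsilon>\<close> from the
    resulting change of \<open>c\<close>.\<close>
  define M where "M = real CARD('n) * (4 + 2 * \<bar>C\<bar>)"
  define \<epsilon> where "\<epsilon> = \<delta> / (M + 1)"
  have M: "M \<ge> 0" by (simp add: M_def)
  then have \<epsilon>: "\<epsilon> > 0" and \<epsilon>M: "M * \<epsilon> < \<delta>" using \<delta> by (auto simp: \<epsilon>_def divide_simps)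
  have \<epsilon>\<delta>: "4 * (real CARD('n) * \<epsilon>) + \<bar>C\<bar> * (2 * (real CARD('n) * \<epsilon>)) < \<delta>"
    using \<epsilon>M by (simp add: M_def algebra_simps)
  have "(\<alpha> \<longlongrightarrow> \<alpha> t0) (nhds t0)" "(\<beta> \<longlongrightarrow> \<beta> t0) (nhds t0)" for t0
    using cont by (simp_all add: continuous_on_eq_continuous_at isCont_def flip: tendsto_at_iff_tendsto_nhds)
  then have ev: "\<forall>\<^sub>F t in nhds t0. dist (\<alpha> t) (\<alpha> t0) < \<epsilon> \<and> dist (\<beta> t) (\<beta> t0) < \<epsilon>" for t0
    using \<epsilon> by (auto simp: tendsto_iff eventually_conj_iff)
  obtain \<delta>u where \<delta>u: "\<delta>u > 0" "\<And>t. dist t u < \<delta>u \<Longrightarrow> dist (\<alpha> t) (\<alpha> u) < \<epsilon> \<and> dist (\<beta> t) (\<beta> u) < \<epsilon>"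
    using ev[of u] unfolding eventually_nhds_metric by blast
  obtain \<delta>v where \<delta>v: "\<delta>v > 0" "\<And>t. dist t v < \<delta>v \<Longrightarrow> dist (\<alpha> t) (\<alpha> v) < \<epsilon> \<and> dist (\<beta> t) (\<beta> v) < \<epsilon>"
    using ev[of v] unfolding eventually_nhds_metric by blast
  \<comment> \<open>The slab \<open>\<bar>Y t - y\<bar> < \<eta>\<close> has to stay less than
    \<open>\<delta>u\<close> below \<open>u\<close> and less than \<open>\<delta>v\<close> above
    \<open>v\<close>. Both differences are positive because \<open>Y\<close> takes the value
    \<open>y\<close> on \<open>[u, v]\<close> only.\<close>
  define \<eta> where "\<eta> = min \<delta> (min (y - Y (u - \<delta>u)) (Y (v + \<delta>v) - y))"
  have Yu: "Y u = y" and Yv: "Y v = y" using Y(3) uv by auto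
  have "Y (u - \<delta>u) \<noteq> y" "Y (v + \<delta>v) \<noteq> y" using Y(3) \<delta>u(1) \<delta>v(1) uv by auto
  moreover have "Y (u - \<delta>u) \<le> y" "y \<le> Y (v + \<delta>v)"
    using monoD[OF Y(2), of "u - \<delta>u" u] monoD[OF Y(2), of v "v + \<delta>v"] \<delta>u(1) \<delta>v(1) Yu Yv by auto
  ultimately have \<eta>: "\<eta> > 0" "\<eta> \<le> \<delta>" using \<delta> by (auto simp: \<eta>_def)
  have slab_u: "u - t < \<delta>u" if "\<bar>Y t - y\<bar> < \<eta>" for t
    using that monoD[OF Y(2), of t "u - \<delta>u"] by (force simp: \<eta>_def)
  have slab_v: "t - v < \<delta>v" if "\<bar>Y t - y\<bar> < \<eta>" for t
    using that monoD[OF Y(2), of "v + \<delta>v" t] by (force simp: \<eta>_def)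
  have near: "dist (\<alpha> (clip u v t)) (\<alpha> t) < \<epsilon> \<and> dist (\<beta> (clip u v t)) (\<beta> t) < \<epsilon>"
    if t: "\<bar>Y t - y\<bar> < \<eta>" for t
  proof -
    consider "t < u" | "u \<le> t" "t \<le> v" | "v < t" by linarith
    then show ?thesis
    proof cases
      case 1
      then have "clip u v t = u" using uv by auto
      moreover have "dist t u < \<delta>u" using slab_u[OF t] 1 by (simp add: dist_real_def)
      ultimately show ?thesis using \<delta>u(2)[of t] by (simp add: dist_commute)
    next
      case 2
      then have "clip u v t = t" by auto
      then show ?thesis using \<epsilon> by simp
    next
      case 3
      then have "clip u v t = v" using uv by auto
      moreover have "dist t v < \<delta>v" using slab_v[OF t] 3 by (simp add: dist_real_def)
      ultimately show ?thesis using \<delta>v(2)[of t] by (simp add: dist_commute)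
    qed
  qed
  define \<kappa> where "\<kappa> = min 1 (\<delta> / (2 * (v - u)))"
  have \<kappa>: "0 < \<kappa>" "\<kappa> \<le> 1" "\<kappa> * (v - u) < \<delta>"
  proof -
    show "0 < \<kappa>" "\<kappa> \<le> 1" using uv \<delta> by (auto simp: \<kappa>_def)
    have "\<kappa> * (v - u) \<le> \<delta> / (2 * (v - u)) * (v - u)"
      using uv by (intro mult_right_mono) (auto simp: \<kappa>_def)
    also have "\<dots> = \<delta> / 2" using uv by (simp add: field_simps)
    also have "\<dots> < \<delta>" using \<delta> by simp
    finally show "\<kappa> * (v - u) < \<delta>" .
  qed
  \<comment> \<open>Outside the gap the fibres are frozen at their values over \<open>u\<close> and
    \<open>v\<close>, so that a vertical motion there cannot leave the column. On the slab this
    moves the corners of a fibre by less than \<epsilon>.\<close>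
  define \<alpha>' where "\<alpha>' = (\<lambda>t. \<alpha> (clip u v t))"
  define \<beta>' where "\<beta>' = (\<lambda>t. \<beta> (clip u v t))"
  define S where "S = (\<lambda>z::(real^'n) \<times> real. (\<chi> j. stretch (\<alpha> (snd z) $ j) (\<beta> (snd z) $ j)
      (\<alpha>' (snd z) $ j) (\<beta>' (snd z) $ j) (fst z $ j), snd z))"
  have cont': "continuous_on UNIV \<alpha>'" "continuous_on UNIV \<beta>'"
    unfolding \<alpha>'_def \<beta>'_def
    by (intro continuous_on_compose2[OF cont(1)] continuous_on_compose2[OF cont(2)] continuous_intros; simp)+
  have pos': "\<And>t j. \<alpha>' t $ j < \<beta>' t $ j" using pos by (simp add: \<alpha>'_def \<beta>'_def)
  obtain S' where S': "homeomorphism UNIV UNIV S S'"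
    using column_stretch(1)[OF cont cont' pos pos'] unfolding S_def by blast
  have Scol: "S z \<in> column \<alpha>' \<beta>' \<longleftrightarrow> z \<in> column \<alpha> \<beta>" for z
    unfolding S_def by (rule column_stretch(2)[OF cont cont' pos pos'])
  have sndS: "snd (S z) = snd z" for z by (simp add: S_def)
  have sndS': "snd (S' z) = snd z" for z
    by (metis sndS homeomorphism_UNIV_simps(1)[OF S'])
  define b where "b = (\<lambda>t. max 0 (1 - \<bar>Y t - y\<bar> / \<eta>))"
  have cb: "continuous_on UNIV b"
    unfolding b_def using \<eta> by (intro continuous_intros Y(1)) auto
  have b: "\<And>t. 0 \<le> b t" "\<And>t. b t \<le> 1" "\<And>t. u \<le> t \<Longrightarrow> t \<le> v \<Longrightarrow> b t = 1"
    using \<eta> Y(3)[THEN iffD2] by (simp_all add: b_def)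
  have b_left: "b s \<le> b t" if "s \<le> t" "t \<le> u" for s t
  proof -
    have "\<bar>Y t - y\<bar> \<le> \<bar>Y s - y\<bar>"
      using monoD[OF Y(2) that(1)] monoD[OF Y(2) that(2)] Yu by auto
    then show ?thesis unfolding b_def using \<eta>
      by (intro max.mono order_refl diff_left_mono divide_right_mono) auto
  qed
  have b_right: "b t \<le> b s" if "s \<le> t" "v \<le> s" for s t
  proof -
    have "\<bar>Y s - y\<bar> \<le> \<bar>Y t - y\<bar>"
      using monoD[OF Y(2) that(1)] monoD[OF Y(2) that(2)] Yv by auto
    then show ?thesis unfolding b_def using \<eta>
      by (intro max.mono order_refl diff_left_mono divide_right_mono) auto
  qed
  have cont_c: "continuous_on UNIV c"
  proof (rule continuous_on_eq_continuous_at[THEN iffD2, OF open_UNIV], rule ballI)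
    fix x :: "real ^ 'n"
    have "((\<lambda>x'. C * norm (x' - x)) \<longlongrightarrow> C * norm (x - x)) (at x)" by (intro tendsto_intros)
    then have "((\<lambda>x'. C * norm (x' - x)) \<longlongrightarrow> 0) (at x)" by simp
    then have "((\<lambda>x'. c x' - c x) \<longlongrightarrow> 0) (at x)"
      by (rule Lim_null_comparison[rotated]) (use cc in auto)
    then show "isCont c x" by (simp add: isCont_def LIM_zero_iff)
  qed
  define E where "E = (\<lambda>z::(real^'n) \<times> real. (fst z, squeeze u v b \<kappa> (c (fst z)) (snd z)))"
  have cu: "u \<le> c x" "c x \<le> v" for x using c[of x] by auto
  note sq = uv \<kappa>(1,2) cu cb b b_left b_right
  have "\<exists>E'. homeomorphism UNIV UNIV E E'"
  proof (rule bij_continuous_imp_homeomorphism)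
    show "continuous_on UNIV E" unfolding E_def squeeze_def
      by (intro continuous_intros continuous_on_compose2[OF cont_c] continuous_on_compose2[OF cb]) auto
    show "inj E"
    proof (rule injI)
      fix z w assume eq: "E z = E w"
      then have x: "fst z = fst w" by (simp add: E_def)
      have "squeeze u v b \<kappa> (c (fst z)) (snd z) = squeeze u v b \<kappa> (c (fst z)) (snd w)"
        using eq x by (simp add: E_def)
      then have "snd z = snd w"
        by (metis linorder_neqE order_less_irrefl squeeze_strict_mono[OF sq])
      with x show "z = w" by (simp add: prod_eq_iff)
    qed
    show "surj E"
    proof (rule surjI)
      fix w
      show "E (fst w, SOME t. squeeze u v b \<kappa> (c (fst w)) t = snd w) = w"
        by (simp add: E_def prod_eq_iff someI_ex[OF squeeze_surj[OF sq]])
    qed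
  qed
  then obtain E' where E': "homeomorphism UNIV UNIV E E'" by blast
  have Ecol: "E z \<in> column \<alpha>' \<beta>' \<longleftrightarrow> z \<in> column \<alpha>' \<beta>'" for z
  proof -
    define t' where "t' = squeeze u v b \<kappa> (c (fst z)) (snd z)"
    have le: "t' \<le> c (fst z) \<longleftrightarrow> snd z \<le> c (fst z)" "c (fst z) \<le> t' \<longleftrightarrow> c (fst z) \<le> snd z"
      unfolding t'_def using squeeze_le_iff(1)[OF sq] squeeze_le_iff(2)[OF sq] by blast+
    have "clip u v t' \<le> c (fst z) \<longleftrightarrow> clip u v (snd z) \<le> c (fst z)"
      "c (fst z) \<le> clip u v t' \<longleftrightarrow> c (fst z) \<le> clip u v (snd z)"
      using le cu[of "fst z"] by (auto simp: max_def min_def)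
    moreover have "fst z \<in> cbox (\<alpha>' t) (\<beta>' t) \<longleftrightarrow>
        (clip u v t \<le> c (fst z) \<and> fst z \<in> cbox (\<alpha> u) (\<beta> u)) \<or>
        (c (fst z) \<le> clip u v t \<and> fst z \<in> cbox (\<alpha> v) (\<beta> v))" for t
      unfolding \<alpha>'_def \<beta>'_def by (rule gap) (use uv in auto)
    ultimately have "fst z \<in> cbox (\<alpha>' t') (\<beta>' t') \<longleftrightarrow> fst z \<in> cbox (\<alpha>' (snd z)) (\<beta>' (snd z))"
      by (simp only:)
    then show ?thesis by (simp add: E_def t'_def)
  qed
  define K where "K = S' \<circ> (E \<circ> S)"
  have K: "homeomorphism UNIV UNIV K (S' \<circ> E' \<circ> S)"
    unfolding K_def
    using homeomorphism_compose[OF homeomorphism_compose[OF S' E'] homeomorphism_symD[OF S']] .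
  have Kid: "K z = z" if z: "\<eta> \<le> \<bar>Y (snd z) - y\<bar>" for z
  proof -
    have "b (snd z) = 0" using z \<eta> by (simp add: b_def)
    then have "E (S z) = S z" by (simp add: E_def squeeze_def sndS prod_eq_iff)
    then show ?thesis by (simp add: K_def homeomorphism_UNIV_simps[OF S'])
  qed
  have Smove: "\<bar>fst (S z) $ j - fst z $ j\<bar> \<le> \<epsilon>" if z: "\<bar>Y (snd z) - y\<bar> < \<eta>" for z j
  proof -
    have "\<bar>\<alpha>' (snd z) $ j - \<alpha> (snd z) $ j\<bar> \<le> \<epsilon>" "\<bar>\<beta>' (snd z) $ j - \<beta> (snd z) $ j\<bar> \<le> \<epsilon>"
      using near[OF z] component_le_norm_cart[of "\<alpha>' (snd z) - \<alpha> (snd z)" j]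
        component_le_norm_cart[of "\<beta>' (snd z) - \<beta> (snd z)" j]
      by (auto simp: \<alpha>'_def \<beta>'_def dist_norm)
    then show ?thesis
      using stretch_displacement[OF pos] by (simp add: S_def)
  qed
  \<comment> \<open>\<open>K\<close> is injective and fixes every point outside the slab, so it
    cannot send a point of the slab there.\<close>
  have Kin: "\<bar>Y (snd (K z)) - y\<bar> < \<eta>" if "\<bar>Y (snd z) - y\<bar> < \<eta>" for z
  proof (rule ccontr)
    assume nb: "\<not> \<bar>Y (snd (K z)) - y\<bar> < \<eta>"
    then have "K (K z) = K z" by (intro Kid) simp
    then have "K z = z" by (rule injD[OF homeomorphism_UNIV_simps(5)[OF K]])
    with nb that show False by simp
  qed
  have fst_near: "norm (fst (K z) - fst z) \<le> 2 * (real CARD('n) * \<epsilon>)" for z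
  proof (cases "\<bar>Y (snd z) - y\<bar> < \<eta>")
    case True
    have "S (K z) = E (S z)" by (simp add: K_def homeomorphism_UNIV_simps[OF S'])
    then have "fst (S (K z)) = fst (S z)" by (simp add: E_def)
    then have "\<bar>(fst (K z) - fst z) $ j\<bar> \<le> 2 * \<epsilon>" for j
      using Smove[OF True, of j] Smove[OF Kin[OF True], of j] by simp
    then have "(\<Sum>j\<in>UNIV. \<bar>(fst (K z) - fst z) $ j\<bar>) \<le> (\<Sum>j\<in>(UNIV::'n set). 2 * \<epsilon>)"
      by (intro sum_mono)
    then show ?thesis
      using norm_le_l1_cart[of "fst (K z) - fst z"] by simp
  next
    case False
    then show ?thesis using Kid \<epsilon> by simp
  qed
  have C\<epsilon>: "0 \<le> \<bar>C\<bar> * (2 * (real CARD('n) * \<epsilon>))" "0 \<le> real CARD('n) * \<epsilon>" using \<epsilon> by auto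
  have fst_dist: "dist (fst (K z)) (fst z) < \<delta>" for z
    unfolding dist_norm using fst_near[of z] \<epsilon>\<delta> C\<epsilon> by linarith
  moreover have col_K: "K z \<in> column \<alpha> \<beta> \<longleftrightarrow> z \<in> column \<alpha> \<beta>" for z
    using Scol[of "K z"] Scol[of z] Ecol[of "S z"] by (simp add: K_def homeomorphism_UNIV_simps[OF S'])
  moreover have "dist (K (x, t)) (K (x, t')) < \<delta>" if t: "t \<in> {u..v}" "t' \<in> {u..v}" for x t t'
  proof -
    have Sid: "S (x, t) = (x, t)" if "t \<in> {u..v}" for t
    proof -
      have "clip u v t = t" using that by auto
      then show ?thesis by (simp add: S_def \<alpha>'_def \<beta>'_def stretch_id[OF pos])
    qed
    have Kt: "K (x, t) = (x, c x + \<kappa> * (t - c x))" if t: "t \<in> {u..v}" for t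
    proof -
      have "(1 - \<kappa>) * c x + \<kappa> * t \<in> {u..v}"
        using convexD[OF convex_real_interval(5), of "c x" u v t "1 - \<kappa>" \<kappa>] c[of x] t \<kappa> by auto
      then have "c x + \<kappa> * (t - c x) \<in> {u..v}" by (simp add: algebra_simps)
      then have "S' (x, c x + \<kappa> * (t - c x)) = (x, c x + \<kappa> * (t - c x))"
        using Sid homeomorphism_UNIV_simps(2)[OF S', of "(x, c x + \<kappa> * (t - c x))"] by simp
      then show ?thesis using t by (simp add: K_def Sid E_def squeeze_mid[OF sq])
    qed
    have "dist (K (x, t)) (K (x, t')) = \<bar>\<kappa> * (t - t')\<bar>"
      by (simp add: Kt[OF t(1)] Kt[OF t(2)] dist_Pair_Pair dist_real_def algebra_simps)
    also have "\<dots> \<le> \<kappa> * (v - u)"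
      using t \<kappa> by (auto simp: abs_mult intro!: mult_left_mono)
    finally show ?thesis using \<kappa> by simp
  qed
  \<comment> \<open>Two times in another gap are clipped to the same end and have the same damping
    \<open>b\<close>. Their vertical displacements therefore differ only through \<open>c\<close>,
    evaluated at the two nearby points into which \<open>S\<close> moves \<open>x\<close>.\<close>
  moreover have "dist (K (x, t)) (K (x, t')) < \<bar>t - t'\<bar> + \<delta>" if t: "Y t = Y t'" "Y t \<noteq> y" for x t t'
  proof (cases "\<bar>Y t - y\<bar> < \<eta>")
    case True
    have cl: "clip u v t = clip u v t'"
    proof -
      have nt: "t \<notin> {u..v}" "t' \<notin> {u..v}" using t Y(3) by metis+
      have "\<not> (t < u \<and> v < t')" "\<not> (t' < u \<and> v < t)"
        using t(2) monoD[OF Y(2), of t u] monoD[OF Y(2), of v t'] monoD[OF Y(2), of t' u] monoD[OF Y(2), of v t] Yu Yv unfolding t(1)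
        by auto
      with nt show ?thesis by auto
    qed
    have sndK: "snd (K (x, s)) = s + (1 - \<kappa>) * (c (fst (S (x, s))) - clip u v s) * b s" for s
      by (simp add: K_def sndS' E_def sndS squeeze_def)
    have bt: "b t = b t'" using t by (simp add: b_def)
    define c1 where "c1 = c (fst (S (x, t)))"
    define c2 where "c2 = c (fst (S (x, t')))"
    have "snd (K (x, t)) - snd (K (x, t')) = (t - t') + (1 - \<kappa>) * b t * (c1 - c2)"
      unfolding sndK cl bt[symmetric] c1_def[symmetric] c2_def[symmetric] by (simp add: algebra_simps)
    moreover have "\<bar>(1 - \<kappa>) * b t * (c1 - c2)\<bar> \<le> 1 * 1 * \<bar>c1 - c2\<bar>"
      unfolding abs_mult using \<kappa> b by (intro mult_mono) auto
    ultimately have "\<bar>snd (K (x, t)) - snd (K (x, t'))\<bar> \<le> \<bar>t - t'\<bar> + \<bar>c1 - c2\<bar>"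
      using abs_triangle_ineq[of "t - t'" "(1 - \<kappa>) * b t * (c1 - c2)"] by simp
    moreover have "\<bar>c1 - c2\<bar> \<le> \<bar>C\<bar> * (2 * (real CARD('n) * \<epsilon>))"
    proof -
      have "\<bar>(fst (S (x, t)) - fst (S (x, t'))) $ j\<bar> \<le> 2 * \<epsilon>" for j
        using Smove[of "(x, t)" j] Smove[of "(x, t')" j] True t by simp
      then have "(\<Sum>j\<in>UNIV. \<bar>(fst (S (x, t)) - fst (S (x, t'))) $ j\<bar>) \<le> (\<Sum>j\<in>(UNIV::'n set). 2 * \<epsilon>)"
        by (intro sum_mono)
      then have "norm (fst (S (x, t)) - fst (S (x, t'))) \<le> 2 * (real CARD('n) * \<epsilon>)"
        using norm_le_l1_cart[of "fst (S (x, t)) - fst (S (x, t'))"] by simp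
      then have "\<bar>C\<bar> * norm (fst (S (x, t)) - fst (S (x, t'))) \<le> \<bar>C\<bar> * (2 * (real CARD('n) * \<epsilon>))"
        by (intro mult_left_mono) auto
      moreover have "C * norm (fst (S (x, t)) - fst (S (x, t'))) \<le> \<bar>C\<bar> * norm (fst (S (x, t)) - fst (S (x, t')))"
        by (intro mult_right_mono) auto
      ultimately show ?thesis using cc unfolding c1_def c2_def by (meson order_trans)
    qed
    moreover have "norm (fst (K (x, t)) - fst (K (x, t'))) \<le> 4 * (real CARD('n) * \<epsilon>)"
      using fst_near[of "(x, t)"] fst_near[of "(x, t')"] norm_triangle_ineq4[of "fst (K (x, t)) - x" "fst (K (x, t')) - x"] by simp
    moreover have "dist (K (x, t)) (K (x, t')) \<le> norm (fst (K (x, t)) - fst (K (x, t'))) + \<bar>snd (K (x, t)) - snd (K (x, t'))\<bar>"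
      using sqrt_sum_squares_le_sum[of "dist (fst (K (x, t))) (fst (K (x, t')))" "dist (snd (K (x, t))) (snd (K (x, t')))"]
      by (simp add: dist_prod_def dist_norm)
    ultimately show ?thesis using \<epsilon>\<delta> by linarith
  next
    case False
    then have "K (x, t) = (x, t)" "K (x, t') = (x, t')" using t Kid[of "(x, t)"] Kid[of "(x, t')"] by auto
    then show ?thesis using \<delta> by (simp add: dist_Pair_Pair dist_real_def)
  qed
  moreover have id_K: "K z = z" if "\<delta> \<le> \<bar>Y (snd z) - y\<bar>" for z
    using Kid that \<eta> by (meson order_trans)
  ultimately have "dist (K (x, t)) (K (x, t')) < (if Y t = y then 0 else \<bar>t - t'\<bar>) + \<delta>"
    if "Y t = Y t'" for x t t'
    using that Y(3)[of t] Y(3)[of t'] by (cases "Y t = y") auto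
  with K show ?thesis using fst_dist col_K id_K by (intro exI[of _ K] exI) blast
qed

section \<open>Blowing up a sequence of points to intervals\<close>

text \<open>The identity plus the left continuous pure jump function with weight
  \<open>(1/2)^i\<close> at \<open>d i\<close>; \<open>jump_hi\<close> is the right continuous
  version. Heights listed repeatedly accumulate their weights. The interval between the two values
  is the one to which \<open>y\<close> is blown up.\<close>

definition jump_lo :: "(nat \<Rightarrow> real) \<Rightarrow> real \<Rightarrow> real" where
  "jump_lo d y = y + (\<Sum>i. if d i < y then (1/2)^i else 0)"

definition jump_hi :: "(nat \<Rightarrow> real) \<Rightarrow> real \<Rightarrow> real" where
  "jump_hi d y = y + (\<Sum>i. if d i \<le> y then (1/2)^i else 0)"

text \<open>The generalised inverse of the jump function, constant on each inserted interval;
  \<open>collapse_ex1\<close> justifies the description.\<close>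

definition collapse :: "(nat \<Rightarrow> real) \<Rightarrow> real \<Rightarrow> real" where
  "collapse d t = (THE y. jump_lo d y \<le> t \<and> t \<le> jump_hi d y)"

lemma summable_half: "summable (\<lambda>i. if P i then (1/2::real)^i else 0)"
  by (rule summable_comparison_test[of _ "\<lambda>i. (1/2)^i"]) (auto simp: summable_geometric)

lemma suminf_half_bounds: "0 \<le> (\<Sum>i. if P i then (1/2::real)^i else 0)" "(\<Sum>i. if P i then (1/2::real)^i else 0) \<le> 2"
proof -
  show "0 \<le> (\<Sum>i. if P i then (1/2::real)^i else 0)"
    by (intro suminf_nonneg summable_half) auto
  have "(\<Sum>i. if P i then (1/2::real)^i else 0) \<le> (\<Sum>i. (1/2)^i)"
    by (intro suminf_le summable_half summable_geometric) auto
  then show "(\<Sum>i. if P i then (1/2::real)^i else 0) \<le> 2"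
    by (simp add: suminf_geometric)
qed

lemma suminf_half_tail:
  assumes "\<And>i. i < N \<Longrightarrow> \<not> P i"
  shows "(\<Sum>i. if P i then (1/2::real)^i else 0) \<le> 2 * (1/2)^N"
proof -
  have "(\<Sum>i. if P i then (1/2::real)^i else 0) = (\<Sum>i. if P (i + N) then (1/2::real)^(i + N) else 0)
      + (\<Sum>i<N. if P i then (1/2::real)^i else 0)"
    by (rule suminf_split_initial_segment[OF summable_half])
  also have "(\<Sum>i<N. if P i then (1/2::real)^i else 0) = 0" using assms by simp
  also have "(\<lambda>i. if P (i + N) then (1/2::real)^(i + N) else 0) = (\<lambda>i. (1/2)^N * (if P (i + N) then (1/2)^i else 0))"
    by (auto simp: power_add)
  also have "(\<Sum>i. (1/2)^N * (if P (i + N) then (1/2::real)^i else 0)) = (1/2)^N * (\<Sum>i. if P (i + N) then (1/2)^i else 0)"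
    by (rule suminf_mult[OF summable_half])
  also have "\<dots> \<le> (1/2)^N * 2"
    using suminf_half_bounds(2)[of "\<lambda>i. P (i + N)"] by (intro mult_left_mono) auto
  finally show ?thesis by (simp add: mult.commute)
qed

text \<open>Reflection turns \<open>d i \<le> y\<close> into the complement of
  \<open>- d i < - y\<close>, and all weights sum to 2. Thus right continuity of
  \<open>jump_hi\<close> can be read off from left continuity of \<open>jump_lo\<close>.\<close>

lemma jump_hi_reflect: "jump_hi d y = 2 - jump_lo (\<lambda>i. - d i) (- y)"
proof -
  have "(\<Sum>i. if d i \<le> y then (1/2::real)^i else 0) + (\<Sum>i. if - d i < - y then (1/2)^i else 0)
      = (\<Sum>i. (if d i \<le> y then (1/2)^i else 0) + (if - d i < - y then (1/2)^i else 0))"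
    by (rule suminf_add[OF summable_half summable_half])
  also have "(\<lambda>i. (if d i \<le> y then (1/2::real)^i else 0) + (if - d i < - y then (1/2)^i else 0)) = (\<lambda>i. (1/2)^i)"
    by auto
  finally show ?thesis by (simp add: jump_hi_def jump_lo_def suminf_geometric)
qed

lemma jump_hi_minus_lo: "jump_hi d y - jump_lo d y = (\<Sum>i. if d i = y then (1/2)^i else 0)"
proof -
  have "(\<Sum>i. if d i \<le> y then (1/2::real)^i else 0) - (\<Sum>i. if d i < y then (1/2)^i else 0)
      = (\<Sum>i. (if d i \<le> y then (1/2)^i else 0) - (if d i < y then (1/2)^i else 0))"
    by (rule suminf_diff[OF summable_half summable_half])
  also have "(\<lambda>i. (if d i \<le> y then (1/2::real)^i else 0) - (if d i < y then (1/2)^i else 0))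
      = (\<lambda>i. if d i = y then (1/2)^i else 0)"
    by auto
  finally show ?thesis by (simp add: jump_hi_def jump_lo_def)
qed

lemma jump_lo_le_hi: "jump_lo d y \<le> jump_hi d y"
  using jump_hi_minus_lo[of d y] suminf_half_bounds(1)[of "\<lambda>i. d i = y"] by linarith

lemma jump_lo_less_hi: 
  assumes "y \<in> range d" shows "jump_lo d y < jump_hi d y"
proof -
  obtain i where i: "d i = y" using assms by auto
  have "0 < (\<Sum>i. if d i = y then (1/2::real)^i else 0)"
    by (rule suminf_pos2[OF summable_half, of _ i]) (auto simp: i)
  then show ?thesis using jump_hi_minus_lo[of d y] by linarith
qed

lemma jump_lo_eq_hi: 
  assumes "y \<notin> range d" shows "jump_lo d y = jump_hi d y"
proof -
  have "d i \<noteq> y" for i using assms by auto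
  then show ?thesis using jump_hi_minus_lo[of d y] by simp
qed

text \<open>Only indices from \<open>N\<close> on contribute, so all but finitely many gaps are
  shorter than any given bound.\<close>

lemma jump_width: "(\<And>i. i < N \<Longrightarrow> d i \<noteq> y) \<Longrightarrow> jump_hi d y - jump_lo d y \<le> 2 * (1/2)^N"
  unfolding jump_hi_minus_lo by (rule suminf_half_tail)

lemma jump_bounds: "y \<le> jump_lo d y" "jump_hi d y \<le> y + 2"
  using suminf_half_bounds by (simp_all add: jump_lo_def jump_hi_def)

text \<open>Every weight counted up to \<open>y\<close> is counted before \<open>y'\<close> too. So
  the inserted intervals are disjoint, in order, and at least as far apart as their heights, which
  makes \<open>collapse\<close> 1-Lipschitz.\<close>

lemma jump_gap: "y < y' \<Longrightarrow> jump_hi d y + (y' - y) \<le> jump_lo d y'"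
proof -
  assume "y < y'"
  then have "(\<Sum>i. if d i \<le> y then (1/2::real)^i else 0) \<le> (\<Sum>i. if d i < y' then (1/2)^i else 0)"
    by (intro suminf_le summable_half) auto
  then show ?thesis by (simp add: jump_lo_def jump_hi_def)
qed

text \<open>A finite partial sum already exceeds \<open>t - y\<close>, and its finitely many heights
  below \<open>y\<close> remain below every \<open>x\<close> close enough to
  \<open>y\<close>.\<close>

lemma jump_lo_left:
  assumes t: "t < jump_lo d y"
  shows "\<exists>y'<y. t < jump_lo d y'"
proof -
  define f where "f = (\<lambda>i. if d i < y then (1/2::real)^i else 0)"
  have "(\<lambda>N. \<Sum>i<N. f i) \<longlonglongrightarrow> suminf f"
    unfolding f_def by (rule summable_LIMSEQ[OF summable_half])
  moreover have "t - y < suminf f" using t by (simp add: jump_lo_def f_def)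
  ultimately have "\<forall>\<^sub>F N in sequentially. t - y < (\<Sum>i<N. f i)" by (rule order_tendstoD)
  then obtain N where N: "t - y < (\<Sum>i<N. f i)" by (auto simp: eventually_sequentially)
  have id: "((\<lambda>x. x) \<longlongrightarrow> y) (at_left y)" by (rule tendsto_ident_at)
  have "\<forall>\<^sub>F x in at_left y. \<forall>i\<in>{..<N}. d i < y \<longrightarrow> d i < x"
    by (intro eventually_ball_finite) (auto intro: order_tendstoD(1)[OF id])
  moreover have "\<forall>\<^sub>F x in at_left y. t - (\<Sum>i<N. f i) < x"
    using N by (intro order_tendstoD(1)[OF id]) linarith
  moreover have "\<forall>\<^sub>F x in at_left y. x < y" by (simp add: eventually_at_filter)
  ultimately have "\<forall>\<^sub>F x in at_left y. (\<forall>i\<in>{..<N}. d i < y \<longrightarrow> d i < x) \<and> t - (\<Sum>i<N. f i) < x \<and> x < y"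
    by eventually_elim auto
  then have "\<exists>x. (\<forall>i\<in>{..<N}. d i < y \<longrightarrow> d i < x) \<and> t - (\<Sum>i<N. f i) < x \<and> x < y"
    by (rule eventually_happens'[OF trivial_limit_at_left_real])
  then obtain x where x: "\<forall>i\<in>{..<N}. d i < y \<longrightarrow> d i < x" "t - (\<Sum>i<N. f i) < x" "x < y"
    by blast
  have "(\<Sum>i<N. f i) = (\<Sum>i<N. if d i < x then (1/2::real)^i else 0)"
    using x by (intro sum.cong) (auto simp: f_def)
  also have "\<dots> \<le> (\<Sum>i. if d i < x then (1/2::real)^i else 0)"
    by (intro sum_le_suminf summable_half) auto
  finally have "t < jump_lo d x" using x(2) by (simp add: jump_lo_def)
  with x(3) show ?thesis by blast
qed

text \<open>The height sought is the supremum of those whose interval starts no later than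
  \<open>t\<close>. Left continuity of \<open>jump_lo\<close> gives one inequality, its reflection
  the other; uniqueness is the disjointness of the intervals.\<close>

lemma collapse_ex1: "\<exists>!y. jump_lo d y \<le> t \<and> t \<le> jump_hi d y"
proof (rule ex_ex1I)
  define S where "S = {y. jump_lo d y \<le> t}"
  have S: "t - 2 \<in> S" "\<And>y. y \<in> S \<Longrightarrow> y \<le> t"
    using jump_lo_le_hi[of d "t - 2"] jump_bounds(2)[of d "t - 2"]
    by (auto simp: S_def intro: order_trans[OF jump_bounds(1)])
  have bdd: "bdd_above S" using S(2) by (auto simp: bdd_above_def)
  have down: "y' \<in> S" if "y \<in> S" "y' < y" for y y'
    using that jump_gap[of y' y d] jump_lo_le_hi[of d y'] by (simp add: S_def)
  have "jump_lo d (Sup S) \<le> t"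
  proof (rule ccontr)
    assume "\<not> jump_lo d (Sup S) \<le> t"
    then obtain y' where y': "y' < Sup S" "t < jump_lo d y'" using jump_lo_left[of t d "Sup S"] by auto
    then obtain y where "y \<in> S" "y' < y" using less_cSup_iff[OF _ bdd] S(1) by blast
    with down y'(2) show False by (force simp: S_def)
  qed
  moreover have "t \<le> jump_hi d (Sup S)"
  proof (rule ccontr)
    assume "\<not> t \<le> jump_hi d (Sup S)"
    then have "2 - t < jump_lo (\<lambda>i. - d i) (- Sup S)" by (simp add: jump_hi_reflect)
    then obtain z where "z < - Sup S" "2 - t < jump_lo (\<lambda>i. - d i) z"
      using jump_lo_left[of "2 - t" "\<lambda>i. - d i" "- Sup S"] by auto
    then have "Sup S < - z" "jump_hi d (- z) < t" by (auto simp: jump_hi_reflect)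
    then have "Sup S < - z" "- z \<in> S" using jump_lo_le_hi[of d "- z"] by (auto simp: S_def)
    then show False using cSup_upper[OF _ bdd] by fastforce
  qed
  ultimately show "\<exists>y. jump_lo d y \<le> t \<and> t \<le> jump_hi d y" by blast
next
  fix y y' assume a: "jump_lo d y \<le> t \<and> t \<le> jump_hi d y" "jump_lo d y' \<le> t \<and> t \<le> jump_hi d y'"
  have False if "x < x'" "t \<le> jump_hi d x" "jump_lo d x' \<le> t" for x x'
    using jump_gap[OF that(1), of d] that by linarith
  with a show "y = y'" by (metis linorder_neqE)
qed

lemma collapse_iff: "collapse d t = y \<longleftrightarrow> t \<in> {jump_lo d y..jump_hi d y}"
proof -
  have "jump_lo d (collapse d t) \<le> t \<and> t \<le> jump_hi d (collapse d t)"
    unfolding collapse_def by (rule theI'[OF collapse_ex1])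
  then show ?thesis using ex1E[OF collapse_ex1[of d t]] by (metis atLeastAtMost_iff)
qed

lemma jump_collapse: "jump_lo d (collapse d t) \<le> t" "t \<le> jump_hi d (collapse d t)"
  using collapse_iff[of d t "collapse d t"] by auto

lemma collapse_less_iff: "collapse d t < y \<longleftrightarrow> t < jump_lo d y" "y < collapse d t \<longleftrightarrow> jump_hi d y < t"
proof -
  note j = jump_collapse[where d = d and t = t]
  have 1: "collapse d t < y \<Longrightarrow> t < jump_lo d y" for y
    using j jump_gap[of "collapse d t" y d] by linarith
  have 2: "y < collapse d t \<Longrightarrow> jump_hi d y < t" for y
    using j jump_gap[of y "collapse d t" d] by linarith
  show "collapse d t < y \<longleftrightarrow> t < jump_lo d y" "y < collapse d t \<longleftrightarrow> jump_hi d y < t"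
    using 1[of y] 2[of y] j jump_lo_le_hi[of d y] by (auto intro: linorder_cases[of "collapse d t" y])
qed

lemma mono_collapse: "mono (collapse d)"
proof (rule monoI)
  fix t t' :: real assume "t \<le> t'"
  then show "collapse d t \<le> collapse d t'"
    using collapse_less_iff(1)[of d t' "collapse d t"] jump_collapse[where d = d and t = t] by force
qed

lemma collapse_lipschitz: 
  assumes "t \<le> t'" shows "collapse d t' - collapse d t \<le> t' - t"
proof (cases "collapse d t < collapse d t'")
  case True
  then show ?thesis
    using jump_gap[OF True, of d] jump_collapse[where d = d and t = t] jump_collapse[where d = d and t = t'] by linarith
qed (use assms in simp)

lemma continuous_collapse: "continuous_on UNIV (collapse d)"
proof -
  have "dist (collapse d t) (collapse d t') \<le> 1 * dist t t'" for t t'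
    using collapse_lipschitz[of t t' d] collapse_lipschitz[of t' t d] monoD[OF mono_collapse[of d], of t t']
      monoD[OF mono_collapse[of d], of t' t] by (auto simp: dist_real_def abs_if)
  then have "1-lipschitz_on UNIV (collapse d)" by (intro lipschitz_onI) auto
  then show ?thesis by (rule lipschitz_on_continuous_on)
qed

lemma collapse_near: "\<bar>collapse d t - t\<bar> \<le> 2"
  using jump_collapse[where d = d and t = t] jump_bounds(1)[of "collapse d t" d] jump_bounds(2)[of d "collapse d t"]
  by auto

section \<open>Columns over regulated paths\<close>

lemma infnorm_le_iff_cart: "infnorm (x::real^'n) \<le> r \<longleftrightarrow> (\<forall>j. \<bar>x $ j\<bar> \<le> r)"
proof
  assume "infnorm x \<le> r"
  then show "\<forall>j. \<bar>x $ j\<bar> \<le> r" using component_le_infnorm_cart order_trans by blast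
next
  assume "\<forall>j. \<bar>x $ j\<bar> \<le> r"
  then show "infnorm x \<le> r" unfolding infnorm_cart by (intro cSup_least) auto
qed

text \<open>The sup-norm distance from \<open>x\<close> to the unit cube with lower corner
  \<open>l\<close>.\<close>

definition box_dist :: "real ^ 'n \<Rightarrow> real ^ 'n \<Rightarrow> real" where
  "box_dist l x = infnorm (\<chi> j. max 0 (max (l $ j - x $ j) (x $ j - l $ j - 1)))"

lemma box_dist_nonneg: "0 \<le> box_dist l x"
  by (simp add: box_dist_def infnorm_pos_le)

lemma box_dist_le_iff:
  assumes "0 \<le> \<rho>"
  shows "box_dist l x \<le> \<rho> \<longleftrightarrow> (\<forall>j. l $ j - \<rho> \<le> x $ j \<and> x $ j \<le> l $ j + 1 + \<rho>)"
  unfolding box_dist_def infnorm_le_iff_cart using assms by (auto simp: algebra_simps)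

lemma box_dist_le_0_iff: "box_dist l x \<le> 0 \<longleftrightarrow> x \<in> cbox l (l + 1)"
  by (simp add: box_dist_le_iff mem_box_cart)

lemma box_dist_lipschitz: "\<bar>box_dist l x - box_dist l x'\<bar> \<le> norm (x - x')"
proof -
  let ?f = "\<lambda>x. \<chi> j. max 0 (max (l $ j - x $ j) (x $ j - l $ j - 1))"
  have "infnorm (?f x - ?f x') \<le> infnorm (x - x')"
    unfolding infnorm_le_iff_cart
  proof
    fix j
    have "\<bar>(?f x - ?f x') $ j\<bar> \<le> \<bar>(x - x') $ j\<bar>" by (auto simp: max_def)
    also have "\<dots> \<le> infnorm (x - x')" by (rule component_le_infnorm_cart)
    finally show "\<bar>(?f x - ?f x') $ j\<bar> \<le> infnorm (x - x')" .
  qed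
  then show ?thesis
    unfolding box_dist_def using absdiff_infnorm[of "?f x" "?f x'"] infnorm_le_norm[of "x - x'"]
    by linarith
qed

text \<open>As \<open>w\<close> runs through \<open>[0, 1]\<close>, the unit interval at \<open>l\<close> shrinks to its intersection with the one at
  \<open>r\<close> and then grows to the latter; this is the left end at time \<open>w\<close>.\<close>

definition edge :: "real \<Rightarrow> real \<Rightarrow> real \<Rightarrow> real" where
  "edge l r w = max (l - max 0 (2 * w - 1)) (r - max 0 (1 - 2 * w))"

text \<open>By reflection, \<open>1 - edge (- l) (- r) w\<close> is the right end belonging to the
  left end \<open>edge l r w\<close>. The bound on the jump says that the two unit intervals overlap
  with positive length, so the fibre never degenerates.\<close>

lemma edge_less: "\<bar>r - l\<bar> < 1 \<Longrightarrow> edge l r w < 1 - edge (- l) (- r) w"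
  by (auto simp: edge_def)

text \<open>At every \<open>w\<close> at least one of the two subtracted terms is 0, so the edge
  stays between the smaller and the larger of \<open>l\<close> and \<open>r\<close>.\<close>

lemma edge_between: "\<bar>l - c\<bar> \<le> e \<Longrightarrow> \<bar>r - c\<bar> \<le> e \<Longrightarrow> \<bar>edge l r w - c\<bar> \<le> e"
  by (auto simp: edge_def max_def)

lemma edge_ends: "\<bar>r - l\<bar> < 1 \<Longrightarrow> edge l r 0 = l" "\<bar>r - l\<bar> < 1 \<Longrightarrow> edge l r 1 = r" "edge l l w = l"
  by (auto simp: edge_def)

text \<open>The relative position of a time in the interval that \<open>collapse d\<close> maps to the same point;
  division by \<open>0\<close> makes it \<open>0\<close> when this interval is a point.\<close>

definition gap_pos :: "(nat \<Rightarrow> real) \<Rightarrow> real \<Rightarrow> real" where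
  "gap_pos d t = (t - jump_lo d (collapse d t)) / (jump_hi d (collapse d t) - jump_lo d (collapse d t))"

definition right_limit :: "(real \<Rightarrow> 'a::metric_space) \<Rightarrow> (real \<Rightarrow> 'a) \<Rightarrow> bool" where
  "right_limit f g \<longleftrightarrow> (\<forall>y. (f \<longlongrightarrow> g y) (at_right y))"

definition left_limit :: "(real \<Rightarrow> 'a::metric_space) \<Rightarrow> (real \<Rightarrow> 'a) \<Rightarrow> bool" where
  "left_limit f g \<longleftrightarrow> (\<forall>y. (f \<longlongrightarrow> g y) (at_left y))"

lemma right_limitD:
  assumes "right_limit f g" "right_limit h g" "e > 0"
  shows "\<exists>\<delta>>0. \<forall>z. y < z \<and> z < y + \<delta> \<longrightarrow> dist (f z) (g y) < e \<and> dist (h z) (g y) < e"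
proof -
  have "\<forall>\<^sub>F z in at_right y. dist (f z) (g y) < e \<and> dist (h z) (g y) < e"
    using assms by (auto simp: right_limit_def tendsto_iff eventually_conj_iff)
  then obtain b where "b > y" "\<And>z. y < z \<Longrightarrow> z < b \<Longrightarrow> dist (f z) (g y) < e \<and> dist (h z) (g y) < e"
    unfolding eventually_at_right_field by blast
  then show ?thesis by (intro exI[of _ "b - y"]) auto
qed

lemma left_limitD:
  assumes "left_limit f g" "left_limit h g" "e > 0"
  shows "\<exists>\<delta>>0. \<forall>z. y - \<delta> < z \<and> z < y \<longrightarrow> dist (f z) (g y) < e \<and> dist (h z) (g y) < e"
proof -
  have "\<forall>\<^sub>F z in at_left y. dist (f z) (g y) < e \<and> dist (h z) (g y) < e"
    using assms by (auto simp: left_limit_def tendsto_iff eventually_conj_iff)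
  then obtain b where "b < y" "\<And>z. b < z \<Longrightarrow> z < y \<Longrightarrow> dist (f z) (g y) < e \<and> dist (h z) (g y) < e"
    unfolding eventually_at_left_field by blast
  then show ?thesis by (intro exI[of _ "y - b"]) auto
qed

text \<open>Inside one gap the formula is continuous in \<open>t\<close>, and at its ends it takes
  the values \<open>l y\<close> and \<open>r y\<close>. Gaps accumulating at such an end lie over
  heights near \<open>y\<close> on one side, where \<open>l\<close> and \<open>r\<close> both
  approach the one-sided limit; by \<open>edge_between\<close> so does everything in
  between.\<close>

lemma continuous_edge:
  fixes l r :: "real \<Rightarrow> real"
  assumes right: "right_limit l r" "right_limit r r" and left: "left_limit l l" "left_limit r l"
    and jump: "\<And>y. \<bar>r y - l y\<bar> < 1" and d: "\<And>y. l y \<noteq> r y \<Longrightarrow> y \<in> range d"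
  shows "continuous_on UNIV (\<lambda>t. edge (l (collapse d t)) (r (collapse d t)) (gap_pos d t))"
    (is "continuous_on UNIV ?f")
proof (rule continuous_on_eq_continuous_at[THEN iffD2, OF open_UNIV], rule ballI, unfold continuous_at_eps_delta, intro allI impI)
  fix t0 e :: real assume "e > 0"
  define y where "y = collapse d t0"
  define u where "u = jump_lo d y"
  define v where "v = jump_hi d y"
  have uv: "u \<le> t0" "t0 \<le> v" using jump_collapse[where d = d and t = t0] by (auto simp: u_def v_def y_def)
  define g where "g = (\<lambda>t. edge (l y) (r y) ((t - u) / (v - u)))"
  have g: "?f t = g t" if "collapse d t = y" for t
    using that by (simp add: g_def gap_pos_def u_def v_def)
  have gu: "g u = l y" using edge_ends(1)[OF jump] by (simp add: g_def)
  have gv: "g v = r y"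
  proof (cases "u < v")
    case True
    then show ?thesis using edge_ends(2)[OF jump] by (simp add: g_def)
  next
    case False
    \<comment> \<open>A degenerate interval belongs to a height that is not blown up, and there the
      two one-sided values agree.\<close>
    then have "y \<notin> range d" using jump_lo_less_hi by (auto simp: u_def v_def)
    then have "l y = r y" using d by blast
    then show ?thesis by (simp add: g_def edge_ends(3))
  qed
  have "isCont g t0"
  proof (cases "u < v")
    case True
    then show ?thesis unfolding g_def edge_def
      by (intro continuous_intros) auto
  next
    case False
    then have "v = u" using uv by simp
    then have "g = (\<lambda>_. edge (l y) (r y) 0)" by (simp add: g_def)
    then show ?thesis by simp
  qed
  then obtain \<delta>0 where \<delta>0: "\<delta>0 > 0" "\<And>t. \<bar>t - t0\<bar> < \<delta>0 \<Longrightarrow> \<bar>g t - g t0\<bar> < e / 2"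
    using \<open>e > 0\<close> unfolding continuous_at_eps_delta by (metis dist_real_def half_gt_zero)
  obtain \<delta>1 where \<delta>1: "\<delta>1 > 0" "\<And>z. y < z \<and> z < y + \<delta>1 \<Longrightarrow> \<bar>l z - r y\<bar> < e/2 \<and> \<bar>r z - r y\<bar> < e/2"
    using right_limitD[OF right, of "e / 2" y] \<open>e > 0\<close> unfolding dist_real_def by (metis half_gt_zero)
  obtain \<delta>2 where \<delta>2: "\<delta>2 > 0" "\<And>z. y - \<delta>2 < z \<and> z < y \<Longrightarrow> \<bar>l z - l y\<bar> < e/2 \<and> \<bar>r z - l y\<bar> < e/2"
    using left_limitD[OF left, of "e / 2" y] \<open>e > 0\<close> unfolding dist_real_def by (metis half_gt_zero)
  have ft0: "?f t0 = g t0" using g y_def by blast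
  have "\<bar>?f t - ?f t0\<bar> < e" if t: "\<bar>t - t0\<bar> < min \<delta>0 (min \<delta>1 \<delta>2)" for t
  proof -
    define z where "z = collapse d t"
    have zy: "\<bar>z - y\<bar> \<le> \<bar>t - t0\<bar>"
      using collapse_lipschitz[of t t0 d] collapse_lipschitz[of t0 t d] 
        monoD[OF mono_collapse[of d], of t t0] monoD[OF mono_collapse[of d], of t0 t]
      by (auto simp: z_def y_def abs_if)
    consider "z = y" | "z > y" | "z < y" by linarith
    then show ?thesis
    proof cases
      case 1
      then show ?thesis using g[of t] \<delta>0(2)[of t] t \<open>e > 0\<close> by (simp add: ft0 z_def)
    next
      case 2
      then have "v < t" using collapse_less_iff(2)[of y d t] by (simp add: z_def v_def)
      then have "\<bar>r y - g t0\<bar> < e / 2" using \<delta>0(2)[of v] uv t gv by simp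
      moreover have "\<bar>l z - r y\<bar> < e/2 \<and> \<bar>r z - r y\<bar> < e/2" using \<delta>1(2)[of z] zy t 2 by simp
      then have "\<bar>?f t - r y\<bar> \<le> e / 2"
        unfolding z_def by (intro edge_between) (auto intro: less_imp_le)
      ultimately show ?thesis unfolding ft0 by linarith
    next
      case 3
      then have "t < u" using collapse_less_iff(1)[of d t y] by (simp add: z_def u_def)
      then have "\<bar>l y - g t0\<bar> < e / 2" using \<delta>0(2)[of u] uv t gu by simp
      moreover have "\<bar>l z - l y\<bar> < e/2 \<and> \<bar>r z - l y\<bar> < e/2" using \<delta>2(2)[of z] zy t 3 by simp
      then have "\<bar>?f t - l y\<bar> \<le> e / 2"
        unfolding z_def by (intro edge_between) (auto intro: less_imp_le)
      ultimately show ?thesis unfolding ft0 by linarith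
    qed
  qed
  then show "\<exists>\<delta>>0. \<forall>t. dist t t0 < \<delta> \<longrightarrow> dist (?f t) (?f t0) < e"
    using \<delta>0(1) \<delta>1(1) \<delta>2(1) unfolding dist_real_def by (intro exI[of _ "min \<delta>0 (min \<delta>1 \<delta>2)"]) auto
qed

text \<open>The slabs of half-width \<delta> around the heights in \<open>G\<close> are disjoint,
  and each map moves points only within its own slab. Hence at every point at most one factor of the
  composition acts, and the estimates do not add up.\<close>

lemma finite_gaps_shrinking:
  fixes \<alpha> \<beta> :: "real \<Rightarrow> real ^ 'n" and Y :: "real \<Rightarrow> real"
  assumes one: "\<And>y. y \<in> D \<Longrightarrow> \<exists>K k. homeomorphism UNIV UNIV K k \<and>
      (\<forall>z. \<delta> \<le> \<bar>Y (snd z) - y\<bar> \<longrightarrow> K z = z) \<and>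
      (\<forall>z. dist (fst (K z)) (fst z) < \<delta>) \<and>
      (\<forall>z. K z \<in> column \<alpha> \<beta> \<longleftrightarrow> z \<in> column \<alpha> \<beta>) \<and>
      (\<forall>x t t'. Y t = Y t' \<longrightarrow> dist (K (x, t)) (K (x, t')) < (if Y t = y then 0 else \<bar>t - t'\<bar>) + \<delta>)"
    and \<delta>: "\<delta> > 0"
    and G: "finite G" "G \<subseteq> D" "\<And>y y'. y \<in> G \<Longrightarrow> y' \<in> G \<Longrightarrow> y \<noteq> y' \<Longrightarrow> 2 * \<delta> \<le> \<bar>y - y'\<bar>"
  shows "\<exists>K k. homeomorphism UNIV UNIV K k \<and>
      (\<forall>z. K z = z \<or> (\<exists>y\<in>G. \<bar>Y (snd z) - y\<bar> < \<delta> \<and> \<bar>Y (snd (K z)) - y\<bar> < \<delta>)) \<and>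
      (\<forall>z. dist (fst (K z)) (fst z) < \<delta>) \<and>
      (\<forall>z. K z \<in> column \<alpha> \<beta> \<longleftrightarrow> z \<in> column \<alpha> \<beta>) \<and>
      (\<forall>x t t'. Y t = Y t' \<longrightarrow> dist (K (x, t)) (K (x, t')) < (if Y t \<in> G then 0 else \<bar>t - t'\<bar>) + \<delta>)"
  using G
proof (induction G rule: finite_induct)
  case empty
  show ?case
    using \<delta> homeomorphism_ident[of UNIV]
    by (intro exI[of _ "\<lambda>z. z"]) (auto simp: dist_Pair_Pair dist_real_def)
next
  case (insert y G)
  obtain K k where K: "homeomorphism UNIV UNIV K k"
      "\<And>z. K z = z \<or> (\<exists>y\<in>G. \<bar>Y (snd z) - y\<bar> < \<delta> \<and> \<bar>Y (snd (K z)) - y\<bar> < \<delta>)"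
      "\<And>z. dist (fst (K z)) (fst z) < \<delta>" "\<And>z. K z \<in> column \<alpha> \<beta> \<longleftrightarrow> z \<in> column \<alpha> \<beta>"
      "\<And>x t t'. Y t = Y t' \<Longrightarrow> dist (K (x, t)) (K (x, t')) < (if Y t \<in> G then 0 else \<bar>t - t'\<bar>) + \<delta>"
    using insert.IH insert.prems by (auto 0 3)
  obtain K1 k1 where K1: "homeomorphism UNIV UNIV K1 k1" "\<And>z. \<delta> \<le> \<bar>Y (snd z) - y\<bar> \<Longrightarrow> K1 z = z"
      "\<And>z. dist (fst (K1 z)) (fst z) < \<delta>" "\<And>z. K1 z \<in> column \<alpha> \<beta> \<longleftrightarrow> z \<in> column \<alpha> \<beta>"
      "\<And>x t t'. Y t = Y t' \<Longrightarrow> dist (K1 (x, t)) (K1 (x, t')) < (if Y t = y then 0 else \<bar>t - t'\<bar>) + \<delta>"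
    using one[of y] insert.prems(1) by (auto 0 3)
  have slab: "\<bar>Y (snd (K1 z)) - y\<bar> < \<delta>" if z: "\<bar>Y (snd z) - y\<bar> < \<delta>" for z
  proof (rule ccontr)
    assume a: "\<not> \<bar>Y (snd (K1 z)) - y\<bar> < \<delta>"
    then have "K1 (K1 z) = K1 z" by (intro K1(2)) simp
    then have "K1 z = z" by (rule injD[OF homeomorphism_UNIV_simps(5)[OF K1(1)]])
    with a z show False by simp
  qed
  have far: "\<not> \<bar>Y t - y'\<bar> < \<delta>" if "y' \<in> G" "\<bar>Y t - y\<bar> < \<delta>" for y' t
  proof -
    have "2 * \<delta> \<le> \<bar>y - y'\<bar>" using insert.prems(2)[of y y'] insert.hyps(2) that(1) by auto
    then show ?thesis using that(2) by linarith
  qed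
  have in1: "K (K1 z) = K1 z" if z: "\<bar>Y (snd z) - y\<bar> < \<delta>" for z
    using K(2)[of "K1 z"] far slab[OF z] by blast
  have out: "K (K1 z) = K z" if "\<not> \<bar>Y (snd z) - y\<bar> < \<delta>" for z
    using K1(2)[of z] that by simp
  have "homeomorphism UNIV UNIV (K \<circ> K1) (k1 \<circ> k)"
    by (rule homeomorphism_compose[OF K1(1) K(1)])
  moreover have "(K \<circ> K1) z = z \<or> (\<exists>y\<in>insert y G. \<bar>Y (snd z) - y\<bar> < \<delta> \<and> \<bar>Y (snd ((K \<circ> K1) z)) - y\<bar> < \<delta>)" for z
  proof (cases "\<bar>Y (snd z) - y\<bar> < \<delta>")
    case True
    then show ?thesis using in1[OF True] slab[OF True] by simp
  next
    case False
    then show ?thesis using out[OF False] K(2)[of z] by simp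
  qed
  moreover have "dist (fst ((K \<circ> K1) z)) (fst z) < \<delta>" for z
    using in1[of z] out[of z] K(3)[of z] K1(3)[of z] by (cases "\<bar>Y (snd z) - y\<bar> < \<delta>") auto
  moreover have "(K \<circ> K1) z \<in> column \<alpha> \<beta> \<longleftrightarrow> z \<in> column \<alpha> \<beta>" for z
    unfolding o_apply by (rule trans[OF K(4) K1(4)])
  moreover have "dist ((K \<circ> K1) (x, t)) ((K \<circ> K1) (x, t')) < (if Y t \<in> insert y G then 0 else \<bar>t - t'\<bar>) + \<delta>"
    if t: "Y t = Y t'" for x t t'
  proof (cases "\<bar>Y t - y\<bar> < \<delta>")
    case True
    then have "Y t \<notin> G" using far[of "Y t" t] \<delta> by auto
    then show ?thesis using in1[of "(x, t)"] in1[of "(x, t')"] True t K1(5)[OF t, of x] by simp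
  next
    case False
    then have "Y t \<noteq> y" using \<delta> by auto
    then show ?thesis using out[of "(x, t)"] out[of "(x, t')"] False t K(5)[OF t, of x] by simp
  qed
  ultimately show ?case by blast
qed

text \<open>Here \<open>eL\<close> and \<open>eR\<close> are the distances of a point from the first
  and the second box, and \<open>m\<close> is its dividing time. If both vanish, the point is in the
  fibre at all times; if only \<open>eL\<close> does, until \<open>(1 - eR) / 2\<close>; if only
  \<open>eR\<close> does, from \<open>(1 + eL) / 2\<close> on; otherwise never. Cutting the
  distances off at 1 keeps \<open>m\<close> in \<open>[0, 1]\<close> for every point.\<close>

lemma gap_weights:
  fixes eL eR w :: real
  assumes "0 \<le> eL" "0 \<le> eR" "eL \<le> 0 \<Longrightarrow> eR \<le> 1" "eR \<le> 0 \<Longrightarrow> eL \<le> 1"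
  defines "m \<equiv> (1 - min 1 eR + min 1 eL) / 2"
  shows "eL \<le> max 0 (2 * w - 1) \<and> eR \<le> max 0 (1 - 2 * w) \<longleftrightarrow> (w \<le> m \<and> eL \<le> 0) \<or> (m \<le> w \<and> eR \<le> 0)"
    and "0 \<le> m" "m \<le> 1"
  unfolding m_def using assms(1-4) by (auto simp: min_def max_def field_simps)

section \<open>The tube over a regulated path and its collapse\<close>

locale regulated_column =
  fixes L R :: "real \<Rightarrow> real ^ 'n" and d :: "nat \<Rightarrow> real" and a b :: real
  assumes right: "right_limit L R" "right_limit R R" and left: "left_limit L L" "left_limit R L"
    and jump: "\<And>y j. \<bar>R y $ j - L y $ j\<bar> < 1" 
    and d: "\<And>y. L y \<noteq> R y \<Longrightarrow> y \<in> range d"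
    and ab: "a < b" "a \<notin> range d" "b \<notin> range d"
begin

abbreviation "Y \<equiv> collapse d"

definition \<alpha> :: "real \<Rightarrow> real ^ 'n" where
  "\<alpha> t = (\<chi> j. edge (L (Y t) $ j) (R (Y t) $ j) (gap_pos d t))"

definition \<beta> :: "real \<Rightarrow> real ^ 'n" where
  "\<beta> t = (\<chi> j. 1 - edge (- L (Y t) $ j) (- R (Y t) $ j) (gap_pos d t))"

definition q :: "(real ^ 'n) \<times> real \<Rightarrow> (real ^ 'n) \<times> real" where
  "q z = (fst z, Y (snd z))"

definition tube :: "((real ^ 'n) \<times> real) set" where
  "tube = {z \<in> column \<alpha> \<beta>. Y (snd z) \<in> {a..b}}"

lemma limits_nth:
  "right_limit (\<lambda>y. L y $ j) (\<lambda>y. R y $ j)" "right_limit (\<lambda>y. R y $ j) (\<lambda>y. R y $ j)"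
  "left_limit (\<lambda>y. L y $ j) (\<lambda>y. L y $ j)" "left_limit (\<lambda>y. R y $ j) (\<lambda>y. L y $ j)"
  "right_limit (\<lambda>y. - L y $ j) (\<lambda>y. - R y $ j)" "right_limit (\<lambda>y. - R y $ j) (\<lambda>y. - R y $ j)"
  "left_limit (\<lambda>y. - L y $ j) (\<lambda>y. - L y $ j)" "left_limit (\<lambda>y. - R y $ j) (\<lambda>y. - L y $ j)"
  using left right unfolding left_limit_def right_limit_def by (auto intro!: tendsto_intros)

lemma continuous_\<alpha>: "continuous_on UNIV \<alpha>"
  unfolding \<alpha>_def
proof (intro continuous_on_vec_lambda continuous_edge[of "\<lambda>y. L y $ j" "\<lambda>y. R y $ j" for j] limits_nth)
  show "y \<in> range d" if "L y $ j \<noteq> R y $ j" for y j by (rule d) (use that in auto)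
qed (use jump in auto)

lemma continuous_\<beta>: "continuous_on UNIV \<beta>"
  unfolding \<beta>_def
proof (intro continuous_on_vec_lambda continuous_intros continuous_edge[of "\<lambda>y. - L y $ j" "\<lambda>y. - R y $ j" for j] limits_nth)
  show "y \<in> range d" if "- L y $ j \<noteq> - R y $ j" for y j by (rule d) (use that in auto)
  show "\<bar>- R y $ j - - L y $ j\<bar> < 1" for y j using jump[where y = y and j = j] by linarith
qed

lemma \<alpha>_less_\<beta>: "\<alpha> t $ j < \<beta> t $ j"
  using edge_less[OF jump[of "Y t" j]] by (simp add: \<alpha>_def \<beta>_def)

text \<open>The edges describe the intersection of the cube at \<open>L\<close> and the cube at
  \<open>R\<close>, each enlarged by an amount depending on the time. So membership becomes two
  conditions on sup-norm distances, as \<open>gap_weights\<close> requires.\<close>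

lemma mem_fibre:
  "x \<in> cbox (\<alpha> t) (\<beta> t) \<longleftrightarrow> box_dist (L (Y t)) x \<le> max 0 (2 * gap_pos d t - 1) \<and> 
     box_dist (R (Y t)) x \<le> max 0 (1 - 2 * gap_pos d t)"
proof -
  have e1: "edge l r w \<le> x \<longleftrightarrow> l - max 0 (2 * w - 1) \<le> x \<and> r - max 0 (1 - 2 * w) \<le> x" for l r w x
    by (simp add: edge_def)
  have e2: "x \<le> 1 - edge (- l) (- r) w \<longleftrightarrow> x \<le> l + 1 + max 0 (2 * w - 1) \<and> x \<le> r + 1 + max 0 (1 - 2 * w)" for l r w x
    unfolding edge_def by linarith
  show ?thesis
    unfolding mem_box_cart by (subst (1 2) box_dist_le_iff) (auto simp: \<alpha>_def \<beta>_def e1 e2)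
qed

lemma dists:
  "box_dist (L y) x \<le> 0 \<Longrightarrow> box_dist (R y) x \<le> 1" "box_dist (R y) x \<le> 0 \<Longrightarrow> box_dist (L y) x \<le> 1"
proof -
  have "R y $ j < L y $ j + 1" "L y $ j < R y $ j + 1" for j using jump[where y = y and j = j] by linarith+
  then show "box_dist (L y) x \<le> 0 \<Longrightarrow> box_dist (R y) x \<le> 1" "box_dist (R y) x \<le> 0 \<Longrightarrow> box_dist (L y) x \<le> 1"
    by (simp_all add: box_dist_le_iff) (smt (verit, best))+
qed

lemma q_tube: "q ` tube = {(x, y). y \<in> {a..b} \<and> (x \<in> cbox (L y) (L y + 1) \<or> x \<in> cbox (R y) (R y + 1))}"
proof (intro equalityI subsetI)
  fix z assume "z \<in> q ` tube"
  then obtain x t where z: "z = (x, Y t)" "x \<in> cbox (\<alpha> t) (\<beta> t)" "Y t \<in> {a..b}" by (auto simp: tube_def q_def)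
  \<comment> \<open>In each half of a gap one of the enlargements is 0, so the fibre lies in one of
    the two unit cubes.\<close>
  have "2 * gap_pos d t \<le> 1 \<or> 1 \<le> 2 * gap_pos d t" by linarith
  then have "box_dist (L (Y t)) x \<le> 0 \<or> box_dist (R (Y t)) x \<le> 0"
    using z(2) unfolding mem_fibre by auto
  then show "z \<in> {(x, y). y \<in> {a..b} \<and> (x \<in> cbox (L y) (L y + 1) \<or> x \<in> cbox (R y) (R y + 1))}"
    using z(1,3) by (simp add: box_dist_le_0_iff)
next
  fix z assume "z \<in> {(x, y). y \<in> {a..b} \<and> (x \<in> cbox (L y) (L y + 1) \<or> x \<in> cbox (R y) (R y + 1))}"
  then obtain x y where z: "z = (x, y)" "y \<in> {a..b}" "box_dist (L y) x \<le> 0 \<or> box_dist (R y) x \<le> 0"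
    by (auto simp: box_dist_le_0_iff)
  have lo: "Y (jump_lo d y) = y" and hi: "Y (jump_hi d y) = y"
    using jump_lo_le_hi[of d y] by (auto simp: collapse_iff)
  have plo: "gap_pos d (jump_lo d y) = 0" by (simp add: gap_pos_def lo)
  have L: "(x, jump_lo d y) \<in> tube" if "box_dist (L y) x \<le> 0"
    using that dists(1)[OF that] z(2) by (simp add: tube_def mem_fibre lo plo)
  have R: "(x, jump_hi d y) \<in> tube" if R: "box_dist (R y) x \<le> 0"
  proof (cases "y \<in> range d")
    case True
    then have "gap_pos d (jump_hi d y) = 1" using jump_lo_less_hi[OF True] by (simp add: gap_pos_def hi)
    then show ?thesis using R dists(2)[OF R] z(2) by (simp add: tube_def mem_fibre hi)
  next
    case False
    then have "L y = R y" using d by blast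
    then show ?thesis using R L jump_lo_eq_hi[OF False] by simp
  qed
  have "q (x, jump_lo d y) = z" "q (x, jump_hi d y) = z" using z(1) by (simp_all add: q_def lo hi)
  then show "z \<in> q ` tube" using z(3) L R by (metis image_eqI)
qed

lemma one_gap:
  assumes y: "y \<in> range d" and \<delta>: "\<delta> > 0"
  shows "\<exists>K k. homeomorphism UNIV UNIV K k \<and>
      (\<forall>z. \<delta> \<le> \<bar>Y (snd z) - y\<bar> \<longrightarrow> K z = z) \<and>
      (\<forall>z. dist (fst (K z)) (fst z) < \<delta>) \<and>
      (\<forall>z. K z \<in> column \<alpha> \<beta> \<longleftrightarrow> z \<in> column \<alpha> \<beta>) \<and>
      (\<forall>x t t'. Y t = Y t' \<longrightarrow> dist (K (x, t)) (K (x, t')) < (if Y t = y then 0 else \<bar>t - t'\<bar>) + \<delta>)"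
proof -
  define u where "u = jump_lo d y"
  define v where "v = jump_hi d y"
  have uv: "u < v" using jump_lo_less_hi[OF y] by (simp add: u_def v_def)
  define m where "m = (\<lambda>x. (1 - min 1 (box_dist (R y) x) + min 1 (box_dist (L y) x)) / 2)"
  \<comment> \<open>The dividing time of the vertical line through \<open>x\<close>, transported
    from \<open>[0, 1]\<close> to the gap. As half the difference of two 1-Lipschitz functions plus
    a constant, \<open>m\<close> is 1-Lipschitz, which gives the constant
    \<open>v - u\<close>.\<close>
  define c where "c = (\<lambda>x. u + (v - u) * m x)"
  have Yiff: "Y t = y \<longleftrightarrow> t \<in> {u..v}" for t by (simp add: collapse_iff u_def v_def)
  note wt = gap_weights[OF box_dist_nonneg box_dist_nonneg dists[of y]]
  have m01: "0 \<le> m x" "m x \<le> 1" for x unfolding m_def using wt(2,3) by blast+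
  have cc: "\<bar>c x - c x'\<bar> \<le> (v - u) * norm (x - x')" for x x'
  proof -
    have "\<bar>m x - m x'\<bar> \<le> norm (x - x')"
    proof -
      have clamp: "\<bar>min 1 p - min 1 p'\<bar> \<le> \<bar>p - p'\<bar>" for p p' :: real by auto
      have half: "\<bar>(1 - p + r) / 2 - (1 - p' + r') / 2\<bar> \<le> N" if "\<bar>p - p'\<bar> \<le> N" "\<bar>r - r'\<bar> \<le> N"
        for p p' r r' N :: real
      proof -
        have eq: "(1 - p + r) / 2 - (1 - p' + r') / 2 = ((r - r') - (p - p')) / 2" by (simp add: field_simps)
        have "\<bar>(r - r') - (p - p')\<bar> \<le> N + N" using that by linarith
        then show ?thesis unfolding eq by simp
      qed
      show ?thesis unfolding m_def
        by (intro half order_trans[OF clamp box_dist_lipschitz])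
    qed
    then have "(v - u) * \<bar>m x - m x'\<bar> \<le> (v - u) * norm (x - x')" using uv by (intro mult_left_mono) auto
    moreover have "c x - c x' = (v - u) * (m x - m x')" by (simp add: c_def algebra_simps)
    ultimately show ?thesis using uv by (simp add: abs_mult)
  qed
  have cuv: "c x \<in> {u..v}" for x
  proof -
    have "0 \<le> (v - u) * m x" "(v - u) * m x \<le> (v - u) * 1"
      using uv m01[of x] by (auto intro!: mult_left_mono)
    then show ?thesis by (simp add: c_def)
  qed
  have pos: "gap_pos d t = (t - u) / (v - u)" if "t \<in> {u..v}" for t
  proof -
    have "Y t = y" using that Yiff by blast
    then show ?thesis by (simp add: gap_pos_def u_def v_def)
  qed
  have le: "(t - u) / (v - u) \<le> m x \<longleftrightarrow> t \<le> c x" "m x \<le> (t - u) / (v - u) \<longleftrightarrow> c x \<le> t" for t x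
    using uv by (auto simp: c_def field_simps)
  have m_eq: "(1 - min 1 (box_dist (R y) x) + min 1 (box_dist (L y) x)) / 2 = m x" for x
    by (simp add: m_def)
  have fib: "x \<in> cbox (\<alpha> t) (\<beta> t) \<longleftrightarrow>
        (t \<le> c x \<and> box_dist (L y) x \<le> 0) \<or> (c x \<le> t \<and> box_dist (R y) x \<le> 0)" if t: "t \<in> {u..v}" for x t
  proof -
    have "Y t = y" using t Yiff by blast
    then show ?thesis
      by (simp only: mem_fibre pos[OF t] wt(1) m_eq le)
  qed
  have "x \<in> cbox (\<alpha> t) (\<beta> t) \<longleftrightarrow>
        (t \<le> c x \<and> x \<in> cbox (\<alpha> u) (\<beta> u)) \<or> (c x \<le> t \<and> x \<in> cbox (\<alpha> v) (\<beta> v))" if t: "t \<in> {u..v}" for x t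
  proof -
    have "x \<in> cbox (\<alpha> u) (\<beta> u) \<longleftrightarrow> box_dist (L y) x \<le> 0 \<or> (c x \<le> u \<and> box_dist (R y) x \<le> 0)"
      using fib[of u x] uv cuv[of x] by auto
    moreover have "x \<in> cbox (\<alpha> v) (\<beta> v) \<longleftrightarrow> (v \<le> c x \<and> box_dist (L y) x \<le> 0) \<or> box_dist (R y) x \<le> 0"
      using fib[of v x] uv cuv[of x] by auto
    ultimately show ?thesis unfolding fib[OF t] using t by auto
  qed
  from gap_shrinking[OF continuous_\<alpha> continuous_\<beta> \<alpha>_less_\<beta> uv continuous_collapse mono_collapse Yiff cc cuv this \<delta>]
  show ?thesis .
qed

lemma compact_tube: "compact tube"
proof -
  have "closed {z :: (real ^ 'n) \<times> real. \<forall>j. \<alpha> (snd z) $ j \<le> fst z $ j \<and> fst z $ j \<le> \<beta> (snd z) $ j}"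
    by (intro closed_Collect_all closed_Collect_conj closed_Collect_le continuous_intros
        continuous_on_compose2[OF continuous_\<alpha>] continuous_on_compose2[OF continuous_\<beta>]) auto
  moreover have "closed {z :: (real ^ 'n) \<times> real. a \<le> Y (snd z) \<and> Y (snd z) \<le> b}"
    by (intro closed_Collect_conj closed_Collect_le continuous_intros
        continuous_on_compose2[OF continuous_collapse]) auto
  ultimately have "closed ({z. \<forall>j. \<alpha> (snd z) $ j \<le> fst z $ j \<and> fst z $ j \<le> \<beta> (snd z) $ j} \<inter>
      {z :: (real ^ 'n) \<times> real. a \<le> Y (snd z) \<and> Y (snd z) \<le> b})" by (rule closed_Int)
  also have "\<dots> = tube" by (auto simp: tube_def mem_box_cart)
  finally have cl: "closed tube" .
  define I where "I = {jump_lo d a..jump_hi d b}"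
  have "compact (\<alpha> ` I)" "compact (\<beta> ` I)"
    unfolding I_def by (intro compact_continuous_image continuous_on_subset[OF continuous_\<alpha>] 
        continuous_on_subset[OF continuous_\<beta>] compact_Icc; simp)+
  then obtain A B where AB: "\<And>t. t \<in> I \<Longrightarrow> norm (\<alpha> t) \<le> A" "\<And>t. t \<in> I \<Longrightarrow> norm (\<beta> t) \<le> B"
    by (metis bounded_iff compact_imp_bounded imageI)
  define c :: "real ^ 'n" where "c = (\<chi> j. \<bar>A\<bar> + \<bar>B\<bar>)"
  have "tube \<subseteq> cbox (- c) c \<times> I"
  proof
    fix z assume z: "z \<in> tube"
    have "snd z \<in> I"
    proof -
      have "\<not> Y (snd z) < a" "\<not> b < Y (snd z)" using z by (auto simp: tube_def)
      then show ?thesis unfolding collapse_less_iff by (simp add: I_def)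
    qed
    moreover have "\<bar>fst z $ j\<bar> \<le> \<bar>A\<bar> + \<bar>B\<bar>" for j
    proof -
      have "\<alpha> (snd z) $ j \<le> fst z $ j" "fst z $ j \<le> \<beta> (snd z) $ j" using z by (auto simp: tube_def mem_box_cart)
      moreover have "\<bar>\<alpha> (snd z) $ j\<bar> \<le> A" "\<bar>\<beta> (snd z) $ j\<bar> \<le> B"
        using AB[OF \<open>snd z \<in> I\<close>] component_le_norm_cart order_trans by blast+
      ultimately show ?thesis by linarith
    qed
    then have "fst z \<in> cbox (- c) c" unfolding mem_box_cart c_def
      by (simp add: abs_le_iff) (smt (verit, best))
    ultimately show "z \<in> cbox (- c) c \<times> I" by (simp add: mem_Times_iff)
  qed
  moreover have "bounded (cbox (- c) c \<times> I)" unfolding I_def by (intro bounded_Times) auto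
  ultimately show ?thesis using cl by (metis bounded_subset compact_eq_bounded_closed)
qed

text \<open>The criterion is fed with \<open>k \<circ> h\<close>, where \<open>k\<close> is the
  inverse of the shrinking map \<open>K\<close>. If \<open>k (h z)\<close> and
  \<open>k (h w)\<close> lie in one fibre of \<open>q\<close>, then \<open>h z\<close> and
  \<open>h w\<close> are their images under \<open>K\<close>, hence close; as \<open>h\<close> is a
  homeomorphism, \<open>z\<close> and \<open>w\<close> are close as well.\<close>

lemma homeomorphic_tube:
  "\<exists>f g. homeomorphism UNIV UNIV f g \<and>
     f ` tube = {(x, y). y \<in> {a..b} \<and> (x \<in> cbox (L y) (L y + 1) \<or> x \<in> cbox (R y) (R y + 1))}"
  unfolding q_tube[symmetric]
proof (rule shrinking_criterion[OF _ _ _ compact_tube refl])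
  show "continuous_on UNIV q"
    unfolding q_def by (intro continuous_intros continuous_on_compose2[OF continuous_collapse]) auto
  show "surj q"
  proof (rule surjI)
    fix w :: "(real ^ 'n) \<times> real"
    have "Y (jump_lo d (snd w)) = snd w" using jump_lo_le_hi[of d "snd w"] by (auto simp: collapse_iff)
    then show "q (fst w, jump_lo d (snd w)) = w" by (simp add: q_def)
  qed
  show "dist (q z) z \<le> 2" for z
    using collapse_near[of d "snd z"] by (cases z) (simp add: q_def dist_Pair_Pair dist_real_def)
  fix h :: "(real ^ 'n) \<times> real \<Rightarrow> (real ^ 'n) \<times> real" and e :: real and n
  assume h: "h \<in> {h. (\<exists>g. homeomorphism UNIV UNIV h g) \<and> h ` tube = tube}" and e: "e > 0"
  then obtain g where g: "homeomorphism UNIV UNIV h g" and htube: "h ` tube = tube" by auto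
  obtain \<eta> where \<eta>: "\<eta> > 0" "\<And>z w. z \<in> cball 0 (real n) \<Longrightarrow> w \<in> cball 0 (real n) \<Longrightarrow> dist (h z) (h w) < \<eta> \<Longrightarrow> dist z w < 1 / real (Suc n)"
  proof -
    have "dist z w < 1 / real (Suc n)" if "h z = h w" for z w
      using injD[OF homeomorphism_UNIV_simps(5)[OF g] that] by simp
    then show ?thesis
      using small_fibres_uniform[OF compact_cball homeomorphism_UNIV_simps(3)[OF g], of 0 "real n" "1 / real (Suc n)"] that
      by blast
  qed
  \<comment> \<open>Gaps over heights not among the first \<open>N\<close> entries of
    \<open>d\<close> have length at most \<open>2 * (1/2)^N\<close>, less than
    \<open>\<eta> / 2\<close>; only the others have to be shrunk.\<close>
  obtain N where N: "(1/2::real)^N < \<eta> / 4" using real_arch_pow_inv[of "\<eta> / 4" "1/2"] \<eta> by auto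
  define G where "G = d ` {..<N}"
  have finG: "finite G" and Gd: "G \<subseteq> range d" by (auto simp: G_def)
  have small: "\<bar>t - t'\<bar> < \<eta> / 2" if "Y t = Y t'" "Y t \<notin> G" for t t'
  proof -
    have "jump_hi d (Y t) - jump_lo d (Y t) \<le> 2 * (1/2)^N"
      using that(2) by (intro jump_width) (metis G_def imageI lessThan_iff)
    moreover have "\<bar>t - t'\<bar> \<le> jump_hi d (Y t) - jump_lo d (Y t)"
      using jump_collapse[where d = d and t = t] jump_collapse[where d = d and t = t'] that(1) by auto
    ultimately show ?thesis using N by linarith
  qed
  \<comment> \<open>Half the distances between treated heights make their slabs disjoint; half the
    distances to \<open>a\<close> and \<open>b\<close> keep the slabs away from the ends of the
    tube. The element 1 makes the minimum meaningful when \<open>G\<close> is empty.\<close>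
  define \<Delta> where "\<Delta> = insert 1 ((\<lambda>(y, y'). \<bar>y - y'\<bar> / 2) ` {(y, y') \<in> G \<times> (insert a (insert b G)). y \<noteq> y'})"
  have fin\<Delta>: "finite \<Delta>"
  proof -
    have "finite {(y, y') \<in> G \<times> (insert a (insert b G)). y \<noteq> y'}"
      by (rule finite_subset[of _ "G \<times> (insert a (insert b G))"]) (use finG in auto)
    then show ?thesis by (simp add: \<Delta>_def)
  qed
  have pos\<Delta>: "\<And>s. s \<in> \<Delta> \<Longrightarrow> s > 0" by (auto simp: \<Delta>_def)
  define \<delta> where "\<delta> = min (Min \<Delta>) (min (e / 4) (\<eta> / 2))"
  have "Min \<Delta> > 0" using fin\<Delta> pos\<Delta> by (subst Min_gr_iff) (auto simp: \<Delta>_def)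
  then have \<delta>: "\<delta> > 0" "3 * \<delta> < e" "\<delta> \<le> \<eta> / 2" using e \<eta> by (auto simp: \<delta>_def)
  have sep: "2 * \<delta> \<le> \<bar>y - y'\<bar>" if "y \<in> G" "y' \<in> insert a (insert b G)" "y \<noteq> y'" for y y'
  proof -
    have "\<bar>y - y'\<bar> / 2 \<in> \<Delta>" using that unfolding \<Delta>_def by (intro insertI2 image_eqI[of _ _ "(y, y')"]) auto
    then have "Min \<Delta> \<le> \<bar>y - y'\<bar> / 2" using fin\<Delta> Min_le by blast
    then show ?thesis by (simp add: \<delta>_def)
  qed
  obtain K k where K: "homeomorphism UNIV UNIV K k"
      "\<And>z. K z = z \<or> (\<exists>y\<in>G. \<bar>Y (snd z) - y\<bar> < \<delta> \<and> \<bar>Y (snd (K z)) - y\<bar> < \<delta>)"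
      "\<And>z. dist (fst (K z)) (fst z) < \<delta>" "\<And>z. K z \<in> column \<alpha> \<beta> \<longleftrightarrow> z \<in> column \<alpha> \<beta>"
      "\<And>x t t'. Y t = Y t' \<Longrightarrow> dist (K (x, t)) (K (x, t')) < (if Y t \<in> G then 0 else \<bar>t - t'\<bar>) + \<delta>"
    using finite_gaps_shrinking[OF one_gap[OF _ \<delta>(1)] \<delta>(1) finG Gd] sep by (auto 0 3)
  have Ktube: "K z \<in> tube \<longleftrightarrow> z \<in> tube" for z
  proof -
    have "Y (snd (K z)) \<in> {a..b} \<longleftrightarrow> Y (snd z) \<in> {a..b}"
    proof (cases "K z = z")
      case False
      then obtain y where y: "y \<in> G" "\<bar>Y (snd z) - y\<bar> < \<delta>" "\<bar>Y (snd (K z)) - y\<bar> < \<delta>" using K(2)[of z] by blast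
      have "y \<noteq> a" "y \<noteq> b" using y(1) Gd ab by auto
      then have "2 * \<delta> \<le> \<bar>y - a\<bar>" "2 * \<delta> \<le> \<bar>y - b\<bar>" using sep[of y] y(1) by auto
      then show ?thesis using y by auto
    qed simp
    then show ?thesis using K(4)[of z] by (simp add: tube_def)
  qed
  have kK: "k (K z) = z" "K (k z) = z" for z using homeomorphism_UNIV_simps[OF K(1)] by auto
  have "k ` tube = tube"
  proof
    show "k ` tube \<subseteq> tube" using Ktube[of "k z" for z] by (auto simp: kK)
    show "tube \<subseteq> k ` tube"
    proof
      fix z assume "z \<in> tube"
      then show "z \<in> k ` tube" using Ktube[of z] kK(1)[of z] by (intro image_eqI[of _ _ "K z"]) auto
    qed
  qed
  then have "(k \<circ> h) ` tube = tube" using htube by (simp only: image_comp[symmetric])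
  moreover have "homeomorphism UNIV UNIV (k \<circ> h) (g \<circ> K)"
    by (rule homeomorphism_compose[OF g homeomorphism_symD[OF K(1)]])
  moreover have "dist (q ((k \<circ> h) z)) (q (h z)) < e" for z
  proof -
    define w where "w = k (h z)"
    have hz: "h z = K w" by (simp add: w_def kK)
    have "dist (Y (snd w)) (Y (snd (K w))) < 2 * \<delta>"
      using K(2)[of w] \<delta>(1) by (auto simp: dist_real_def)
    moreover have "dist (fst w) (fst (K w)) < \<delta>" using K(3)[of w] by (simp add: dist_commute)
    moreover have "dist (q w) (q (K w)) \<le> dist (fst w) (fst (K w)) + dist (Y (snd w)) (Y (snd (K w)))"
      unfolding q_def dist_Pair_Pair by (rule sqrt_sum_squares_le_sum) auto
    ultimately show ?thesis using \<delta>(2) by (simp add: hz[symmetric] flip: w_def)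
  qed
  moreover have "dist z w < 1 / real (Suc n)"
    if zw: "z \<in> cball 0 (real n)" "w \<in> cball 0 (real n)" "q ((k \<circ> h) z) = q ((k \<circ> h) w)" for z w
  proof (rule \<eta>(2)[OF zw(1,2)])
    define x where "x = fst (k (h z))"
    define t where "t = snd (k (h z))"
    define t' where "t' = snd (k (h w))"
    have x: "fst (k (h w)) = x" and Yt: "Y t = Y t'" using zw(3) by (auto simp: q_def x_def t_def t'_def)
    have "k (h z) = (x, t)" "k (h w) = (x, t')" using x by (simp_all add: x_def t_def t'_def prod_eq_iff)
    then have "h z = K (x, t)" "h w = K (x, t')" using kK(2)[of "h z"] kK(2)[of "h w"] by auto
    then have "dist (h z) (h w) < (if Y t \<in> G then 0 else \<bar>t - t'\<bar>) + \<delta>" using K(5)[OF Yt] by simp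
    also have "\<dots> \<le> \<eta> / 2 + \<eta> / 2" using small[OF Yt] \<delta>(3) \<eta>(1) by (auto intro: less_imp_le)
    finally show "dist (h z) (h w) < \<eta>" by simp
  qed
  ultimately show "\<exists>h'\<in>{h. (\<exists>g. homeomorphism UNIV UNIV h g) \<and> h ` tube = tube}. (\<forall>a. dist (q (h' a)) (q (h a)) < e) \<and>
        (\<forall>a\<in>cball 0 (real n). \<forall>b\<in>cball 0 (real n). q (h' a) = q (h' b) \<longrightarrow> dist a b < 1 / real (Suc n))"
    by (intro bexI[of _ "k \<circ> h"]) blast+
qed

text \<open>The preceding homeomorphism is undone first: over the blown-up interval the fibres are
  boxes with continuous ends, which stretch to a common box.\<close>

lemma homeomorphism_to_cube:
  "\<exists>f g. homeomorphism UNIV UNIV f g \<and>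
     f ` {(x, y). y \<in> {a..b} \<and> (x \<in> cbox (L y) (L y + 1) \<or> x \<in> cbox (R y) (R y + 1))} =
       cbox (-1 :: real ^ 'n) 1 \<times> {-1..1 :: real}"
proof -
  obtain f g where fg: "homeomorphism UNIV UNIV f g"
    and f: "f ` tube = {(x, y). y \<in> {a..b} \<and> (x \<in> cbox (L y) (L y + 1) \<or> x \<in> cbox (R y) (R y + 1))}"
    using homeomorphic_tube by blast
  define S where "S = (\<lambda>z::(real^'n) \<times> real. (\<chi> j. stretch (\<alpha> (snd z) $ j) (\<beta> (snd z) $ j)
      ((-1 :: real^'n) $ j) ((1 :: real^'n) $ j) (fst z $ j), snd z))"
  have "\<exists>S'. homeomorphism UNIV UNIV S S'"
    and Scol: "S z \<in> column (\<lambda>_. -1) (\<lambda>_. 1) \<longleftrightarrow> z \<in> column \<alpha> \<beta>" for z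
    unfolding S_def
    by (rule column_stretch[OF continuous_\<alpha> continuous_\<beta> continuous_on_const continuous_on_const \<alpha>_less_\<beta>]; simp)+
  then obtain S' where S': "homeomorphism UNIV UNIV S S'" by blast
  define u where "u = jump_lo d a"
  define v where "v = jump_hi d b"
  have Yuv: "Y t \<in> {a..b} \<longleftrightarrow> t \<in> {u..v}" for t
    using collapse_less_iff(1)[of d t a] collapse_less_iff(2)[of b d t] by (auto simp: u_def v_def)
  have uv: "u < v" using jump_gap[OF ab(1), of d] jump_lo_le_hi[of d a] jump_lo_le_hi[of d b] ab(1) by (simp add: u_def v_def)
  define P where "P = (\<lambda>z::(real^'n) \<times> real. (fst z, (2 * snd z - u - v) / (v - u)))"
  define P' where "P' = (\<lambda>z::(real^'n) \<times> real. (fst z, (snd z * (v - u) + u + v) / 2))"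
  have PP': "P (P' z) = z" "P' (P z) = z" for z using uv by (simp_all add: P_def P'_def prod_eq_iff nonzero_divide_eq_eq) (simp_all add: field_simps)
  have P: "homeomorphism UNIV UNIV P P'"
  proof (rule homeomorphismI)
    show "continuous_on UNIV P" "continuous_on UNIV P'"
      unfolding P_def P'_def using uv by (auto intro!: continuous_intros)
  qed (auto simp: PP')
  have "homeomorphism UNIV UNIV (P \<circ> S \<circ> g) (f \<circ> (S' \<circ> P'))"
    using homeomorphism_compose[OF homeomorphism_symD[OF fg] homeomorphism_compose[OF S' P]] by (simp add: comp_assoc)
  moreover have "(P \<circ> S \<circ> g) ` (f ` tube) = cbox (-1 :: real ^ 'n) 1 \<times> {-1..1 :: real}"
  proof -
    have "g ` (f ` tube) = tube" by (simp add: image_image homeomorphism_UNIV_simps[OF fg])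
    moreover have PS: "P (S z) \<in> cbox (-1) 1 \<times> {-1..1} \<longleftrightarrow> z \<in> tube" for z
    proof -
      have "(2 * t - u - v) / (v - u) \<in> {-1..1} \<longleftrightarrow> t \<in> {u..v}" for t
        using uv by (auto simp: field_simps)
      moreover have "snd (S z) = snd z" by (simp add: S_def)
      ultimately show ?thesis using Scol[of z] Yuv[of "snd z"] by (simp add: P_def tube_def mem_Times_iff)
    qed
    moreover have "(P \<circ> S) ` tube = cbox (-1) 1 \<times> {-1..1}"
    proof (intro equalityI subsetI)
      fix w :: "(real^'n) \<times> real" assume "w \<in> cbox (-1) 1 \<times> {-1..1}"
      moreover have "P (S (S' (P' w))) = w" by (simp add: homeomorphism_UNIV_simps[OF S'] PP')
      ultimately show "w \<in> (P \<circ> S) ` tube" using PS[of "S' (P' w)"] by (intro image_eqI[of _ _ "S' (P' w)"]) auto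
    next
      fix w assume "w \<in> (P \<circ> S) ` tube"
      then obtain z where "z \<in> tube" "w = P (S z)" by auto
      then show "w \<in> cbox (-1) 1 \<times> {-1..1}" using PS by blast
    qed
    ultimately show ?thesis by (simp only: image_comp[symmetric])
  qed
  ultimately show ?thesis unfolding f by blast
qed

end

section \<open>Expansions in an integer base\<close>

text \<open>The numbers \<open>\<Sum> e\<^sub>k / m\<^sup>k\<close> with digits \<open>e\<^sub>k\<close> in \<open>{0..<\<bar>m\<bar>}\<close> form the unit interval starting at
  \<open>least_value m\<close>.\<close>

definition least_value :: "int \<Rightarrow> real" where
  "least_value m = (if 0 < m then 0 else of_int m / (1 - of_int m))"

text \<open>The two conventions differ when \<open>z\<close> is an integer: \<open>up\<close>
  chooses the cell starting at \<open>z\<close>, otherwise the cell ending there is chosen. The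
  clamps keep the digit in range at \<open>z = 0\<close> and \<open>z = N\<close>, where only one
  cell exists.\<close>

definition floor_digit :: "int \<Rightarrow> bool \<Rightarrow> real \<Rightarrow> int" where
  "floor_digit N up z = (if up then min \<lfloor>z\<rfloor> (N - 1) else max (\<lceil>z\<rceil> - 1) 0)"

lemma floor_digit_range:
  assumes "0 \<le> z" "z \<le> of_int N" "1 \<le> N"
  shows "0 \<le> floor_digit N u z" "floor_digit N u z < N"
    "of_int (floor_digit N u z) \<le> z" "z \<le> of_int (floor_digit N u z) + 1"
proof -
  have 1: "0 \<le> \<lfloor>z\<rfloor>" "\<lceil>z\<rceil> \<le> N" using assms by (auto simp: ceiling_le_iff)
  then show "0 \<le> floor_digit N u z" "floor_digit N u z < N" using assms by (auto simp: floor_digit_def)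
  show "of_int (floor_digit N u z) \<le> z"
    using assms of_int_floor_le[of z] ceiling_correct[of z] by (auto simp: floor_digit_def min_def max_def; linarith)
  show "z \<le> of_int (floor_digit N u z) + 1"
    using assms floor_correct[of z] ceiling_correct[of z] by (auto simp: floor_digit_def min_def max_def; linarith)
qed

lemma floor_digit_strict:
  "z < of_int N \<Longrightarrow> z < of_int (floor_digit N True z) + 1" "0 < z \<Longrightarrow> of_int (floor_digit N False z) < z"
  using floor_correct[of z] ceiling_correct[of z] by (auto simp: floor_digit_def min_def max_def; linarith)+

lemma floor_digit_ends:
  "1 \<le> N \<Longrightarrow> floor_digit N u 0 = 0" "1 \<le> N \<Longrightarrow> floor_digit N u (of_int N) = N - 1"
  by (auto simp: floor_digit_def)

lemma floor_digit_eqI: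
  assumes "0 \<le> k" "k < N"
  shows "of_int k \<le> z \<Longrightarrow> z < of_int k + 1 \<Longrightarrow> floor_digit N True z = k"
    and "of_int k < z \<Longrightarrow> z \<le> of_int k + 1 \<Longrightarrow> floor_digit N False z = k"
proof -
  assume "of_int k \<le> z" "z < of_int k + 1"
  then have "\<lfloor>z\<rfloor> = k" by (simp add: floor_eq_iff)
  then show "floor_digit N True z = k" using assms by (simp add: floor_digit_def)
next
  assume "of_int k < z" "z \<le> of_int k + 1"
  then have "\<lceil>z\<rceil> = k + 1" by (simp add: ceiling_eq_iff)
  then show "floor_digit N False z = k" using assms by (simp add: floor_digit_def)
qed

locale radix =
  fixes r :: int
  assumes r: "2 \<le> \<bar>r\<bar>"
begin

abbreviation lo :: real where "lo \<equiv> least_value r"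
abbreviation hi :: real where "hi \<equiv> lo + 1"

definition side :: "bool \<Rightarrow> bool" where "side b \<longleftrightarrow> b = (0 < r)"

text \<open>The first digit of the expansion of \<open>y\<close> that is a limit of expansions of numbers to its right
  (\<open>b = True\<close>) or to its left (\<open>b = False\<close>); \<open>succ\<close> shifts the expansion by one place, and
  \<open>side\<close> records that this reverses the order when \<open>r\<close> is negative.\<close>

definition digit :: "bool \<Rightarrow> real \<Rightarrow> int" where
  "digit b y = floor_digit \<bar>r\<bar> (side b) (of_int r * y - lo)"

definition succ :: "bool \<Rightarrow> real \<Rightarrow> real" where
  "succ b y = of_int r * y - of_int (digit b y)"

text \<open>A negative base interchanges the ends: \<open>r * hi\<close> is \<open>lo\<close> with
  digit 0, and \<open>r * lo\<close> is \<open>hi\<close> plus the largest digit. These equations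
  determine \<open>least_value\<close>.\<close>

lemma r_cases:
  "(0 < r \<and> lo = 0) \<or> (r < 0 \<and> of_int r * hi = lo \<and> of_int r * lo = lo - of_int r)"
proof (cases "0 < r")
  case False
  then have "of_int r < (0::real)" using r by simp
  then have "of_int r * hi = lo" "of_int r * lo = lo - of_int r"
    using False by (auto simp: least_value_def field_simps)
  with False r show ?thesis by auto
qed (simp add: least_value_def)

lemma scaled_range: 
  assumes "y \<in> {lo..hi}" shows "0 \<le> of_int r * y - lo" "of_int r * y - lo \<le> of_int \<bar>r\<bar>"
proof -
  consider "0 < r" "lo = 0" | "r < 0" "of_int r * hi = lo" "of_int r * lo = lo - of_int r"
    using r_cases by blast
  then have "0 \<le> of_int r * y - lo \<and> of_int r * y - lo \<le> of_int \<bar>r\<bar>"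
  proof cases
  case 1
  then have "0 \<le> of_int r * y" "of_int r * y \<le> of_int r * 1" using assms by (auto intro: mult_left_mono)
  then show ?thesis using 1 by auto
next
  case 2
  have "of_int r * hi \<le> of_int r * y" "of_int r * y \<le> of_int r * lo"
    by (rule mult_left_mono_neg; use 2(1) assms in simp)+
  then have "lo \<le> of_int r * y" "of_int r * y \<le> lo - of_int r" by (simp_all only: 2)
  then show ?thesis using 2(1) by simp
  qed
  then show "0 \<le> of_int r * y - lo" "of_int r * y - lo \<le> of_int \<bar>r\<bar>" by auto
qed

lemma digit_range:
  assumes "y \<in> {lo..hi}" shows "0 \<le> digit b y" "digit b y < \<bar>r\<bar>" "succ b y \<in> {lo..hi}"
  using floor_digit_range[OF scaled_range[OF assms], of "side b"] r by (auto simp: digit_def succ_def)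

lemma digit_eqI:
  assumes k: "0 \<le> k" "k < \<bar>r\<bar>" and y': "of_int r * y = y' + of_int k"
  shows "lo \<le> y' \<Longrightarrow> y' < hi \<Longrightarrow> side b \<Longrightarrow> digit b y = k"
    and "lo < y' \<Longrightarrow> y' \<le> hi \<Longrightarrow> \<not> side b \<Longrightarrow> digit b y = k"
  using floor_digit_eqI[OF k, of "of_int r * y - lo"] y' by (auto simp: digit_def)

lemma side_surj: "\<exists>b. side b = c"
  by (auto simp: side_def)

text \<open>Any digit may be put in front of any admissible remainder; with
  \<open>digit_range\<close> this is the self-similarity of the unit interval.\<close>

lemma in_range_iff: 
  assumes k: "0 \<le> k" "k < \<bar>r\<bar>" and y': "y' \<in> {lo..hi}" and eq: "of_int r * y = y' + of_int k"
  shows "y \<in> {lo..hi}"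
proof -
  have k1: "of_int k \<le> of_int \<bar>r\<bar> - (1::real)" using k(2) by (metis of_int_1 of_int_diff of_int_le_iff zle_diff1_eq)
  consider "0 < r" "lo = 0" | "r < 0" "of_int r * hi = lo" "of_int r * lo = lo - of_int r"
    using r_cases by blast
  then show ?thesis
  proof cases
    case 1
    then have "of_int r * 0 \<le> of_int r * y" "of_int r * y \<le> of_int r * 1"
      using eq k k1 y' by auto
    then show ?thesis using 1 by (auto simp: zero_le_mult_iff)
  next
    case 2
    have "lo \<le> of_int r * y" "of_int r * y \<le> lo - of_int r"
      using eq k(1) k1 y' 2(1) by auto
    then have "of_int r * hi \<le> of_int r * y" "of_int r * y \<le> of_int r * lo"
      by (simp_all only: 2)
    moreover have "of_int r < (0 :: real)" using 2(1) by simp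
    ultimately have "y \<le> hi" "lo \<le> y" by (simp_all only: mult_le_cancel_left_neg)
    then show ?thesis by simp
  qed
qed

text \<open>At an end of the interval the clamps leave a single digit, and the shift leads to an end
  again. So the expansions of the ends are unambiguous forever.\<close>

lemma digit_ends:
  assumes "y \<in> {lo, hi}"
  shows "digit b y = digit c y" "succ b y \<in> {lo, hi}"
proof -
  have *: "floor_digit \<bar>r\<bar> u 0 = 0" "floor_digit \<bar>r\<bar> u (of_int \<bar>r\<bar>) = \<bar>r\<bar> - 1" for u
    using floor_digit_ends[of "\<bar>r\<bar>"] r by auto
  have z: "of_int r * y - lo = 0 \<or> of_int r * y - lo = of_int \<bar>r\<bar>"
    using assms r_cases by (auto simp: algebra_simps)
  then show "digit b y = digit c y" unfolding digit_def by (metis *)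
  show "succ b y \<in> {lo, hi}" using z
  proof
    assume 0: "of_int r * y - lo = 0"
    then have "digit b y = 0" by (simp only: digit_def *)
    then show ?thesis using 0 by (simp add: succ_def)
  next
    assume 1: "of_int r * y - lo = of_int \<bar>r\<bar>"
    then have "digit b y = \<bar>r\<bar> - 1" by (simp only: digit_def *)
    then show ?thesis using 1 by (simp add: succ_def)
  qed
qed

text \<open>\<gamma> is the distance from \<open>z\<close> to the far end of its digit cell in the
  direction of approach. It vanishes only at an end of the whole range, and then no
  \<open>y'\<close> exists on that side.\<close>

lemma digit_locally_constant:
  assumes y: "y \<in> {lo..hi}"
  shows "\<exists>\<delta>>0. \<forall>y'\<in>{lo..hi}. \<bar>y' - y\<bar> < \<delta> \<and> (if b then y < y' else y' < y) \<longrightarrow> (\<forall>c. digit c y' = digit b y)"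
proof -
  define z where "z = of_int r * y - lo"
  define k where "k = floor_digit \<bar>r\<bar> (side b) z"
  note z = scaled_range[OF y, folded z_def]
  have k: "0 \<le> k" "k < \<bar>r\<bar>" "of_int k \<le> z" "z \<le> of_int k + 1"
    using floor_digit_range[OF z, of "side b"] r by (auto simp: k_def)
  have ord: "(if side b then of_int r * y < of_int r * y' else of_int r * y' < of_int r * y)" 
    if "if b then y < y' else y' < y" for y' :: real
    using that r by (auto simp: side_def mult_less_cancel_left split: if_splits)
  define \<gamma> where "\<gamma> = (if side b then of_int k + 1 - z else z - of_int k)"
  show ?thesis
  proof (cases "\<gamma> > 0")
    case True
    have "digit c y' = k" if y': "\<bar>y' - y\<bar> < \<gamma> / of_int \<bar>r\<bar>" "if b then y < y' else y' < y" for c y'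
    proof -
      have "\<bar>of_int r * y' - of_int r * y\<bar> = of_int \<bar>r\<bar> * \<bar>y' - y\<bar>"
        by (simp add: abs_mult flip: right_diff_distrib)
      also have "\<dots> < \<gamma>" using y'(1) r by (simp add: field_simps)
      finally have "of_int k < of_int r * y' - lo" "of_int r * y' - lo < of_int k + 1"
        using ord[OF y'(2)] k(3,4) by (auto simp: \<gamma>_def z_def split: if_splits)
      then show ?thesis
        using floor_digit_eqI[OF k(1,2), of "of_int r * y' - lo"] unfolding digit_def by (cases "side c") auto
    qed
    moreover have "\<gamma> / of_int \<bar>r\<bar> > 0" using True r by simp
    ultimately show ?thesis unfolding k_def z_def digit_def[symmetric] by blast
  next
    case False
    have bdry: "if side b then z = of_int \<bar>r\<bar> else z = 0"
    proof (cases "side b")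
      case True
      with \<open>\<not> \<gamma> > 0\<close> floor_digit_strict(1)[of z "\<bar>r\<bar>"] z show ?thesis
        unfolding \<gamma>_def k_def by (metis diff_gt_0_iff_gt order_le_less)
    next
      case False
      with \<open>\<not> \<gamma> > 0\<close> floor_digit_strict(2)[of z "\<bar>r\<bar>"] z show ?thesis
        unfolding \<gamma>_def k_def by (metis diff_gt_0_iff_gt order_le_less)
    qed
    have "\<not> (if b then y < y' else y' < y)" if "y' \<in> {lo..hi}" for y'
      using ord[of y'] scaled_range[OF that] bdry by (auto simp: z_def split: if_splits)
    then show ?thesis using zero_less_one by blast
  qed
qed

text \<open>The conventions disagree only when \<open>z\<close> is an integer strictly between 0 and
  \<open>\<bar>r\<bar>\<close>, the common boundary of two cells; the remainders are then opposite
  ends of the interval.\<close>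

lemma digits_differ:
  assumes y: "y \<in> {lo..hi}" and ne: "digit True y \<noteq> digit False y" and b: "side b"
  shows "\<exists>k. 0 \<le> k \<and> k + 1 < \<bar>r\<bar> \<and> digit b y = k + 1 \<and> digit (\<not> b) y = k \<and> succ b y = lo \<and> succ (\<not> b) y = hi"
proof -
  define z where "z = of_int r * y - lo"
  note z = scaled_range[OF y, folded z_def]
  have nb: "\<not> side (\<not> b)" using b by (auto simp: side_def)
  have d: "digit b y = floor_digit \<bar>r\<bar> True z" "digit (\<not> b) y = floor_digit \<bar>r\<bar> False z"
    using b nb by (auto simp: digit_def z_def)
  have r1: "1 \<le> \<bar>r\<bar>" using r by simp
  define k where "k = floor_digit \<bar>r\<bar> False z"
  note kr = floor_digit_range[OF z r1, of False, folded k_def]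
  note lr = floor_digit_range[OF z r1, of True]
  have ne': "floor_digit \<bar>r\<bar> True z \<noteq> k"
    using ne d unfolding k_def by (metis (full_types))
  have "\<not> z < of_int k + 1" using floor_digit_eqI(1)[OF kr(1,2)] kr(3) ne' by blast
  then have zk: "z = of_int k + 1" using kr(4) by simp
  have zN: "z < of_int \<bar>r\<bar>"
  proof (rule ccontr)
    assume "\<not> z < of_int \<bar>r\<bar>"
    then have "z = of_int \<bar>r\<bar>" using z by simp
    then have "floor_digit \<bar>r\<bar> True z = \<bar>r\<bar> - 1" "k = \<bar>r\<bar> - 1"
      using floor_digit_ends(2)[OF r1] by (simp_all only: k_def)
    with ne' show False by simp
  qed
  then have k1: "k + 1 < \<bar>r\<bar>" using zk by linarith
  have "floor_digit \<bar>r\<bar> True z = k + 1" using floor_digit_eqI(1)[of "k + 1" "\<bar>r\<bar>" z] kr(1) k1 zk by simp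
  then have "digit b y = k + 1" "digit (\<not> b) y = k" using d by (simp_all only: k_def)
  moreover have "of_int r * y = lo + of_int k + 1" using zk by (simp add: z_def)
  ultimately show ?thesis using kr(1) k1 by (intro exI[of _ k]) (simp add: succ_def)
qed

end

section \<open>The paths traced by the fibres\<close>

lemma le_geometric_imp_le:
  fixes x M C c :: real
  assumes "\<And>n. x \<le> M + C * c ^ n" "0 \<le> c" "c < 1"
  shows "x \<le> M"
proof (rule LIMSEQ_le_const)
  have "(\<lambda>n. M + C * c ^ n) \<longlonglongrightarrow> M + C * 0"
    using assms by (intro tendsto_intros LIMSEQ_power_zero) simp
  then show "(\<lambda>n. M + C * c ^ n) \<longlonglongrightarrow> M" by simp
qed (use assms in blast)

locale digit_path = radix r for r :: int +
  fixes P :: int and A :: "int \<Rightarrow> real" and \<sigma> :: real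
  assumes P: "2 \<le> \<bar>P\<bar>"
begin

definition shift :: "bool \<times> real \<Rightarrow> bool \<times> real" where
  "shift = (\<lambda>(b, y). (side b, succ b y))"

definition cost :: "bool \<times> real \<Rightarrow> real" where
  "cost = (\<lambda>(b, y). A (digit b y) + \<sigma> * y)"

text \<open>One coordinate of the path, as the series obtained by iterating \<open>g_rec\<close>:
  \<open>A\<close> holds the translations and \<sigma> the shear. The state of \<open>shift\<close>
  contains the side of approach because a negative base reverses it.\<close>

definition g :: "bool \<Rightarrow> real \<Rightarrow> real" where
  "g b y = (\<Sum>n. cost ((shift ^^ n) (b, y)) / of_int P ^ Suc n)"

lemma half_le: "\<bar>x / of_int P\<bar> \<le> \<bar>x\<bar> / 2" for x :: real
proof -
  have "\<bar>x\<bar> / real_of_int \<bar>P\<bar> \<le> \<bar>x\<bar> / 2" using P by (intro divide_left_mono) auto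
  then show ?thesis by simp
qed

lemma cost_bounded: "\<exists>M\<ge>0. \<forall>b n. \<forall>y\<in>{lo..hi}. \<bar>cost ((shift ^^ n) (b, y)) / of_int P ^ Suc n\<bar> \<le> M * (1/2) ^ Suc n"
proof -
  define M where "M = (\<Sum>e\<in>{0..<\<bar>r\<bar>}. \<bar>A e\<bar>) + \<bar>\<sigma>\<bar> * (\<bar>lo\<bar> + 1)"
  have c: "\<bar>cost (b, y)\<bar> \<le> M" if y: "y \<in> {lo..hi}" for b y
  proof -
    have "\<bar>A (digit b y)\<bar> \<le> (\<Sum>e\<in>{0..<\<bar>r\<bar>}. \<bar>A e\<bar>)"
      using digit_range[OF y, of b] by (intro member_le_sum) auto
    moreover have "\<bar>\<sigma> * y\<bar> \<le> \<bar>\<sigma>\<bar> * (\<bar>lo\<bar> + 1)"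
      unfolding abs_mult using y by (intro mult_left_mono) auto
    ultimately show ?thesis by (simp add: cost_def M_def)
  qed
  have M: "M \<ge> 0" by (simp add: M_def sum_nonneg)
  have inI: "snd ((shift ^^ n) (b, y)) \<in> {lo..hi}" if "y \<in> {lo..hi}" for b n y
    using that
  proof (induction n)
    case (Suc n)
    have "snd (shift z) = succ (fst z) (snd z)" for z by (simp add: shift_def split_beta)
    then show ?case using digit_range(3)[OF Suc.IH] Suc.prems by simp
  qed simp
  have "\<bar>cost ((shift ^^ n) (b, y))\<bar> \<le> M" if "y \<in> {lo..hi}" for b n y
    using c[OF inI[OF that, of n b], of "fst ((shift ^^ n) (b, y))"] by simp
  moreover have "(1 / real_of_int \<bar>P\<bar>) ^ Suc n \<le> (1/2) ^ Suc n" for n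
    using P by (intro power_mono divide_left_mono) auto
  ultimately have "\<bar>cost ((shift ^^ n) (b, y))\<bar> * (1 / real_of_int \<bar>P\<bar>) ^ Suc n \<le> M * (1/2) ^ Suc n"
    if "y \<in> {lo..hi}" for b n y
    using that M by (intro mult_mono) auto
  moreover have "\<bar>x / of_int P ^ Suc n\<bar> = \<bar>x\<bar> * (1 / real_of_int \<bar>P\<bar>) ^ Suc n" for x n
    by (simp add: power_divide abs_mult power_abs)
  ultimately show ?thesis using M by (intro exI[of _ M]) simp
qed

lemma summable_cost:
  assumes "y \<in> {lo..hi}"
  shows "summable (\<lambda>n. cost ((shift ^^ n) (b, y)) / of_int P ^ Suc n)"
proof -
  obtain M where M: "\<And>n. \<bar>cost ((shift ^^ n) (b, y)) / of_int P ^ Suc n\<bar> \<le> M * (1/2) ^ Suc n"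
    using cost_bounded assms by blast
  have "summable (\<lambda>n. M * (1/2::real) ^ Suc n)"
    by (intro summable_mult summable_Suc_iff[THEN iffD2] summable_geometric) simp
  then show ?thesis by (rule summable_comparison_test') (simp only: real_norm_def M)
qed

lemma g_bounded: "\<exists>B\<ge>0. \<forall>b. \<forall>y\<in>{lo..hi}. \<bar>g b y\<bar> \<le> B"
proof -
  obtain M where M: "M \<ge> 0" "\<And>b n y. y \<in> {lo..hi} \<Longrightarrow> \<bar>cost ((shift ^^ n) (b, y)) / of_int P ^ Suc n\<bar> \<le> M * (1/2) ^ Suc n"
    using cost_bounded by blast
  have sm: "summable (\<lambda>n. M * (1/2::real) ^ Suc n)"
    by (intro summable_mult summable_Suc_iff[THEN iffD2] summable_geometric) simp
  have "\<bar>g b y\<bar> \<le> (\<Sum>n. M * (1/2::real) ^ Suc n)" if y: "y \<in> {lo..hi}" for b y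
  proof -
    have s: "summable (\<lambda>n. \<bar>cost ((shift ^^ n) (b, y)) / of_int P ^ Suc n\<bar>)"
      by (rule summable_comparison_test'[OF sm]) (simp only: real_norm_def abs_abs M(2)[OF y])
    show ?thesis unfolding g_def
      using summable_rabs[OF s] suminf_le[OF M(2)[OF y] s sm] by linarith
  qed
  moreover have "0 \<le> (\<Sum>n. M * (1/2::real) ^ Suc n)" using M(1) by (intro suminf_nonneg sm) auto
  ultimately show ?thesis by blast
qed

lemma g_rec:
  assumes y: "y \<in> {lo..hi}"
  shows "g b y = (A (digit b y) + \<sigma> * y + g (side b) (succ b y)) / of_int P"
proof -
  have "g b y = cost (b, y) / of_int P + (\<Sum>n. cost ((shift ^^ Suc n) (b, y)) / of_int P ^ Suc (Suc n))"
    unfolding g_def using suminf_split_head[OF summable_cost[OF y, of b]] by simp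
  also have "(\<lambda>n. cost ((shift ^^ Suc n) (b, y)) / of_int P ^ Suc (Suc n))
      = (\<lambda>n. (1 / of_int P) * (cost ((shift ^^ n) (side b, succ b y)) / of_int P ^ Suc n))"
    by (simp add: funpow_Suc_right shift_def del: funpow.simps)
  also have "suminf \<dots> = (1 / of_int P) * g (side b) (succ b y)"
    unfolding g_def by (intro suminf_mult summable_cost digit_range y)
  finally show ?thesis by (simp add: cost_def add_divide_distrib)
qed

lemma g_diff_same_digit:
  assumes "y \<in> {lo..hi}" "y' \<in> {lo..hi}" "digit b y = digit c y'"
  shows "\<bar>g b y - g c y'\<bar> \<le> (\<bar>\<sigma>\<bar> * \<bar>y - y'\<bar> + \<bar>g (side b) (succ b y) - g (side c) (succ c y')\<bar>) / 2"
proof -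
  have "g b y - g c y' = (\<sigma> * (y - y') + (g (side b) (succ b y) - g (side c) (succ c y'))) / of_int P"
    using assms(3) by (simp add: g_rec[OF assms(1), of b] g_rec[OF assms(2), of c] algebra_simps flip: diff_divide_distrib)
  also have "\<bar>\<dots>\<bar> \<le> \<bar>\<sigma> * (y - y') + (g (side b) (succ b y) - g (side c) (succ c y'))\<bar> / 2" by (rule half_le)
  also have "\<dots> \<le> (\<bar>\<sigma>\<bar> * \<bar>y - y'\<bar> + \<bar>g (side b) (succ b y) - g (side c) (succ c y')\<bar>) / 2"
    by (intro divide_right_mono order_trans[OF abs_triangle_ineq]) (auto simp: abs_mult)
  finally show ?thesis .
qed

text \<open>As long as the digits agree, passing to the remainder bounds the jump by half of the
  next one; when they first differ, \<open>M\<close> takes over, and if they never do the jump is 0.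
  The invariant set \<open>S\<close> is instantiated by the two end points, by the unambiguous
  heights and by the whole interval.\<close>

lemma jump_le:
  assumes S: "S \<subseteq> {lo..hi}" "\<And>b y. y \<in> S \<Longrightarrow> digit True y = digit False y \<Longrightarrow> succ b y \<in> S"
    and M: "0 \<le> M" "\<And>y. y \<in> S \<Longrightarrow> digit True y \<noteq> digit False y \<Longrightarrow> \<bar>g True y - g False y\<bar> \<le> M"
    and y: "y \<in> S"
  shows "\<bar>g True y - g False y\<bar> \<le> M"
proof -
  obtain B where B: "B \<ge> 0" "\<And>b y. y \<in> {lo..hi} \<Longrightarrow> \<bar>g b y\<bar> \<le> B" using g_bounded by blast
  have "\<bar>g b y - g c y\<bar> \<le> M + (2 * B) * (1/2) ^ n" if "y \<in> S" for b c n y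
    using that
  proof (induction n arbitrary: b c y)
    case 0
    then have yI: "y \<in> {lo..hi}" using S by blast
    show ?case using B(2)[OF yI, of b] B(2)[OF yI, of c] M(1) by simp
  next
    case (Suc n)
    have yI: "y \<in> {lo..hi}" using S Suc.prems by blast
    have nn: "0 \<le> 2 * B * (1/2) ^ Suc n" using B(1) by simp
    show ?case
    proof (cases "digit True y = digit False y")
      case True
      then have eq: "digit b y = digit c y" by (metis (full_types))
      then have s: "succ b y = succ c y" by (simp add: succ_def)
      have "\<bar>g (side b) (succ b y) - g (side c) (succ b y)\<bar> \<le> M + (2 * B) * (1/2) ^ n"
        by (rule Suc.IH[OF S(2)[OF Suc.prems True]])
      then have "\<bar>g b y - g c y\<bar> \<le> (M + (2 * B) * (1/2) ^ n) / 2"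
        using g_diff_same_digit[OF yI yI eq] s by simp
      also have "\<dots> \<le> M + (2 * B) * (1/2) ^ Suc n" using M(1) by simp
      finally show ?thesis .
    next
      case False
      have "\<bar>g b y - g c y\<bar> \<le> \<bar>g True y - g False y\<bar>" by (cases b; cases c) auto
      then show ?thesis using M(2)[OF Suc.prems False] nn by linarith
    qed
  qed
  from this[OF y, of True False] show ?thesis by (rule le_geometric_imp_le) auto
qed

lemma g_ends: 
  assumes "y \<in> {lo, hi}" shows "g b y = g c y"
proof -
  have "\<bar>g True y - g False y\<bar> \<le> 0"
    by (rule jump_le[of "{lo, hi}"]) (use assms digit_ends in auto)
  then show ?thesis by (cases b; cases c) auto
qed

text \<open>\<open>E\<close> contains every height with an ambiguous digit at the first place, and
  contains \<open>y\<close> whenever it contains a remainder of \<open>y\<close>. So remainders of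
  heights outside \<open>E\<close> stay outside, their digits always agree, and no jump
  arises.\<close>

lemma countable_jumps: "countable {y \<in> {lo..hi}. g True y \<noteq> g False y}"
proof -
  define E where "E = range (\<lambda>(n, k::int). (lo + of_int k) / of_int r ^ n)"
  have r0: "real_of_int r \<noteq> 0" using r by auto
  have E1: "y \<in> E" if ne: "digit True y \<noteq> digit False y" and yI: "y \<in> {lo..hi}" for y
  proof -
    obtain b where b: "side b" using side_surj[of True] by blast
    obtain k where "digit b y = k + 1" "succ b y = lo" using digits_differ[OF yI ne b] by blast
    then have "y = (lo + of_int (k + 1)) / of_int r ^ 1" using r0 by (simp add: succ_def field_simps)
    then show ?thesis unfolding E_def by (intro image_eqI[of _ _ "(1, k + 1)"]) auto
  qed
  have E2: "y \<in> E" if sE: "succ b y \<in> E" for b y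
  proof -
    obtain n k where "succ b y = (lo + of_int k) / of_int r ^ n" using sE by (auto simp: E_def)
    then have "y = (lo + of_int (k + digit b y * r ^ n)) / of_int r ^ Suc n"
      using r0 by (simp add: succ_def field_simps)
    then show ?thesis unfolding E_def by (intro image_eqI[of _ _ "(Suc n, k + digit b y * r ^ n)"]) auto
  qed
  have "y \<in> E" if yI: "y \<in> {lo..hi}" and neq: "g True y \<noteq> g False y" for y
  proof (rule ccontr)
    assume "y \<notin> E"
    have "\<bar>g True y - g False y\<bar> \<le> 0"
    proof (rule jump_le[of "{lo..hi} - E"])
      show "succ b y \<in> {lo..hi} - E" if "y \<in> {lo..hi} - E" for b y
        using that E2[of b y] digit_range(3)[of y b] by blast
    qed (use yI \<open>y \<notin> E\<close> E1 in auto)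
    with neq show False by simp
  qed
  then have "{y \<in> {lo..hi}. g True y \<noteq> g False y} \<subseteq> E" by blast
  moreover have "countable E" unfolding E_def by (intro countable_image) auto
  ultimately show ?thesis by (rule countable_subset)
qed

text \<open>The jump at the boundary of the digit cells \<open>k\<close> and \<open>k + 1\<close>,
  signed as upper minus lower digit. The second term is the difference of the path between the ends
  of the interval, divided by \<open>P\<close>.\<close>

definition first_jump :: "int \<Rightarrow> real" where
  "first_jump k = (A (k + 1) - A k) / of_int P
     - (of_int (sgn r) * A (\<bar>r\<bar> - 1) + \<sigma>) / (of_int P * (of_int P - of_int (sgn r)))"

text \<open>For positive \<open>r\<close> each end is fixed by the shift, for negative
  \<open>r\<close> the ends are exchanged. In both cases \<open>g_rec\<close> becomes a linear
  system for the two end values, whence the denominators \<open>P - 1\<close> and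
  \<open>P + 1\<close>.\<close>

lemma g_ends_diff:
  assumes A0: "A 0 = 0"
  shows "g b lo - g c hi = - (of_int (sgn r) * A (\<bar>r\<bar> - 1) + \<sigma>) / (of_int P - of_int (sgn r))"
proof -
  have P0: "real_of_int P \<noteq> 0" "real_of_int P \<noteq> 1" "real_of_int P \<noteq> -1" using P by auto
  have rec: "of_int P * g b y = A (digit b y) + \<sigma> * y + g (side b) (succ b y)" if "y \<in> {lo, hi}" for b y
    using g_rec[of y b] that P0 by (auto simp: field_simps)
  have dig: "digit b y = e" "succ b y = y'"
    if "floor_digit \<bar>r\<bar> (side b) z = e" "of_int r * y - lo = z" "of_int r * y - of_int e = y'" for b y z e y'
    using that by (auto simp: digit_def succ_def)
  note fe = floor_digit_ends[of "\<bar>r\<bar>"]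
  have r1: "1 \<le> \<bar>r\<bar>" using r by simp
  consider "0 < r" "lo = 0" | "r < 0" "of_int r * hi = lo" "of_int r * lo = lo - of_int r"
    using r_cases by blast
  then show ?thesis
  proof cases
    case 1
    have l: "digit b lo = 0" "succ b lo = lo" for b
      using dig[where b = b and y = lo and y' = lo, OF fe(1)[OF r1]] 1 by auto
    have h: "digit c hi = r - 1" "succ c hi = hi" for c
      using dig[where b = c and y = hi and y' = hi, OF fe(2)[OF r1]] 1 by auto
    have "of_int P * g b lo = g b lo" using rec[where y = lo and b = b] g_ends[where y = lo and b = "side b" and c = b] l[of b] 1 A0 by simp
    then have gl: "g b lo = 0" using P0 by simp
    have "of_int P * g c hi = A (r - 1) + \<sigma> + g c hi" using rec[where y = hi and b = c] g_ends[where y = hi and b = "side c" and c = c] h[of c] 1 by simp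
    then have "g c hi = (A (r - 1) + \<sigma>) / (of_int P - 1)" using P0 by (simp add: field_simps)
    then show ?thesis using gl 1 by (simp add: minus_divide_left)
  next
    case 2
    have rr: "\<bar>r\<bar> - 1 = - r - 1" "sgn r = -1" using 2(1) by auto
    have z: "of_int r * lo - lo = of_int \<bar>r\<bar>" "of_int r * lo - of_int (\<bar>r\<bar> - 1) = hi"
      unfolding 2(3) using 2(1) by simp_all
    have l: "digit b lo = - r - 1" "succ b lo = hi" for b
      using dig[where b = b and y = lo and y' = hi, OF fe(2)[OF r1] z] unfolding rr .
    have z': "of_int r * hi - lo = 0" "of_int r * hi - of_int 0 = lo"
      unfolding 2(2) by simp_all
    have h: "digit c hi = 0" "succ c hi = lo" for c
      using dig[where b = c and y = hi and y' = lo, OF fe(1)[OF r1] z'] .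
    have "of_int P * g b lo = A (- r - 1) + \<sigma> * lo + g c hi" using rec[where y = lo and b = b] g_ends[where y = hi and b = "side b" and c = c] l[of b] by simp
    moreover have "of_int P * g c hi = \<sigma> * hi + g b lo" using rec[where y = hi and b = c] g_ends[where y = lo and b = "side c" and c = b] h[of c] A0 by simp
    ultimately have "(g b lo - g c hi) * (of_int P + 1) = A (- r - 1) - \<sigma>" by (simp add: algebra_simps)
    then have "g b lo - g c hi = (A (- r - 1) - \<sigma>) / (of_int P + 1)" using P0 by (simp add: field_simps)
    then show ?thesis unfolding rr by simp
  qed
qed

lemma jump_eq_first_jump:
  assumes y: "y \<in> {lo..hi}" and b: "side b" and A0: "A 0 = 0"
    and d: "digit b y = k + 1" "digit (\<not> b) y = k" "succ b y = lo" "succ (\<not> b) y = hi"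
  shows "g b y - g (\<not> b) y = first_jump k"
proof -
  have "g b y - g (\<not> b) y = (A (k + 1) - A k + (g (side b) lo - g (side (\<not> b)) hi)) / of_int P"
    using g_rec[OF y, of b] g_rec[OF y, of "\<not> b"] d by (simp flip: diff_divide_distrib)
  also have "\<dots> = first_jump k"
    unfolding g_ends_diff[OF A0] first_jump_def by (simp add: diff_divide_distrib add_divide_distrib mult.commute)
  finally show ?thesis .
qed

lemma jump_first_jump:
  assumes y: "y \<in> {lo..hi}" and ne: "digit True y \<noteq> digit False y" and A0: "A 0 = 0"
  shows "\<exists>k. 0 \<le> k \<and> k + 1 < \<bar>r\<bar> \<and> \<bar>g True y - g False y\<bar> = \<bar>first_jump k\<bar>"
proof -
  obtain b where b: "side b" using side_surj[of True] by blast
  obtain k where k: "0 \<le> k" "k + 1 < \<bar>r\<bar>" "digit b y = k + 1" "digit (\<not> b) y = k" "succ b y = lo" "succ (\<not> b) y = hi"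
    using digits_differ[OF y ne b] by blast
  have "\<bar>g True y - g False y\<bar> = \<bar>g b y - g (\<not> b) y\<bar>" by (cases b) auto
  then show ?thesis using jump_eq_first_jump[OF y b A0 k(3-6)] k(1,2) by auto
qed

lemma first_jump_occurs:
  assumes k: "0 \<le> k" "k + 1 < \<bar>r\<bar>" and A0: "A 0 = 0"
  defines "y \<equiv> (lo + of_int k + 1) / of_int r"
  shows "lo < y" "y < hi" "\<bar>g True y - g False y\<bar> = \<bar>first_jump k\<bar>"
proof -
  have "real_of_int r \<noteq> 0" using r by auto
  then have ry: "of_int r * y = lo + of_int (k + 1)" by (simp add: y_def)
  have yI: "y \<in> {lo..hi}" by (rule in_range_iff[OF _ k(2) _ ry]) (use k in auto)
  obtain b where b: "side b" using side_surj[of True] by blast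
  then have nb: "\<not> side (\<not> b)" by (auto simp: side_def)
  have d: "digit b y = k + 1" using digit_eqI(1)[OF _ k(2) ry] k b by auto
  have d': "digit (\<not> b) y = k" using digit_eqI(2)[OF k(1), of y hi "\<not> b"] ry k(2) nb by auto
  have "y \<noteq> lo" "y \<noteq> hi" using d d' digit_ends(1)[of y b "\<not> b"] by auto
  then show "lo < y" "y < hi" using yI by auto
  have "g b y - g (\<not> b) y = first_jump k"
    by (rule jump_eq_first_jump[OF yI b A0 d d']) (use ry d d' in \<open>auto simp: succ_def\<close>)
  moreover have "\<bar>g True y - g False y\<bar> = \<bar>g b y - g (\<not> b) y\<bar>" by (cases b) auto
  ultimately show "\<bar>g True y - g False y\<bar> = \<bar>first_jump k\<bar>" by simp
qed

text \<open>Induction on the number of controlled digits: near \<open>y\<close> on one side the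
  first digits agree, and the remainders are again close on the side that \<open>side\<close>
  prescribes. The ratio 3/4 instead of 1/2 leaves room for the shear: half of
  \<open>1/2 + 1\<close>.\<close>

lemma g_near:
  "\<exists>C. \<forall>n b. \<forall>y\<in>{lo..hi}. \<exists>\<delta>>0. \<forall>y'\<in>{lo..hi}. \<bar>y' - y\<bar> < \<delta> \<and> (if b then y < y' else y' < y) \<longrightarrow>
     (\<forall>c. \<bar>g c y' - g b y\<bar> \<le> C * (3/4) ^ n)"
proof -
  obtain B where B: "B \<ge> 0" "\<And>b y. y \<in> {lo..hi} \<Longrightarrow> \<bar>g b y\<bar> \<le> B" using g_bounded by blast
  define C where "C = 2 * B + 1"
  have C: "C > 0" using B(1) by (simp add: C_def)
  have "\<exists>\<delta>>0. \<forall>y'\<in>{lo..hi}. \<bar>y' - y\<bar> < \<delta> \<and> (if b then y < y' else y' < y) \<longrightarrow>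
     (\<forall>c. \<bar>g c y' - g b y\<bar> \<le> C * (3/4) ^ n)" if "y \<in> {lo..hi}" for n b y
    using that
  proof (induction n arbitrary: b y)
    case 0
    have "\<bar>g c y' - g b y\<bar> \<le> C" if "y' \<in> {lo..hi}" for c y'
      using B(2)[OF that, of c] B(2)[OF 0, of b] by (simp add: C_def)
    then show ?case by (intro exI[of _ 1]) auto
  next
    case (Suc n)
    obtain \<delta>1 where \<delta>1: "\<delta>1 > 0" "\<And>y' c. y' \<in> {lo..hi} \<Longrightarrow> \<bar>y' - y\<bar> < \<delta>1 \<Longrightarrow> (if b then y < y' else y' < y) \<Longrightarrow> digit c y' = digit b y"
      using digit_locally_constant[OF Suc.prems, of b] by blast
    obtain \<delta>2 where \<delta>2: "\<delta>2 > 0" "\<And>y' c. y' \<in> {lo..hi} \<Longrightarrow> \<bar>y' - succ b y\<bar> < \<delta>2 \<Longrightarrow> 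
        (if side b then succ b y < y' else y' < succ b y) \<Longrightarrow> \<bar>g c y' - g (side b) (succ b y)\<bar> \<le> C * (3/4) ^ n"
      using Suc.IH[OF digit_range(3)[OF Suc.prems], of b "side b"] by blast
    \<comment> \<open>Chosen so that the shear contributes at most half of the bound at stage
      \<open>n\<close>.\<close>
    define \<delta>3 where "\<delta>3 = C * (3/4) ^ n / (2 * (\<bar>\<sigma>\<bar> + 1))"
    have \<delta>3: "\<delta>3 > 0" using C by (simp add: \<delta>3_def)
    define \<delta> where "\<delta> = min \<delta>1 (min (\<delta>2 / of_int \<bar>r\<bar>) \<delta>3)"
    have "\<delta> > 0" using \<delta>1 \<delta>2 \<delta>3 r by (simp add: \<delta>_def)
    moreover have "\<bar>g c y' - g b y\<bar> \<le> C * (3/4) ^ Suc n"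
      if y': "y' \<in> {lo..hi}" "\<bar>y' - y\<bar> < \<delta>" "if b then y < y' else y' < y" for c y'
    proof -
      have dc: "digit c y' = digit b y" using \<delta>1(2)[OF y'(1) _ y'(3)] y'(2) by (simp add: \<delta>_def)
      have diff: "succ c y' - succ b y = of_int r * (y' - y)" using dc by (simp add: succ_def algebra_simps)
      have "\<bar>of_int r * (y' - y)\<bar> = of_int \<bar>r\<bar> * \<bar>y' - y\<bar>" by (simp add: abs_mult)
      also have "\<dots> < of_int \<bar>r\<bar> * (\<delta>2 / of_int \<bar>r\<bar>)" using y'(2) r by (intro mult_strict_left_mono) (auto simp: \<delta>_def)
      also have "\<dots> = \<delta>2" using r by simp
      finally have "\<bar>succ c y' - succ b y\<bar> < \<delta>2" by (simp add: diff)
      moreover have "if side b then succ b y < succ c y' else succ c y' < succ b y"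
      proof -
        have "0 < r \<longleftrightarrow> 0 < real_of_int r" "r < 0 \<longleftrightarrow> real_of_int r < 0" "r \<noteq> 0" using r by auto
        then have "if side b then 0 < of_int r * (y' - y) else of_int r * (y' - y) < 0"
          using y'(3) by (cases b) (auto simp: side_def zero_less_mult_iff mult_less_0_iff)
        then show ?thesis unfolding diff[symmetric] by (auto split: if_splits)
      qed
      ultimately have IH: "\<bar>g (side c) (succ c y') - g (side b) (succ b y)\<bar> \<le> C * (3/4) ^ n"
        by (intro \<delta>2(2) digit_range(3) y'(1))
      have "\<bar>\<sigma>\<bar> * \<bar>y' - y\<bar> \<le> (\<bar>\<sigma>\<bar> + 1) * \<delta>3"
        using y'(2) by (intro mult_mono) (auto simp: \<delta>_def)
      also have "\<dots> = C * (3/4) ^ n / 2"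
      proof -
        have "x * (D / (2 * x)) = D / 2" if "x > 0" for x D :: real using that by simp
        from this[of "\<bar>\<sigma>\<bar> + 1"] show ?thesis unfolding \<delta>3_def by simp
      qed
      finally have "\<bar>\<sigma>\<bar> * \<bar>y' - y\<bar> \<le> C * (3/4) ^ n / 2" .
      then have "\<bar>g c y' - g b y\<bar> \<le> (C * (3/4) ^ n / 2 + C * (3/4) ^ n) / 2"
        using g_diff_same_digit[OF y'(1) Suc.prems dc] IH by simp
      then show ?thesis by simp
    qed
    ultimately show ?case by blast
  qed
  then show ?thesis by blast
qed

lemma g_one_sided_limit:
  assumes y: "y \<in> {lo..hi}" and e: "e > 0"
  shows "\<exists>\<delta>>0. \<forall>y'\<in>{lo..hi}. \<bar>y' - y\<bar> < \<delta> \<and> (if b then y < y' else y' < y) \<longrightarrow> (\<forall>c. \<bar>g c y' - g b y\<bar> < e)"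
proof -
  obtain C where C: "\<And>n b y. y \<in> {lo..hi} \<Longrightarrow> \<exists>\<delta>>0. \<forall>y'\<in>{lo..hi}. \<bar>y' - y\<bar> < \<delta> \<and> (if b then y < y' else y' < y) \<longrightarrow>
     (\<forall>c. \<bar>g c y' - g b y\<bar> \<le> C * (3/4) ^ n)" using g_near by blast
  have "(\<lambda>n. C * (3/4::real) ^ n) \<longlonglongrightarrow> C * 0" by (intro tendsto_intros LIMSEQ_power_zero) simp
  then have "\<forall>\<^sub>F n in sequentially. C * (3/4) ^ n < e" using e by (intro order_tendstoD(2)) auto
  then obtain n where n: "C * (3/4) ^ n < e" by (auto simp: eventually_sequentially)
  obtain \<delta> where "\<delta> > 0" "\<And>y' c. y' \<in> {lo..hi} \<Longrightarrow> \<bar>y' - y\<bar> < \<delta> \<Longrightarrow> (if b then y < y' else y' < y) \<Longrightarrow>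
     \<bar>g c y' - g b y\<bar> \<le> C * (3/4) ^ n" using C[OF y, of b n] by blast
  with n show ?thesis by (meson order_le_less_trans)
qed

text \<open>Clipping extends the path by constants. No jump is created at the ends because
  \<open>g_ends\<close> makes both conventions agree there.\<close>

lemma right_limit_g: "right_limit (\<lambda>y. g c (clip lo hi y)) (\<lambda>y. g True (clip lo hi y))"
  unfolding right_limit_def
proof (intro allI tendstoI)
  fix y e :: real assume e: "e > 0"
  consider "y < lo" | "y \<in> {lo..<hi}" | "hi \<le> y" by fastforce
  then show "\<forall>\<^sub>F y' in at_right y. dist (g c (clip lo hi y')) (g True (clip lo hi y)) < e"
  proof cases
    case 1
    have "dist (g c (clip lo hi y')) (g True (clip lo hi y)) < e" if "y' < lo" for y'
      using that 1 g_ends[of lo c True] e by simp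
    with 1 show ?thesis unfolding eventually_at_right_field by blast
  next
    case 2
    then have y: "y \<in> {lo..hi}" by auto
    obtain \<delta> where \<delta>: "\<delta> > 0" "\<And>y' c. y' \<in> {lo..hi} \<Longrightarrow> \<bar>y' - y\<bar> < \<delta> \<Longrightarrow> y < y' \<Longrightarrow> \<bar>g c y' - g True y\<bar> < e"
      using g_one_sided_limit[OF y e, of True] by auto
    have "dist (g c (clip lo hi y')) (g True (clip lo hi y)) < e" if "y < y'" "y' < min hi (y + \<delta>)" for y'
    proof -
      have "clip lo hi y' = y'" "clip lo hi y = y" using that 2 by auto
      then show ?thesis using \<delta>(2)[of y' c] that 2 by (simp add: dist_real_def)
    qed
    moreover have "y < min hi (y + \<delta>)" using 2 \<delta>(1) by simp
    ultimately show ?thesis unfolding eventually_at_right_field by blast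
  next
    case 3
    have "dist (g c (clip lo hi y')) (g True (clip lo hi y)) < e" if "y < y'" for y'
      using that 3 g_ends[of hi c True] e by simp
    then show ?thesis unfolding eventually_at_right_field by (intro exI[of _ "y + 1"]) auto
  qed
qed

lemma left_limit_g: "left_limit (\<lambda>y. g c (clip lo hi y)) (\<lambda>y. g False (clip lo hi y))"
  unfolding left_limit_def
proof (intro allI tendstoI)
  fix y e :: real assume e: "e > 0"
  consider "hi < y" | "y \<in> {lo<..hi}" | "y \<le> lo" by fastforce
  then show "\<forall>\<^sub>F y' in at_left y. dist (g c (clip lo hi y')) (g False (clip lo hi y)) < e"
  proof cases
    case 1
    have "dist (g c (clip lo hi y')) (g False (clip lo hi y)) < e" if "hi < y'" for y'
      using that 1 g_ends[of hi c False] e by simp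
    with 1 show ?thesis unfolding eventually_at_left_field by blast
  next
    case 2
    then have y: "y \<in> {lo..hi}" by auto
    obtain \<delta> where \<delta>: "\<delta> > 0" "\<And>y' c. y' \<in> {lo..hi} \<Longrightarrow> \<bar>y' - y\<bar> < \<delta> \<Longrightarrow> y' < y \<Longrightarrow> \<bar>g c y' - g False y\<bar> < e"
      using g_one_sided_limit[OF y e, of False] by auto
    have "dist (g c (clip lo hi y')) (g False (clip lo hi y)) < e" if "max lo (y - \<delta>) < y'" "y' < y" for y'
    proof -
      have "clip lo hi y' = y'" "clip lo hi y = y" using that 2 by auto
      then show ?thesis using \<delta>(2)[of y' c] that 2 by (simp add: dist_real_def)
    qed
    moreover have "max lo (y - \<delta>) < y" using 2 \<delta>(1) by simp
    ultimately show ?thesis unfolding eventually_at_left_field by blast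
  next
    case 3
    have "dist (g c (clip lo hi y')) (g False (clip lo hi y)) < e" if "y' < y" for y'
      using that 3 g_ends[of lo c False] e by simp
    then show ?thesis unfolding eventually_at_left_field by (intro exI[of _ "y - 1"]) auto
  qed
qed

end

section \<open>The tile\<close>

lemma sum_option: "(\<Sum>i\<in>UNIV. f i) = f None + (\<Sum>j\<in>UNIV. f (Some j))" for f :: "'n::finite option \<Rightarrow> real"
proof -
  have "(\<Sum>i\<in>UNIV. f i) = f None + sum f (range Some)"
    unfolding UNIV_option_conv by (subst sum.insert) auto
  also have "sum f (range Some) = (\<Sum>j\<in>UNIV. f (Some j))"
    by (subst sum.reindex) auto
  finally show ?thesis .
qed

section \<open>The matrix in coordinates and uniqueness of the self-affine set\<close>

lemma tile_matrix_mult: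
  "(tile_matrix p s *v v) $ None = of_int (p None) * v $ None"
  "(tile_matrix p s *v v) $ Some j = of_int (p (Some j)) * v $ Some j - s $ j * v $ None"
proof -
  show "(tile_matrix p s *v v) $ None = of_int (p None) * v $ None"
    by (simp add: matrix_vector_mult_def tile_matrix_def sum_option)
  have "(\<Sum>j'\<in>UNIV. (if j = j' then real_of_int (p (Some j)) else 0) * v $ Some j') = of_int (p (Some j)) * v $ Some j"
    by (subst sum.cong[of UNIV UNIV _ "\<lambda>j'. if j = j' then real_of_int (p (Some j)) * v $ Some j' else 0"]) auto
  then show "(tile_matrix p s *v v) $ Some j = of_int (p (Some j)) * v $ Some j - s $ j * v $ None"
    by (simp add: matrix_vector_mult_def tile_matrix_def sum_option)
qed

lemma append_coord_nth: "append_coord x y $ None = y" "append_coord x y $ Some j = x $ j"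
  by (simp_all add: append_coord_def)

lemma vec_option_eq_iff: "v = w \<longleftrightarrow> v $ None = w $ None \<and> (\<forall>j. v $ Some j = w $ Some j)"
  unfolding vec_eq_iff by (metis option.exhaust)

text \<open>The shear may be large compared with the diagonal, so the inverse matrix need not
  contract the sup norm. Weighting the last coordinate by a bound for the shear repairs
  this.\<close>

definition weighted_norm :: "real \<Rightarrow> real ^ ('n::finite) option \<Rightarrow> real" where
  "weighted_norm M v = infnorm (append_coord (\<chi> j. v $ Some j) (M * v $ None))"

lemma weighted_norm_le_iff:
  "weighted_norm M v \<le> c \<longleftrightarrow> \<bar>M * v $ None\<bar> \<le> c \<and> (\<forall>j. \<bar>v $ Some j\<bar> \<le> c)"
  unfolding weighted_norm_def infnorm_le_iff_cart
  by (metis append_coord_nth option.exhaust vec_lambda_beta)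

text \<open>One application of the set equation to \<open>T\<close> and back through
  \<open>U\<close> brings a point of \<open>T\<close> closer to \<open>U\<close> by the factor 3/4:
  a diagonal entry gains 1/2, and the weighted shear adds at most half as much again. Iteration puts
  the point in the closure of \<open>U\<close>.\<close>

lemma self_affine_unique:
  fixes p :: "'n::finite option \<Rightarrow> int" and s :: "real ^ 'n"
  assumes p: "\<And>i. 2 \<le> \<bar>p i\<bar>"
    and T: "T \<noteq> {}" "compact T" "(\<lambda>x. tile_matrix p s *v x) ` T = {t + d | t d. t \<in> T \<and> d \<in> D}"
    and U: "U \<noteq> {}" "compact U" "(\<lambda>x. tile_matrix p s *v x) ` U = {t + d | t d. t \<in> U \<and> d \<in> D}"
  shows "T \<subseteq> U"
proof
  define M where "M = norm s + 1"
  have M: "M \<ge> 1" "\<bar>s $ j\<bar> \<le> M" for j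
    using component_le_norm_cart[of s j] by (simp_all add: M_def)
  define N :: "real ^ 'n option \<Rightarrow> real" where "N = weighted_norm M"
  have expand: "N v \<le> 3/4 * N (tile_matrix p s *v v)" for v :: "real ^ 'n option"
  proof -
    let ?w = "tile_matrix p s *v v"
    have w: "\<bar>M * ?w $ None\<bar> \<le> N ?w" "\<And>j. \<bar>?w $ Some j\<bar> \<le> N ?w"
      using weighted_norm_le_iff[of M ?w "N ?w"] by (auto simp: N_def)
    have p2: "2 * \<bar>x\<bar> \<le> \<bar>of_int (p i) * x\<bar>" for i and x :: real
    proof -
      have "real_of_int 2 \<le> of_int \<bar>p i\<bar>" using p[of i] by (simp only: of_int_le_iff)
      then show ?thesis by (simp add: abs_mult mult_right_mono)
    qed
    have None: "2 * \<bar>M * v $ None\<bar> \<le> N ?w"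
      using p2[of "M * v $ None" None] w(1) by (simp add: tile_matrix_mult mult.left_commute)
    have "\<bar>v $ Some j\<bar> \<le> 3/4 * N ?w" for j
    proof -
      have "\<bar>s $ j * v $ None\<bar> \<le> \<bar>M * v $ None\<bar>"
        using M(1) M(2)[of j] by (simp add: abs_mult mult_right_mono)
      moreover have "of_int (p (Some j)) * v $ Some j = ?w $ Some j + s $ j * v $ None"
        by (simp add: tile_matrix_mult)
      ultimately have "2 * \<bar>v $ Some j\<bar> \<le> N ?w + N ?w / 2"
        using p2[of "v $ Some j" "Some j"] w(2)[of j] None by linarith
      then show ?thesis by simp
    qed
    then show ?thesis using None unfolding N_def weighted_norm_le_iff by (auto simp: N_def)
  qed
  obtain B1 B2 where B: "\<And>x. x \<in> T \<Longrightarrow> norm x \<le> B1" "\<And>x. x \<in> U \<Longrightarrow> norm x \<le> B2"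
    using compact_imp_bounded[OF T(2)] compact_imp_bounded[OF U(2)] unfolding bounded_iff by blast
  have near: "\<exists>y\<in>U. N (x - y) \<le> M * (B1 + B2) * (3/4) ^ n" if "x \<in> T" for x n
    using that
  proof (induction n arbitrary: x)
    case 0
    obtain y where y: "y \<in> U" using U(1) by blast
    have b: "norm (x - y) \<le> B1 + B2" using B(1)[OF 0] B(2)[OF y] norm_triangle_ineq4[of x y] by linarith
    have "\<bar>M * (x - y) $ None\<bar> \<le> M * (B1 + B2)"
      using component_le_norm_cart[of "x - y" None] b M(1) by (auto simp: abs_mult intro!: mult_left_mono)
    moreover have "\<bar>(x - y) $ Some j\<bar> \<le> M * (B1 + B2)" for j
    proof -
      have "\<bar>(x - y) $ Some j\<bar> \<le> 1 * (B1 + B2)" using component_le_norm_cart[of "x - y" "Some j"] b by simp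
      also have "\<dots> \<le> M * (B1 + B2)" using M(1) order_trans[OF norm_ge_zero b] by (intro mult_right_mono) auto
      finally show ?thesis .
    qed
    ultimately have "N (x - y) \<le> M * (B1 + B2)" unfolding N_def weighted_norm_le_iff by blast
    then show ?case using y by auto
  next
    case (Suc n)
    obtain x' e where x': "x' \<in> T" "e \<in> D" "tile_matrix p s *v x = x' + e"
      using T(3) Suc.prems by (smt (verit, ccfv_SIG) imageI mem_Collect_eq)
    obtain y' where y': "y' \<in> U" "N (x' - y') \<le> M * (B1 + B2) * (3/4) ^ n" using Suc.IH[OF x'(1)] by blast
    have "y' + e \<in> (\<lambda>x. tile_matrix p s *v x) ` U" using U(3) y'(1) x'(2) by blast
    then obtain y where y: "y \<in> U" "tile_matrix p s *v y = y' + e" by (metis imageE)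
    have "tile_matrix p s *v (x - y) = x' - y'" by (simp add: matrix_vector_mult_diff_distrib x'(3) y(2))
    then have "N (x - y) \<le> M * (B1 + B2) * (3/4) ^ Suc n" using expand[of "x - y"] y'(2) by simp
    then show ?case using y(1) by blast
  qed
  fix x assume x: "x \<in> T"
  define Q where "Q = sqrt DIM(real ^ 'n option)"
  have "x \<in> closure U"
    unfolding closure_approachable
  proof (intro allI impI)
    fix \<epsilon> :: real assume \<epsilon>: "\<epsilon> > 0"
    have "(\<lambda>n. Q * (M * (B1 + B2) * (3/4::real) ^ n)) \<longlonglongrightarrow> Q * (M * (B1 + B2) * 0)"
      by (intro tendsto_intros LIMSEQ_power_zero) simp
    then have "\<forall>\<^sub>F n in sequentially. Q * (M * (B1 + B2) * (3/4::real) ^ n) < \<epsilon>"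
      using \<epsilon> by (intro order_tendstoD(2)) auto
    then obtain n where n: "Q * (M * (B1 + B2) * (3/4::real) ^ n) < \<epsilon>" by (auto simp: eventually_sequentially)
    obtain y where y: "y \<in> U" "N (x - y) \<le> M * (B1 + B2) * (3/4) ^ n" using near[OF x] by blast
    have "infnorm (x - y) \<le> N (x - y)"
      unfolding infnorm_le_iff_cart
    proof
      fix i
      have N: "\<bar>M * (x - y) $ None\<bar> \<le> N (x - y)" "\<And>j. \<bar>(x - y) $ Some j\<bar> \<le> N (x - y)"
        using weighted_norm_le_iff[of M "x - y" "N (x - y)"] by (auto simp: N_def)
      have "1 * \<bar>(x - y) $ None\<bar> \<le> \<bar>M * (x - y) $ None\<bar>"
        unfolding abs_mult using M(1) by (intro mult_right_mono) auto
      with N show "\<bar>(x - y) $ i\<bar> \<le> N (x - y)" by (cases i) auto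
    qed
    then have "Q * infnorm (x - y) \<le> Q * (M * (B1 + B2) * (3/4) ^ n)"
      using y(2) by (intro mult_left_mono) (auto simp: Q_def)
    then have "norm (x - y) < \<epsilon>"
      using norm_le_infnorm[of "x - y", folded Q_def] n by linarith
    then have "dist y x < \<epsilon>" by (simp add: dist_norm norm_minus_commute)
    with y(1) show "\<exists>y\<in>U. dist y x < \<epsilon>" by blast
  qed
  then show "x \<in> U" using compact_imp_closed[OF U(2)] by simp
qed

section \<open>The tile as an explicit family of boxes\<close>

locale tile =
  fixes p :: "'n::finite option \<Rightarrow> int" and s :: "real ^ 'n" and a :: "nat \<Rightarrow> real ^ 'n"
  assumes p: "\<And>i. 2 \<le> \<bar>p i\<bar>" and a0: "a 0 = 0"

sublocale tile \<subseteq> radix "p None"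
  using p by unfold_locales

context tile
begin

abbreviation coord :: "'n \<Rightarrow> int \<Rightarrow> real" where
  "coord j \<equiv> \<lambda>e. a (nat e) $ j"

lemma paths: "digit_path (p None) (p (Some j))"
  using p by unfold_locales

definition path :: "'n \<Rightarrow> bool \<Rightarrow> real \<Rightarrow> real" where
  "path j = digit_path.g (p None) (p (Some j)) (coord j) (s $ j)"

definition left_end :: "'n \<Rightarrow> bool \<Rightarrow> real \<Rightarrow> real" where
  "left_end j b y = path j b y + least_value (p (Some j))"

text \<open>One \<open>b\<close> serves all coordinates: over a height with two expansions the fibre
  is the union of two boxes, not a mixture of their sides.\<close>

definition tile_set :: "(real ^ 'n option) set" where
  "tile_set = {v. v $ None \<in> {lo..hi} \<and>
     (\<exists>b. \<forall>j. v $ Some j \<in> {left_end j b (v $ None) .. left_end j b (v $ None) + 1})}"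

lemma path_rec:
  assumes "y \<in> {lo..hi}"
  shows "of_int (p (Some j)) * path j b y = a (nat (digit b y)) $ j + s $ j * y + path j (side b) (succ b y)"
proof -
  have "real_of_int (p (Some j)) \<noteq> 0" using p[of "Some j"] by auto
  then show ?thesis
    using digit_path.g_rec[OF paths assms, of j "coord j" "s $ j" b] by (simp add: path_def)
qed

lemma path_ends: "y \<in> {lo, hi} \<Longrightarrow> path j b y = path j c y"
  unfolding path_def by (rule digit_path.g_ends[OF paths])

lemma radix_Some: "radix (p (Some j))"
  using p by unfold_locales

lemma tile_set_subset:
  assumes v: "v \<in> tile_set"
  shows "\<exists>t d. t \<in> tile_set \<and> d \<in> tile_digits p a \<and> tile_matrix p s *v v = t + d"
proof -
  define y where "y = v $ None"
  obtain b where y: "y \<in> {lo..hi}" and b: "\<And>j. v $ Some j \<in> {left_end j b y .. left_end j b y + 1}"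
    using v by (auto simp: tile_set_def y_def)
  define e where "e = digit b y"
  \<comment> \<open>Without the path, the coordinates are independent numbers in the unit intervals
    of the bases \<open>p (Some j)\<close>, and their first digits supply \<iota>.\<close>
  define \<tau> where "\<tau> = (\<lambda>j. v $ Some j - path j b y)"
  have \<tau>: "\<tau> j \<in> {least_value (p (Some j)) .. least_value (p (Some j)) + 1}" for j
    using b[of j] by (auto simp: \<tau>_def left_end_def)
  define \<iota> :: "real ^ 'n" where "\<iota> = (\<chi> j. of_int (radix.digit (p (Some j)) True (\<tau> j)))"
  define t where "t = append_coord (\<chi> j. of_int (p (Some j)) * \<tau> j - \<iota> $ j + path j (side b) (succ b y)) (succ b y)"
  have \<iota>: "\<iota> \<in> box_digits p"
    using radix.digit_range(1,2)[OF radix_Some \<tau>, of _ True]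
    by (auto simp: box_digits_def \<iota>_def simp flip: of_int_abs)
  have "t \<in> tile_set"
  proof -
    have "of_int (p (Some j)) * \<tau> j - \<iota> $ j \<in> {least_value (p (Some j)) .. least_value (p (Some j)) + 1}" for j
      using radix.digit_range(3)[OF radix_Some \<tau>, of j True] by (simp add: \<iota>_def radix.succ_def[OF radix_Some])
    then show ?thesis
      using digit_range(3)[OF y, of b]
      by (auto simp: tile_set_def t_def append_coord_nth left_end_def intro!: exI[of _ "side b"])
  qed
  moreover have "append_coord (\<iota> + a (nat e)) (real (nat e)) \<in> tile_digits p a"
    using digit_range(1,2)[OF y, of b] \<iota> unfolding tile_digits_def e_def
    by (intro CollectI exI[of _ \<iota>] exI[of _ "nat (digit b y)"]) simp
  moreover have "tile_matrix p s *v v = t + append_coord (\<iota> + a (nat e)) (real (nat e))"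
  proof -
    have "of_int (p (Some j)) * v $ Some j = of_int (p (Some j)) * \<tau> j + (a (nat e) $ j + s $ j * y + path j (side b) (succ b y))" for j
      using path_rec[OF y, of j b] by (simp add: \<tau>_def e_def algebra_simps)
    then show ?thesis
      using digit_range(1)[OF y, of b]
      by (simp add: vec_option_eq_iff tile_matrix_mult t_def append_coord_nth y_def[symmetric] succ_def e_def)
  qed
  ultimately show ?thesis by blast
qed

lemma tile_set_supset:
  assumes t: "t \<in> tile_set" and d: "d \<in> tile_digits p a"
  shows "\<exists>v\<in>tile_set. tile_matrix p s *v v = t + d"
proof -
  define y' where "y' = t $ None"
  obtain c where y': "y' \<in> {lo..hi}" and c: "\<And>j. t $ Some j \<in> {left_end j c y' .. left_end j c y' + 1}"
    using t by (auto simp: tile_set_def y'_def)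
  obtain \<iota> k where k: "k < nat \<bar>p None\<bar>" and \<iota>: "\<iota> \<in> box_digits p" and dk: "d = append_coord (\<iota> + a k) (real k)"
    using d by (auto simp: tile_digits_def)
  define e where "e = int k"
  have e: "0 \<le> e" "e < \<bar>p None\<bar>" using k by (auto simp: e_def)
  have r0: "real_of_int (p None) \<noteq> 0" using p[of None] by auto
  define y where "y = (y' + of_int e) / of_int (p None)"
  have ry: "of_int (p None) * y = y' + of_int e" using r0 by (simp add: y_def)
  have y: "y \<in> {lo..hi}" by (rule in_range_iff[OF e y' ry])
  \<comment> \<open>The convention \<open>b\<close> has to produce the given digit and to pass into
    the convention \<open>c\<close> used for \<open>t\<close>. If \<open>y'\<close> is an end, the
    digit may force another choice, but there the path does not depend on the convention.\<close>
  have "\<exists>b. digit b y = e \<and> (side b = c \<or> y' \<in> {lo, hi})"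
  proof (cases "y' \<in> {lo, hi}")
    case True
    obtain b where "side b = (y' = lo)" using side_surj by blast
    then have "digit b y = e"
      using digit_eqI[OF e ry, of b] True by (cases "y' = lo") auto
    with True show ?thesis by blast
  next
    case False
    obtain b where b: "side b = c" using side_surj by blast
    then have "digit b y = e" using digit_eqI[OF e ry, of b] False y' by (cases "side b") auto
    with b show ?thesis by blast
  qed
  then obtain b where b: "digit b y = e" "side b = c \<or> y' \<in> {lo, hi}" by blast
  have sy: "succ b y = y'" using ry b(1) by (simp add: succ_def)
  have pc: "path j (side b) y' = path j c y'" for j using b(2) path_ends[of y' j "side b" c] by blast
  define \<tau> where "\<tau> = (\<lambda>j. t $ Some j - path j c y')"
  have \<tau>: "\<tau> j \<in> {least_value (p (Some j)) .. least_value (p (Some j)) + 1}" for j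
    using c[of j] by (auto simp: \<tau>_def left_end_def)
  have pj: "real_of_int (p (Some j)) \<noteq> 0" for j using p[of "Some j"] by auto
  have in_box: "(\<tau> j + \<iota> $ j) / of_int (p (Some j)) \<in> {least_value (p (Some j)) .. least_value (p (Some j)) + 1}" for j
  proof -
    have "\<iota> $ j \<in> \<int>" "0 \<le> \<iota> $ j" "\<iota> $ j < of_int \<bar>p (Some j)\<bar>" using \<iota> by (auto simp: box_digits_def)
    then obtain i where i: "\<iota> $ j = of_int i" "0 \<le> i" "i < \<bar>p (Some j)\<bar>" by (metis Ints_cases of_int_0_le_iff of_int_less_iff)
    show ?thesis
      by (rule radix.in_range_iff[OF radix_Some i(2,3) \<tau>]) (use pj[of j] in \<open>simp add: i(1)\<close>)
  qed
  define v where "v = append_coord (\<chi> j. path j b y + (\<tau> j + \<iota> $ j) / of_int (p (Some j))) y"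
  have "v \<in> tile_set"
    using y in_box by (auto simp: tile_set_def v_def append_coord_nth left_end_def intro!: exI[of _ b])
  moreover have "tile_matrix p s *v v = t + d"
  proof -
    have "of_int (p (Some j)) * v $ Some j = a k $ j + s $ j * y + path j c y' + (\<tau> j + \<iota> $ j)" for j
    proof -
      define z where "z = (\<tau> j + \<iota> $ j) / of_int (p (Some j))"
      have "of_int (p (Some j)) * z = \<tau> j + \<iota> $ j" using pj[of j] by (simp add: z_def)
      moreover have "v $ Some j = path j b y + z" by (simp add: v_def append_coord_nth z_def)
      moreover have "of_int (p (Some j)) * path j b y = a k $ j + s $ j * y + path j c y'"
        using path_rec[OF y, of j b] by (simp add: b(1) sy pc e_def)
      ultimately show ?thesis by (simp add: distrib_left)
    qed
    then have "of_int (p (Some j)) * v $ Some j - s $ j * v $ None = t $ Some j + (\<iota> $ j + a k $ j)" for j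
      by (simp add: v_def append_coord_nth(1) \<tau>_def)
    moreover have "of_int (p None) * v $ None = t $ None + real k"
      using ry by (simp add: v_def append_coord_nth(1) y'_def e_def)
    ultimately show ?thesis
      by (simp add: vec_option_eq_iff tile_matrix_mult dk append_coord_nth)
  qed
  ultimately show ?thesis by blast
qed

lemma tile_set_eq: "(\<lambda>x. tile_matrix p s *v x) ` tile_set = {t + d | t d. t \<in> tile_set \<and> d \<in> tile_digits p a}"
proof (intro equalityI subsetI)
  fix w assume "w \<in> (\<lambda>x. tile_matrix p s *v x) ` tile_set"
  then show "w \<in> {t + d | t d. t \<in> tile_set \<and> d \<in> tile_digits p a}" using tile_set_subset by blast
next
  fix w assume "w \<in> {t + d | t d. t \<in> tile_set \<and> d \<in> tile_digits p a}"
  then obtain t d where "t \<in> tile_set" "d \<in> tile_digits p a" "w = t + d" by blast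
  then show "w \<in> (\<lambda>x. tile_matrix p s *v x) ` tile_set" using tile_set_supset[of t d] by (metis imageI)
qed

lemma path_limit:
  assumes "y \<in> {lo..hi}" "e > 0"
  shows "\<exists>\<delta>>0. \<forall>j. \<forall>y'\<in>{lo..hi}. \<bar>y' - y\<bar> < \<delta> \<and> (if b then y < y' else y' < y) \<longrightarrow>
    (\<forall>c. \<bar>left_end j c y' - left_end j b y\<bar> < e)"
proof -
  have "\<forall>j. \<exists>\<delta>>0. \<forall>y'\<in>{lo..hi}. \<bar>y' - y\<bar> < \<delta> \<and> (if b then y < y' else y' < y) \<longrightarrow>
    (\<forall>c. \<bar>left_end j c y' - left_end j b y\<bar> < e)"
    using digit_path.g_one_sided_limit[OF paths assms, where b = b] by (simp add: left_end_def path_def)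
  then obtain \<delta> where \<delta>: "\<And>j. \<delta> j > 0" "\<And>j y' c. y' \<in> {lo..hi} \<Longrightarrow> \<bar>y' - y\<bar> < \<delta> j \<Longrightarrow> (if b then y < y' else y' < y) \<Longrightarrow>
    \<bar>left_end j c y' - left_end j b y\<bar> < e" by metis
  have "Min (range \<delta>) > 0" using \<delta>(1) by (subst Min_gr_iff) auto
  moreover have "\<bar>y' - y\<bar> < \<delta> j" if "\<bar>y' - y\<bar> < Min (range \<delta>)" for y' j
    using that by (meson Min_le finite finite_imageI order_less_le_trans rangeI)
  ultimately show ?thesis using \<delta>(2) by blast
qed

lemma compact_tile_set: "compact tile_set"
proof -
  have "open (- tile_set)"
    unfolding open_dist
  proof
    fix v assume "v \<in> - tile_set"
    define y where "y = v $ None"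
    show "\<exists>e>0. \<forall>w. dist w v < e \<longrightarrow> w \<in> - tile_set"
    proof (cases "y \<in> {lo..hi}")
      case False
      have "open {w :: real ^ 'n option. w $ None \<in> - {lo..hi}}"
        by (rule open_vimage_vec_nth[of "- {lo..hi}" None, unfolded vimage_def]) auto
      moreover have "v \<in> {w. w $ None \<in> - {lo..hi}}" using False by (simp add: y_def)
      moreover have "{w. w $ None \<in> - {lo..hi}} \<subseteq> - tile_set" by (auto simp: tile_set_def)
      ultimately show ?thesis unfolding open_dist by blast
    next
      case True
      have "\<exists>j. v $ Some j \<notin> {left_end j b y .. left_end j b y + 1}" for b
        using \<open>v \<in> - tile_set\<close> True by (auto simp: tile_set_def y_def)
      then obtain j where j: "\<And>b. v $ Some (j b) \<notin> {left_end (j b) b y .. left_end (j b) b y + 1}" by metis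
      \<comment> \<open>\<open>gap b\<close> measures how far \<open>v\<close> is outside the box of
        convention \<open>b\<close>, in a coordinate where it is missed. Boxes just above height
        \<open>y\<close> are near the \<open>True\<close> one, those just below near the
        \<open>False\<close> one; half the gap is spent on the motion of the box, half on that of
        the point.\<close>
      define gap where "gap = (\<lambda>b. max (left_end (j b) b y - v $ Some (j b)) (v $ Some (j b) - left_end (j b) b y - 1))"
      have gap: "gap b > 0" for b using j[of b] by (auto simp: gap_def)
      have "\<exists>\<delta>>0. \<forall>j. \<forall>y'\<in>{lo..hi}. \<bar>y' - y\<bar> < \<delta> \<and> (if b then y < y' else y' < y) \<longrightarrow>
          (\<forall>c. \<bar>left_end j c y' - left_end j b y\<bar> < gap b / 2)" for b
        by (rule path_limit[OF True half_gt_zero[OF gap]])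
      then obtain \<delta> where \<delta>: "\<And>b. \<delta> b > 0" "\<And>b j y' c. y' \<in> {lo..hi} \<Longrightarrow> \<bar>y' - y\<bar> < \<delta> b \<Longrightarrow> (if b then y < y' else y' < y) \<Longrightarrow>
          \<bar>left_end j c y' - left_end j b y\<bar> < gap b / 2"
        by metis
      define e where "e = min (min (\<delta> True) (\<delta> False)) (min (gap True / 2) (gap False / 2))"
      have "e > 0" using \<delta>(1) gap by (simp add: e_def)
      moreover have "w \<notin> tile_set" if w: "dist w v < e" for w
      proof
        assume "w \<in> tile_set"
        define y' where "y' = w $ None"
        obtain c where c: "y' \<in> {lo..hi}" "\<And>j. w $ Some j \<in> {left_end j c y' .. left_end j c y' + 1}"
          using \<open>w \<in> tile_set\<close> by (auto simp: tile_set_def y'_def)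
        have comp: "\<bar>w $ i - v $ i\<bar> < e" for i
          using component_le_norm_cart[of "w - v" i] w by (simp add: dist_norm)
        obtain b where b: "\<bar>left_end (j b) c y' - left_end (j b) b y\<bar> < gap b / 2"
        proof (cases "y' = y")
          case True
          then show ?thesis using that[of c] gap[of c] by simp
        next
          case False
          define b where "b \<longleftrightarrow> y < y'"
          have "if b then y < y' else y' < y" using False by (auto simp: b_def)
          moreover have "\<bar>y' - y\<bar> < \<delta> b" using comp[of None] by (cases b) (auto simp: e_def y_def y'_def)
          ultimately show ?thesis using \<delta>(2)[OF c(1), of b "j b" c] that[of b] by blast
        qed
        moreover have "\<bar>w $ Some (j b) - v $ Some (j b)\<bar> < gap b / 2"
          using comp[of "Some (j b)"] by (cases b) (auto simp: e_def)
        ultimately show False using c(2)[of "j b"] unfolding gap_def by (auto simp: max_def abs_if split: if_splits)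
      qed
      ultimately show ?thesis by blast
    qed
  qed
  then have cl: "closed tile_set" by (simp add: closed_def)
  have "\<exists>B. \<forall>b. \<forall>y\<in>{lo..hi}. \<bar>path j b y\<bar> \<le> B" for j
    using digit_path.g_bounded[OF paths, of j "coord j" "s $ j"] unfolding path_def by blast
  then obtain B where B: "\<And>j b y. y \<in> {lo..hi} \<Longrightarrow> \<bar>path j b y\<bar> \<le> B j" by metis
  define c where "c = append_coord (\<chi> j. B j + \<bar>least_value (p (Some j))\<bar> + 1) (\<bar>lo\<bar> + 1)"
  have "tile_set \<subseteq> cbox (- c) c"
  proof
    fix v assume v: "v \<in> tile_set"
    have "- c $ i \<le> v $ i \<and> v $ i \<le> c $ i" for i
    proof (cases i)
      case None
      then show ?thesis using v by (auto simp: tile_set_def c_def append_coord_nth)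
    next
      case (Some j)
      obtain b where "v $ Some j \<in> {left_end j b (v $ None) .. left_end j b (v $ None) + 1}" "v $ None \<in> {lo..hi}"
        using v by (auto simp: tile_set_def)
      then show ?thesis using B[of "v $ None" j b] Some by (auto simp: c_def append_coord_nth left_end_def)
    qed
    then show "v \<in> cbox (- c) c" by (simp add: mem_box_cart)
  qed
  then have "bounded tile_set" using bounded_cbox bounded_subset by blast
  with cl show ?thesis by (simp add: compact_eq_bounded_closed)
qed

lemma tile_set_nonempty: "tile_set \<noteq> {}"
proof -
  have "append_coord (\<chi> j. left_end j True lo) lo \<in> tile_set"
    by (auto simp: tile_set_def append_coord_nth intro!: exI[of _ True])
  then show ?thesis by blast
qed

lemma self_affine_set_eq: "self_affine_set (tile_matrix p s) (tile_digits p a) = tile_set"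
  unfolding self_affine_set_def
proof (rule the_equality)
  show "tile_set \<noteq> {} \<and> compact tile_set \<and>
    (\<lambda>x. tile_matrix p s *v x) ` tile_set = {t + d | t d. t \<in> tile_set \<and> d \<in> tile_digits p a}"
    using tile_set_nonempty compact_tile_set tile_set_eq by blast
  fix T assume T: "T \<noteq> {} \<and> compact T \<and> (\<lambda>x. tile_matrix p s *v x) ` T = {t + d | t d. t \<in> T \<and> d \<in> tile_digits p a}"
  show "T = tile_set"
    using self_affine_unique[where T = T and U = tile_set and p = p and s = s and D = "tile_digits p a", OF p]
      self_affine_unique[where T = tile_set and U = T and p = p and s = s and D = "tile_digits p a", OF p]
      T tile_set_nonempty compact_tile_set tile_set_eq by blast
qed

end

section \<open>Connectedness of the interior\<close>

context tile
begin

definition jump_size :: "nat \<Rightarrow> 'n \<Rightarrow> real" where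
  "jump_size k j = (a (k + 1) $ j - a k $ j) / of_int (p (Some j))
            - (of_int (sgn (p None)) * a (nat \<bar>p None\<bar> - 1) $ j + s $ j)
              / (of_int (p (Some j)) * (of_int (p (Some j)) - of_int (sgn (p None))))"

lemma first_jump_eq: "digit_path.first_jump (p None) (p (Some j)) (coord j) (s $ j) (int k) = jump_size k j"
proof -
  have "nat (\<bar>p None\<bar> - 1) = nat \<bar>p None\<bar> - 1" "nat (int k + 1) = k + 1" by auto
  then show ?thesis unfolding digit_path.first_jump_def[OF paths] jump_size_def by simp
qed

lemma jump_size_occurs:
  assumes "k < nat \<bar>p None\<bar> - 1"
  shows "\<exists>y. lo < y \<and> y < hi \<and> \<bar>path j True y - path j False y\<bar> = \<bar>jump_size k j\<bar>"
proof -
  have k: "0 \<le> int k" "int k + 1 < \<bar>p None\<bar>" "coord j 0 = 0" using assms a0 by auto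
  note occurs = digit_path.first_jump_occurs[where A = "coord j" and k = "int k", OF paths[of j] k]
  show ?thesis
    unfolding path_def first_jump_eq[symmetric]
    by (intro exI[of _ "(lo + real_of_int (int k) + 1) / real_of_int (p None)"] conjI; rule occurs)
qed

lemma path_jump_le:
  assumes "0 \<le> M" "\<And>k. k < nat \<bar>p None\<bar> - 1 \<Longrightarrow> \<bar>jump_size k j\<bar> \<le> M" and y: "y \<in> {lo..hi}"
  shows "\<bar>path j True y - path j False y\<bar> \<le> M"
  unfolding path_def
proof (rule digit_path.jump_le[OF paths order_refl _ assms(1) _ y])
  fix y assume y: "y \<in> {lo..hi}"
  show "succ b y \<in> {lo..hi}" for b using digit_range(3)[OF y] .
  assume "digit True y \<noteq> digit False y"
  then obtain k where k: "0 \<le> k" "k + 1 < \<bar>p None\<bar>"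
    "\<bar>digit_path.g (p None) (p (Some j)) (coord j) (s $ j) True y - digit_path.g (p None) (p (Some j)) (coord j) (s $ j) False y\<bar>
      = \<bar>digit_path.first_jump (p None) (p (Some j)) (coord j) (s $ j) k\<bar>"
    using digit_path.jump_first_jump[OF paths y, of "coord j" j "s $ j"] a0 by auto
  then have "\<bar>digit_path.first_jump (p None) (p (Some j)) (coord j) (s $ j) k\<bar> \<le> M"
    using first_jump_eq[of j "nat k"] assms(2)[of "nat k"] by auto
  with k(3) show "\<bar>digit_path.g (p None) (p (Some j)) (coord j) (s $ j) True y - digit_path.g (p None) (p (Some j)) (coord j) (s $ j) False y\<bar> \<le> M"
    by simp
qed

lemma countable_path_jumps: "countable {y \<in> {lo..hi}. \<exists>j. path j True y \<noteq> path j False y}"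
proof -
  have "countable (\<Union>j. {y \<in> {lo..hi}. path j True y \<noteq> path j False y})"
    unfolding path_def using digit_path.countable_jumps[OF paths] by (intro countable_UN) auto
  moreover have "{y \<in> {lo..hi}. \<exists>j. path j True y \<noteq> path j False y} = (\<Union>j. {y \<in> {lo..hi}. path j True y \<noteq> path j False y})"
    by blast
  ultimately show ?thesis by simp
qed

text \<open>Jumps occur at countably many heights, so the range contains a height without one. There
  the boxes vary continuously and the centre is interior: of its distance 1/2 to the faces, 1/4
  absorbs the motion of the box and 1/4 that of the point.\<close>

lemma interior_tile_level:
  assumes lu: "lo \<le> l" "l < u" "u \<le> hi"
  shows "\<exists>v\<in>interior tile_set. l < v $ None \<and> v $ None < u"
proof -
  have "uncountable {l<..<u}" using lu(2) by (simp add: uncountable_open_interval)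
  then have "\<not> {l<..<u} \<subseteq> {y \<in> {lo..hi}. \<exists>j. path j True y \<noteq> path j False y}"
    using countable_path_jumps countable_subset by blast
  then obtain y where ly: "l < y" "y < u" and "\<And>j. path j True y = path j False y" using lu by force
  then have eq: "left_end j b y = left_end j True y" for j b by (cases b) (auto simp: left_end_def)
  have y: "y \<in> {lo..hi}" using ly lu by auto
  obtain \<delta> where \<delta>: "\<And>b. \<delta> b > 0" "\<And>b j y' c. y' \<in> {lo..hi} \<Longrightarrow> \<bar>y' - y\<bar> < \<delta> b \<Longrightarrow> (if b then y < y' else y' < y) \<Longrightarrow>
      \<bar>left_end j c y' - left_end j b y\<bar> < 1/4"
    using path_limit[OF y, of "1/4"] by (metis zero_less_divide_1_iff zero_less_numeral)
  define e where "e = min (min (1/4) (min (\<delta> True) (\<delta> False))) (min (y - l) (u - y))"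
  have e: "e > 0" using \<delta>(1) ly by (simp add: e_def)
  define v where "v = append_coord (\<chi> j. left_end j True y + 1/2) y"
  have "ball v e \<subseteq> tile_set"
  proof
    fix w assume w: "w \<in> ball v e"
    have comp: "\<bar>w $ i - v $ i\<bar> < e" for i
      using component_le_norm_cart[of "w - v" i] w by (simp add: dist_norm norm_minus_commute)
    define y' where "y' = w $ None"
    have y': "\<bar>y' - y\<bar> < e" using comp[of None] by (simp add: y'_def v_def append_coord_nth)
    then have I: "y' \<in> {lo..hi}" using lu by (auto simp: e_def)
    have 1: "\<bar>left_end j True y' - left_end j True y\<bar> < 1/4" for j
    proof (cases "y' = y")
      case False
      define b where "b \<longleftrightarrow> y < y'"
      have "if b then y < y' else y' < y" using False by (auto simp: b_def)
      moreover have "\<bar>y' - y\<bar> < \<delta> b" using y' by (cases b) (auto simp: e_def)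
      ultimately have "\<bar>left_end j True y' - left_end j b y\<bar> < 1/4" using \<delta>(2)[OF I] by blast
      then show ?thesis by (simp only: eq[of j b])
    qed simp
    have 2: "\<bar>w $ Some j - (left_end j True y + 1/2)\<bar> < 1/4" for j
      using comp[of "Some j"] by (simp add: v_def append_coord_nth e_def)
    have "w $ Some j \<in> {left_end j True y' .. left_end j True y' + 1}" for j
      using 1[of j] 2[of j] unfolding atLeastAtMost_iff by linarith
    then show "w \<in> tile_set" using I unfolding tile_set_def y'_def by blast
  qed
  then have "v \<in> interior tile_set" using e by (meson centre_in_ball interior_maximal open_ball subsetD)
  moreover have "v $ None = y" by (simp add: v_def append_coord_nth)
  ultimately show ?thesis using ly by auto
qed

text \<open>A neighbourhood of an interior point at height \<open>y\<close> meets heights on both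
  sides. Letting these tend to \<open>y\<close> puts the whole segment of half-length
  \<open>e / 4\<close> in direction \<open>j\<close> into both closed unit intervals, which then
  overlap with positive length.\<close>

lemma interior_tile_avoids_large_jump:
  assumes y: "lo < y" "y < hi" and jump: "1 \<le> \<bar>path j True y - path j False y\<bar>"
    and v: "v \<in> interior tile_set"
  shows "v $ None \<noteq> y"
proof
  assume vy: "v $ None = y"
  obtain e where e: "e > 0" "ball v e \<subseteq> tile_set" using v mem_interior by blast
  have yI: "y \<in> {lo..hi}" using y by auto
  have *: "v $ Some j + h \<in> {left_end j b y .. left_end j b y + 1}" if h: "\<bar>h\<bar> \<le> e / 4" for b h
  proof -
    have near: "left_end j b y - \<epsilon> \<le> v $ Some j + h \<and> v $ Some j + h \<le> left_end j b y + 1 + \<epsilon>" if \<epsilon>: "\<epsilon> > 0" for \<epsilon>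
    proof -
      obtain \<delta> where \<delta>: "\<delta> > 0" "\<And>j y' c. y' \<in> {lo..hi} \<Longrightarrow> \<bar>y' - y\<bar> < \<delta> \<Longrightarrow> (if b then y < y' else y' < y) \<Longrightarrow>
          \<bar>left_end j c y' - left_end j b y\<bar> < \<epsilon>"
        using path_limit[OF yI \<epsilon>, of b] by blast
      define t where "t = min (min (\<delta> / 2) (e / 4)) (min (hi - y) (y - lo))"
      have t: "t > 0" "t < \<delta>" "t \<le> e / 4" "t \<le> hi - y" "t \<le> y - lo" using \<delta>(1) e(1) y unfolding t_def by (simp_all only: min_less_iff_conj) linarith+
      define t' where "t' = (if b then t else - t)"
      define w where "w = v + (axis (Some j) h + axis None t')"
      have norm_axis: "norm (axis i x :: real ^ 'n option) = \<bar>x\<bar>" for i x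
      proof -
        have "axis i x = x *\<^sub>R (axis i 1 :: real ^ 'n option)" by (simp add: axis_def vec_eq_iff)
        then show ?thesis by simp
      qed
      have "dist w v \<le> \<bar>h\<bar> + \<bar>t'\<bar>"
        using norm_triangle_ineq[of "axis (Some j) h :: real ^ 'n option" "axis None t'"] by (simp add: w_def dist_norm norm_axis)
      also have "\<dots> < e" using h t e(1) by (simp add: t'_def)
      finally have "w \<in> tile_set" using e(2) by (auto simp: dist_commute)
      then obtain c where c: "w $ None \<in> {lo..hi}" "\<And>j. w $ Some j \<in> {left_end j c (w $ None) .. left_end j c (w $ None) + 1}"
        unfolding tile_set_def by blast
      have w: "w $ None = y + t'" "w $ Some j = v $ Some j + h" by (simp_all add: w_def axis_def vy)
      have I: "y + t' \<in> {lo..hi}" using c(1) w(1) by simp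
      have "v $ Some j + h \<in> {left_end j c (y + t') .. left_end j c (y + t') + 1}" using c(2)[of j] w by simp
      moreover have "\<bar>left_end j c (y + t') - left_end j b y\<bar> < \<epsilon>"
        using t by (intro \<delta>(2)[OF I]) (auto simp: t'_def)
      ultimately show ?thesis by auto
    qed
    have "left_end j b y \<le> v $ Some j + h"
    proof (rule field_le_epsilon)
      show "left_end j b y \<le> v $ Some j + h + \<epsilon>" if "\<epsilon> > 0" for \<epsilon> using near[OF that] by linarith
    qed
    moreover have "v $ Some j + h \<le> left_end j b y + 1"
    proof (rule field_le_epsilon)
      show "v $ Some j + h \<le> left_end j b y + 1 + \<epsilon>" if "\<epsilon> > 0" for \<epsilon> using near[OF that] by linarith
    qed
    ultimately show ?thesis by simp
  qed
  have "\<bar>left_end j True y - left_end j False y\<bar> < 1"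
    using *[of "e / 4" True] *[of "e / 4" False] *[of "- (e / 4)" True] *[of "- (e / 4)" False] e(1) by auto
  with jump show False by (simp add: left_end_def)
qed

lemma connected_interior_imp:
  assumes con: "connected (interior tile_set)" and k: "k < nat \<bar>p None\<bar> - 1"
  shows "\<bar>jump_size k j\<bar> < 1"
proof (rule ccontr)
  assume "\<not> \<bar>jump_size k j\<bar> < 1"
  then obtain y where y: "lo < y" "y < hi" "1 \<le> \<bar>path j True y - path j False y\<bar>"
    using jump_size_occurs[OF k, of j] by auto
  obtain v where v: "v \<in> interior tile_set" "v $ None < y" using interior_tile_level[of lo y] y by auto
  obtain w where w: "w \<in> interior tile_set" "y < w $ None" using interior_tile_level[of y hi] y by auto
  obtain z where "z \<in> interior tile_set" "z $ None = y"
    using connected_ivt_component_cart[OF con v(1) w(1), of None y] v(2) w(2) by auto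
  then show False using interior_tile_avoids_large_jump[OF y] by blast
qed

section \<open>Small jumps make the tile a ball\<close>

lemma tame_ball_tile_set:
  assumes small: "\<And>k j. k < nat \<bar>p None\<bar> - 1 \<Longrightarrow> \<bar>jump_size k j\<bar> < 1"
  shows "tame_ball tile_set"
proof -
  define G where "G = (\<lambda>b y. \<chi> j. left_end j b (clip lo hi y))"
  have clip: "clip lo hi y \<in> {lo..hi}" for y by auto
  have R: "right_limit (G c) (G True)" and L: "left_limit (G c) (G False)" for c
    using digit_path.right_limit_g[OF paths] digit_path.left_limit_g[OF paths]
    unfolding right_limit_def left_limit_def G_def left_end_def path_def
    by (auto intro!: vec_tendstoI tendsto_add)
  have jump: "\<bar>G True y $ j - G False y $ j\<bar> < 1" for y j
  proof -
    \<comment> \<open>The bound for jumps at deeper digits passes through a limit and yields only a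
      weak inequality, so the finitely many first jumps need a common bound below 1.\<close>
    define M where "M = Max (insert 0 ((\<lambda>k. \<bar>jump_size k j\<bar>) ` {..<nat \<bar>p None\<bar> - 1}))"
    have "M < 1" unfolding M_def using small by (subst Max_less_iff) auto
    moreover have "0 \<le> M" "\<And>k. k < nat \<bar>p None\<bar> - 1 \<Longrightarrow> \<bar>jump_size k j\<bar> \<le> M"
      unfolding M_def by (intro Max_ge; simp)+
    then have "\<bar>path j True (clip lo hi y) - path j False (clip lo hi y)\<bar> \<le> M"
      by (rule path_jump_le[OF _ _ clip])
    ultimately show ?thesis by (simp add: G_def left_end_def)
  qed
  define S where "S = {y. G False y \<noteq> G True y}"
  have ends: "G False y = G True y" if "y \<le> lo \<or> hi \<le> y" for y
  proof -
    have "clip lo hi y \<in> {lo, hi}" using that by auto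
    then show ?thesis unfolding G_def left_end_def using path_ends by (simp add: vec_eq_iff)
  qed
  have "S \<subseteq> {y \<in> {lo..hi}. \<exists>j. path j True y \<noteq> path j False y}"
  proof
    fix y assume y: "y \<in> S"
    then have I: "\<not> (y \<le> lo \<or> hi \<le> y)" using ends by (auto simp: S_def)
    then have "clip lo hi y = y" by auto
    then have "\<exists>j. path j True y \<noteq> path j False y" using y by (simp add: S_def G_def left_end_def vec_eq_iff) metis
    with I show "y \<in> {y \<in> {lo..hi}. \<exists>j. path j True y \<noteq> path j False y}" by auto
  qed
  then have cS: "countable (insert (lo + 1/2) S)" using countable_path_jumps countable_subset by blast
  \<comment> \<open>The extra height makes the set nonempty, hence enumerable, when the path has no
    jumps; blowing it up inserts a cylinder. It is the midpoint because the ends must not be blown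
    up.\<close>
  define d where "d = from_nat_into (insert (lo + 1/2) S)"
  have rd: "range d = insert (lo + 1/2) S" unfolding d_def using range_from_nat_into[OF _ cS] by blast
  have col: "regulated_column (G False) (G True) d lo hi"
  proof
    show "y \<in> range d" if "G False y \<noteq> G True y" for y using that by (auto simp: rd S_def)
    show "lo \<notin> range d" "hi \<notin> range d" unfolding rd S_def using ends by auto
  qed (use R L jump in auto)
  define E where "E = {(x, y). y \<in> {lo..hi} \<and> (x \<in> cbox (G False y) (G False y + 1) \<or> x \<in> cbox (G True y) (G True y + 1))}"
  obtain f g where fg: "homeomorphism UNIV UNIV f g" "f ` E = cbox (-1 :: real ^ 'n) 1 \<times> {-1..1 :: real}"
    using regulated_column.homeomorphism_to_cube[OF col] unfolding E_def by blast
  define J where "J = (\<lambda>z :: (real ^ 'n) \<times> real. append_coord (fst z) (snd z))"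
  define J' where "J' = (\<lambda>v :: real ^ 'n option. ((\<chi> j. v $ Some j), v $ None))"
  have JJ': "J (J' v) = v" "J' (J z) = z" for v z
    by (auto simp: J_def J'_def append_coord_nth vec_option_eq_iff prod_eq_iff)
  have "continuous_on UNIV (\<lambda>z :: (real ^ 'n) \<times> real. append_coord (fst z) (snd z) $ i)" for i
    by (cases i) (auto simp: append_coord_nth intro!: continuous_intros)
  then have cJ: "continuous_on UNIV J"
    unfolding J_def by (rule continuous_on_vec_lambda[of UNIV "\<lambda>i z. append_coord (fst z) (snd z) $ i", unfolded vec_lambda_eta])
  have cJ': "continuous_on UNIV J'"
    unfolding J'_def by (intro continuous_intros continuous_on_vec_lambda)
  have J: "homeomorphism UNIV UNIV J J'"
    by (rule homeomorphismI[OF cJ cJ']) (auto simp: JJ')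
  have "homeomorphism UNIV UNIV (J \<circ> (f \<circ> J')) (J \<circ> g \<circ> J')"
    by (rule homeomorphism_compose[OF homeomorphism_compose[OF homeomorphism_symD[OF J] fg(1)] J])
  moreover have "(J \<circ> (f \<circ> J')) ` tile_set = {x. infnorm x \<le> 1}"
  proof -
    have "J z \<in> tile_set \<longleftrightarrow> z \<in> E" for z
    proof (cases "snd z \<in> {lo..hi}")
      case True
      then have "clip lo hi (snd z) = snd z" by auto
      then show ?thesis using True
        by (auto simp: J_def tile_set_def E_def append_coord_nth mem_box_cart G_def split_beta ex_bool_eq)
    qed (auto simp: J_def tile_set_def E_def append_coord_nth)
    then have "J' ` tile_set = E" using JJ' by (auto simp: image_iff) (metis JJ')+
    moreover have "J ` (cbox (-1 :: real ^ 'n) 1 \<times> {-1..1 :: real}) = {x. infnorm x \<le> 1}"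
    proof -
      have iff: "infnorm (J z) \<le> 1 \<longleftrightarrow> z \<in> cbox (-1 :: real ^ 'n) 1 \<times> {-1..1 :: real}" for z
        unfolding infnorm_le_iff_cart split_option_all
        by (auto simp: J_def append_coord_nth mem_Times_iff mem_box_cart abs_le_iff minus_le_iff)
      show ?thesis
      proof (intro equalityI subsetI)
        fix x :: "real ^ 'n option" assume "x \<in> {x. infnorm x \<le> 1}"
        then show "x \<in> J ` (cbox (-1 :: real ^ 'n) 1 \<times> {-1..1 :: real})"
          using iff[of "J' x"] by (intro image_eqI[of _ _ "J' x"]) (auto simp: JJ')
      qed (use iff in auto)
    qed
    ultimately show ?thesis by (simp only: image_comp[symmetric] fg(2))
  qed
  ultimately show ?thesis by (rule tame_ballI)
qed

end


theorem theorem5p1: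
  fixes p :: "'n::finite option \<Rightarrow> int" and r :: int
    and s :: "real ^ 'n" and a :: "nat \<Rightarrow> real ^ 'n"
    and T :: "(real ^ 'n option) set"
  assumes p: "\<And>i. \<bar>p i\<bar> \<ge> 2"
    and r: "r = p None"
    and a0: "a 0 = 0"
    and T: "T = self_affine_set (tile_matrix p s) (tile_digits p a)"
  shows "(connected (interior T) \<longleftrightarrow> tame_ball T) \<and>
    (tame_ball T \<longleftrightarrow>
      Max {\<bar>(a (k + 1) $ j - a k $ j) / of_int (p (Some j))
            - (of_int (sgn r) * a (nat \<bar>r\<bar> - 1) $ j + s $ j)
              / (of_int (p (Some j)) * (of_int (p (Some j)) - of_int (sgn r)))\<bar>
          | k j. k < nat \<bar>r\<bar> - 1} < 1)"
proof -
  note r_eq = r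
  interpret tile p s a
  proof unfold_locales
    show "2 \<le> \<bar>p i\<bar>" for i by (rule p)
    show "a 0 = 0" by (rule a0)
  qed
  have T': "T = tile_set" using T self_affine_set_eq by simp
  define S where "S = (\<lambda>(k, j). \<bar>jump_size k j\<bar>) ` ({..<nat \<bar>r\<bar> - 1} \<times> UNIV)"
  have S_eq: "{\<bar>(a (k + 1) $ j - a k $ j) / of_int (p (Some j))
            - (of_int (sgn r) * a (nat \<bar>r\<bar> - 1) $ j + s $ j)
              / (of_int (p (Some j)) * (of_int (p (Some j)) - of_int (sgn r)))\<bar>
          | k j. k < nat \<bar>r\<bar> - 1} = S"
    unfolding S_def r_eq jump_size_def[symmetric] by (force simp: image_iff)
  have "finite S" by (simp add: S_def)
  \<comment> \<open>The digits 0 and 1 always exist since \<open>\<bar>r\<bar> \<ge> 2\<close>, so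
    \<open>Max\<close> is taken over a nonempty finite set and has its intended meaning.\<close>
  moreover have "S \<noteq> {}" using p[of None] by (auto simp: S_def r_eq lessThan_empty_iff)
  ultimately have Max_S: "Max S < 1 \<longleftrightarrow> (\<forall>k j. k < nat \<bar>p None\<bar> - 1 \<longrightarrow> \<bar>jump_size k j\<bar> < 1)"
    by (subst Max_less_iff) (auto simp: S_def r_eq)
  have "connected (interior T)" if "tame_ball T"
    using tame_ball_connected_interior[OF that] .
  moreover have "Max S < 1" if "connected (interior T)"
    using connected_interior_imp that unfolding T' Max_S by blast
  moreover have "tame_ball T" if "Max S < 1"
    using tame_ball_tile_set that unfolding T' Max_S by blast
  ultimately show ?thesis unfolding S_eq by blast
qed

end
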